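(* Let $X$ be the strictly $\alpha$-stable process described in the context with $(\alpha,\rho)\in\mathcal{A}$ and $\alpha\in(1,2)$. Let $\tau_1^+=\inf\{t>0:X_t>1\}$ and $\tau_0=\inf\{t>0:X_t=0\}$. When $0<x<1$, \[ \mathrm{P}_x(\tau_0<\tau_1^+)=(\alpha-1)x^{\alpha-1}\int_1^{1/x}(t-1)^{\alpha\rho-1}t^{\alpha\hat\rho-1}\,\mathrm{d}t. \] When $x<0$, \[ \mathrm{P}_x(\tau_0<\tau_1^+)=(\alpha-1)(-x)^{\alpha-1}\int_1^{1-1/x}(t-1)^{\alpha\hat\rho-1}t^{\alpha\rho-1}\,\mathrm{d}t. \]
   Context: $X=(X_t)_{t\ge0}$ is a one-dimensional strictly $\alpha$-stable Lévy process: a Lévy process such that for every $c>0$, $(cX_{tc^{-\alpha}})_{t\ge0}$ has the same law as $X$. It has no Gaussian component and Lévy density $c_+x^{-(\alpha+1)}\mathbf 1_{\{x>0\}}+c_-|x|^{-(\alpha+1)}\mathbf 1_{\{x<0\}}$, normalised so that $c_+=\frac{\Gamma(\alpha+1)}{\Gamma(\alpha\rho)\Gamma(1-\alpha\rho)}$, $c_-=\frac{\Gamma(\alpha+1)}{\Gamma(\alpha\hat\rho)\Gamma(1-\alpha\hat\rho)}$, where $\rho=\mathrm{P}(X_t>0)$ and $\hat\rho=1-\rho$. The admissible set is $\mathcal{A}=\{(\alpha,\rho):\alpha\in(0,1),\rho\in(0,1)\}\cup\{(\alpha,\rho):\alpha\in(1,2),\rho\in(1-1/\alpha,1/\alpha)\}\cup\{(1,1/2)\}$.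 $\mathrm{P}_x$ is the law of $X+x$ when $X$ starts at $0$. *)

theory Defs
  imports "HOL-Probability.Probability"
begin

definition admissible :: "real \<Rightarrow> real \<Rightarrow> bool" where
  "admissible \<alpha> \<rho> \<longleftrightarrow>
     (0 < \<alpha> \<and> \<alpha> < 1 \<and> 0 < \<rho> \<and> \<rho> < 1)
   \<or> (1 < \<alpha> \<and> \<alpha> < 2 \<and> 1 - 1 / \<alpha> < \<rho> \<and> \<rho> < 1 / \<alpha>)
   \<or> (\<alpha> = 1 \<and> \<rho> = 1 / 2)"

definition c_plus :: "real \<Rightarrow> real \<Rightarrow> real" where
  "c_plus \<alpha> \<rho> = Gamma (\<alpha> + 1) / (Gamma (\<alpha> * \<rho>) * Gamma (1 - \<alpha> * \<rho>))"

definition c_minus :: "real \<Rightarrow> real \<Rightarrow> real" where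
  "c_minus \<alpha> \<rho> = Gamma (\<alpha> + 1) / (Gamma (\<alpha> * (1 - \<rho>)) * Gamma (1 - \<alpha> * (1 - \<rho>)))"

definition levy_density :: "real \<Rightarrow> real \<Rightarrow> real \<Rightarrow> real" where
  "levy_density \<alpha> \<rho> y =
     (if y > 0 then c_plus \<alpha> \<rho> * y powr (-(\<alpha> + 1))
      else if y < 0 then c_minus \<alpha> \<rho> * (-y) powr (-(\<alpha> + 1))
      else 0)"

definition levy_process :: "'a measure \<Rightarrow> (real \<Rightarrow> 'a \<Rightarrow> real) \<Rightarrow> bool" where
  "levy_process M X \<longleftrightarrow>
     prob_space M
   \<and> (\<forall>t\<ge>0. X t \<in> borel_measurable M)
   \<and> (\<forall>\<omega>\<in>space M. X 0 \<omega> = 0)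
   \<and> (\<forall>\<omega>\<in>space M. \<forall>t\<ge>0. continuous (at_right t) (\<lambda>s. X s \<omega>)
                         \<and> (t > 0 \<longrightarrow> (\<exists>l. ((\<lambda>s. X s \<omega>) \<longlongrightarrow> l) (at_left t))))
   \<and> (\<forall>(ts :: nat \<Rightarrow> real) n. 0 \<le> ts 0 \<and> (\<forall>i<n. ts i < ts (Suc i)) \<longrightarrow>
        prob_space.indep_vars M (\<lambda>_. borel) (\<lambda>i \<omega>. X (ts (Suc i)) \<omega> - X (ts i) \<omega>) {..<n})
   \<and> (\<forall>s t. 0 \<le> s \<and> s \<le> t \<longrightarrow>
        distr M borel (\<lambda>\<omega>. X t \<omega> - X s \<omega>) = distr M borel (X (t - s)))"

definition strictly_stable_process ::
  "'a measure \<Rightarrow> (real \<Rightarrow> 'a \<Rightarrow> real) \<Rightarrow> real \<Rightarrow> real \<Rightarrow> bool" where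
  "strictly_stable_process M X \<alpha> \<rho> \<longleftrightarrow>
     levy_process M X
   \<comment> \<open>self-similarity: (c X_{t c^{-alpha}}) has the same law (finite-dim. distributions) as X\<close>
   \<and> (\<forall>c>0. \<forall>J. finite J \<and> J \<subseteq> {0..} \<longrightarrow>
        distr M (PiM J (\<lambda>_. borel)) (\<lambda>\<omega>. \<lambda>t\<in>J. c * X (t * c powr (-\<alpha>)) \<omega>)
      = distr M (PiM J (\<lambda>_. borel)) (\<lambda>\<omega>. \<lambda>t\<in>J. X t \<omega>))
   \<comment> \<open>Levy-Khintchine: no Gaussian part, Levy density levy_density, some drift a\<close>
   \<and> (\<exists>a::real. \<forall>t\<ge>0. \<forall>\<theta>::real.
        char (distr M borel (X t)) \<theta>
      = exp (complex_of_real t *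
             (\<i> * complex_of_real (a * \<theta>)
              + (CLINT y|lborel. (iexp (\<theta> * y) - 1 - \<i> * complex_of_real (\<theta> * y * indicator {-1<..<1} y))
                                  * complex_of_real (levy_density \<alpha> \<rho> y)))))
   \<comment> \<open>rho = P(X_t > 0)\<close>
   \<and> (\<forall>t>0. measure M {\<omega>\<in>space M. X t \<omega> > 0} = \<rho>)"

text \<open>First passage above level b and first hitting time of the point a, for the process x + X
  (i.e. under P_x); infimum of the empty set is \<infinity>.\<close>
definition first_passage_above :: "(real \<Rightarrow> 'a \<Rightarrow> real) \<Rightarrow> real \<Rightarrow> real \<Rightarrow> 'a \<Rightarrow> ereal" where
  "first_passage_above X x b \<omega> = Inf (ereal ` {t. t > 0 \<and> x + X t \<omega> > b})"

definition first_hitting_point :: "(real \<Rightarrow> 'a \<Rightarrow> real) \<Rightarrow> real \<Rightarrow> real \<Rightarrow> 'a \<Rightarrow> ereal" where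
  "first_hitting_point X x a \<omega> = Inf (ereal ` {t. t > 0 \<and> x + X t \<omega> = a})"

end

(* Write b = alpha rho and g = alpha (1 - rho), so that the characteristic exponent factorises (Wiener-Hopf) as
   psi(u) = - (i u)^g (- i u)^b. The claimed probability is a constant multiple of
   H(x) = INT_0^1 s^(g - 1) (s - x)_+^(b - 1) ds, and (s - x)_+^(b - 1) has Fourier transform proportional to
   (- i u)^(- b). Applying the generator to H therefore leaves, up to a constant, (i u)^g acting on
   s^(g - 1) 1_(0,1)(s), that is, the derivative of
   w(x) = INT_0^1 s^(g - 1) (x - s)_+^(- g) ds,
   and w is 0 on the negative axis and equal to the constant B(g, 1 - g) on (0, 1). Hence H is harmonic for X away from
   0 and below 1, which is made rigorous by smoothing H with Gaussians of variance tending to 0. Optional stopping at the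
   entrance of a neighbourhood of 0 or of a half-line [a, oo), together with H = 0 on [1, oo), the continuity of H at 0
   and at 1, the decay of E H(X_t), and quasi-left-continuity when the neighbourhoods shrink to 0, gives
   P_x(tau_0 < tau_1^+) = H(x) / H(0). All processes are observed on dyadic time grids, for which stopping
   arguments reduce to finite telescoping sums over independent increments. *)
theory Submission
  imports Defs "HOL-Real_Asymp.Real_Asymp"
begin

section \<open>The Laplace transform of a power function\<close>

text \<open>The Levy triplet fixes the exponent only up to a drift; self-similarity with factor 2 at
  single times removes it, because \<alpha> differs from 1. The function w is constant only on each
  side of 0 and only up to the cut-off level, so harmonicity fails at 0 and at the cut-off, and
  every estimate keeps a distance \<eta> from both. For this reason H carries a level c: the lower
  bound uses c = 1 and stops above some a < 1, the upper bound uses c > 1 and stops above some a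
  with 1 < a < c, and the error made by moving c is controlled separately. Smoothing keeps the
  Fourier density of H integrable even after multiplication by the squared modulus of the exponent,
  which the second-order error of the grid approximation requires; the smoothing error is of order
  1/s and vanishes for fixed \<eta>. The hitting event involves uncountably many times. It is
  enclosed between measurable sets of nearly equal probability, hence the completion of the measure.
  The prefactor \<alpha> - 1 is 1/H(0).\<close>

definition pos_powr :: "real \<Rightarrow> real \<Rightarrow> real" where
  "pos_powr s z = (if 0 < z then z powr (s - 1) else 0)"

lemma pos_powr_nonneg [simp]: "0 \<le> pos_powr s z"
  by (simp add: pos_powr_def)

lemma pos_powr_measurable [measurable]: "pos_powr s \<in> borel_measurable borel"
  unfolding pos_powr_def by measurable

text \<open>Mean value bound on the disc of radius |z|. The factor \<open>exp (norm z)\<close> is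
  the price for allowing either sign of the real part, as happens for the increments of a complex
  difference quotient.\<close>

lemma norm_exp_diff_1: "norm (exp z - 1) \<le> norm z * exp (norm z)" for z :: complex
proof -
  have "norm (exp z - exp 0) \<le> exp (norm z) * norm (z - 0)"
  proof (rule field_differentiable_bound[where S="cball 0 (norm z)"])
    show "(exp has_field_derivative exp w) (at w within cball 0 (norm z))" for w :: complex
      by (auto intro!: derivative_eq_intros)
    show "norm (exp w) \<le> exp (norm z)" if "w \<in> cball 0 (norm z)" for w :: complex
      using that norm_exp[of w] by (auto intro: order_trans)
  qed auto
  then show ?thesis by (simp add: mult.commute)
qed

lemma pos_powr_exp_integrable:
  assumes "0 < s" "0 < a"
  shows "integrable lborel (\<lambda>z. pos_powr s z * exp (- a * z))"
proof -
  have "integrable lebesgue (\<lambda>t. indicator {0<..} t *\<^sub>R (complex_of_real t powr (complex_of_real s - 1) / of_real (exp (a * t))))"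
    using absolutely_integrable_Gamma_integral[of "of_real s" a] assms
    by (simp add: set_integrable_def)
  from integrable_norm[OF this]
  have "integrable lebesgue (\<lambda>t. pos_powr s t * exp (- a * t))"
  proof (rule Bochner_Integration.integrable_cong[THEN iffD1, OF refl, rotated])
    fix t :: real
    have "norm (complex_of_real t powr (complex_of_real s - 1)) = t powr (s - 1)" if "0 < t"
      using that by (subst norm_powr_real_powr) auto
    then show "norm (indicator {0<..} t *\<^sub>R (complex_of_real t powr (complex_of_real s - 1) / of_real (exp (a * t))))
      = pos_powr s t * exp (- a * t)"
      by (auto simp: pos_powr_def norm_divide exp_minus field_simps)
  qed
  then show ?thesis by (subst (asm) integrable_completion) auto
qed

lemma pos_powr_exp_integral:
  assumes "0 < s"
  shows "(\<integral>z. pos_powr s z * exp (- z) \<partial>lborel) = Gamma s"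
proof -
  have "ennreal (\<integral>z. pos_powr s z * exp (- z) \<partial>lborel) = (\<integral>\<^sup>+z. ennreal (pos_powr s z * exp (- z)) \<partial>lborel)"
    using pos_powr_exp_integrable[OF assms, of 1] by (subst nn_integral_eq_integral) auto
  also have "\<dots> = nn_integral lborel (\<lambda>t. ennreal (indicator {0..} t * t powr (s - 1) / exp t))"
    by (intro nn_integral_cong_AE AE_I[where N="{0}"])
       (auto simp: pos_powr_def exp_minus divide_simps indicator_def split: if_splits)
  also have "\<dots> = Gamma s" using Gamma_conv_nn_integral_real[OF assms] by simp
  finally show ?thesis
    by (subst (asm) ennreal_inj) (auto intro!: integral_nonneg_AE Gamma_real_pos[THEN less_imp_le] assms)
qed

lemma pos_powr_cexp_integrable:
  assumes "0 < s" "0 < Re w"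
  shows "integrable lborel (\<lambda>z. complex_of_real (pos_powr s z) * exp (- w * of_real z))"
proof (rule Bochner_Integration.integrable_bound[OF pos_powr_exp_integrable[OF assms]])
  show "AE z in lborel. norm (complex_of_real (pos_powr s z) * exp (- w * of_real z)) \<le> norm (pos_powr s z * exp (- Re w * z))"
    by (auto simp: norm_mult norm_exp)
qed measurable

lemma pos_powr_Suc: "pos_powr (s + 1) z = z * pos_powr s z"
  by (auto simp: pos_powr_def powr_mult_base)

text \<open>Integration by parts: z^s exp(-w z) vanishes at 0 because s > 0 and at infinity because
  Re w > 0, so its derivative integrates to 0. The identity is the differential equation that
  determines the Laplace transform.\<close>

lemma pos_powr_cexp_parts:
  assumes s: "0 < s" and w: "0 < Re w"
  shows "w * (\<integral>z. complex_of_real (pos_powr (s + 1) z) * exp (- w * of_real z) \<partial>lborel)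
    = of_real s * (\<integral>z. complex_of_real (pos_powr s z) * exp (- w * of_real z) \<partial>lborel)"
proof -
  define F where "F = (\<lambda>z::real. complex_of_real (z powr s) * exp (- w * of_real z))"
  define f where "f = (\<lambda>z::real. of_real s * (complex_of_real (z powr (s - 1)) * exp (- w * of_real z)) - w * (complex_of_real (z powr s) * exp (- w * of_real z)))"
  define g where "g = (\<lambda>z::real. of_real s * (complex_of_real (pos_powr s z) * exp (- w * of_real z)) - w * (complex_of_real (pos_powr (s + 1) z) * exp (- w * of_real z)))"
  have gi: "integrable lborel g"
    unfolding g_def using pos_powr_cexp_integrable[OF s w] pos_powr_cexp_integrable[of "s+1" w] s w
    by (intro Bochner_Integration.integrable_diff integrable_mult_right) auto
  have eq: "indicator (einterval 0 \<infinity>) z *\<^sub>R f z = g z" for z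
    by (auto simp: f_def g_def pos_powr_def indicator_def einterval_def zero_ereal_def)
  have "(LBINT z=0..\<infinity>. f z) = 0 - 0"
  proof (rule interval_integral_FTC_integrable[where F=F])
    show "(F has_vector_derivative f x) (at x)" if "0 < ereal x" for x
    proof -
      have x: "0 < x" using that by simp
      have "((\<lambda>z. complex_of_real (z powr s)) has_vector_derivative of_real (s * x powr (s - 1))) (at x)"
        using x by (intro has_vector_derivative_of_real) (auto simp: has_real_derivative_iff_has_vector_derivative[symmetric] intro!: derivative_eq_intros)
      moreover have "((\<lambda>z. exp (- w * of_real z)) has_vector_derivative (- w * exp (- w * of_real x))) (at x)"
        by (rule has_vector_derivative_real_field) (auto intro!: derivative_eq_intros)
      ultimately have "(F has_vector_derivative complex_of_real (x powr s) * (- w * exp (- w * of_real x)) + of_real (s * x powr (s - 1)) * exp (- w * of_real x)) (at x)"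
        unfolding F_def by (rule has_vector_derivative_mult)
      then show ?thesis by (simp add: f_def algebra_simps)
    qed
    show "isCont f x" if "0 < ereal x" for x
      using that unfolding f_def by (auto intro!: continuous_intros)
    show "set_integrable lborel (einterval 0 \<infinity>) f"
      using gi unfolding set_integrable_def eq .
    have nF: "norm (F z) = z powr s * exp (- Re w * z)" for z
      by (simp add: F_def norm_mult norm_exp)
    have "((\<lambda>z. z powr s) \<longlongrightarrow> 0 powr s) (at_right 0)"
      using s by (intro tendsto_powr' tendsto_intros) (auto simp: eventually_at_right_less eventually_at intro!: exI[of _ 1])
    then have z: "((\<lambda>z. z powr s) \<longlongrightarrow> 0) (at_right 0)" by simp
    have "((\<lambda>z. z powr s * exp (- Re w * z)) \<longlongrightarrow> 0 * exp (- Re w * 0)) (at_right 0)"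
      by (intro tendsto_mult z tendsto_intros)
    then have "(F \<longlongrightarrow> 0) (at_right 0)"
      by (subst tendsto_norm_zero_iff[symmetric]) (simp add: nF)
    then show "((F \<circ> real_of_ereal) \<longlongrightarrow> 0) (at_right 0)"
      by (simp add: zero_ereal_def ereal_tendsto_simps)
    have "((\<lambda>z. z powr s / exp (Re w * z)) \<longlongrightarrow> 0) at_top"
      using w s by real_asymp
    then have "(F \<longlongrightarrow> 0) at_top"
      by (subst tendsto_norm_zero_iff[symmetric]) (simp add: nF exp_minus field_simps)
    then show "((F \<circ> real_of_ereal) \<longlongrightarrow> 0) (at_left \<infinity>)"
      by (simp add: ereal_tendsto_simps)
  qed auto
  then have "integral\<^sup>L lborel g = 0"
    by (simp add: interval_lebesgue_integral_def set_lebesgue_integral_def eq)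
  then show ?thesis
    unfolding g_def using pos_powr_cexp_integrable[OF s w] pos_powr_cexp_integrable[of "s+1" w] s w
    by (subst (asm) Bochner_Integration.integral_diff) auto
qed

text \<open>Differentiation under the integral sign, by dominated convergence along an arbitrary
  sequence of complex increments.\<close>

lemma pos_powr_cexp_deriv:
  assumes s: "0 < s" and w: "0 < Re w"
  shows "((\<lambda>w. \<integral>z. complex_of_real (pos_powr s z) * exp (- w * of_real z) \<partial>lborel) has_field_derivative
    - (\<integral>z. complex_of_real (pos_powr (s + 1) z) * exp (- w * of_real z) \<partial>lborel)) (at w)"
  unfolding DERIV_def tendsto_at_iff_sequentially
proof (intro allI impI)
  fix h :: "nat \<Rightarrow> complex" assume h: "\<forall>i. h i \<in> UNIV - {0}" "h \<longlonglongrightarrow> 0"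
  let ?G = "\<lambda>w. \<integral>z. complex_of_real (pos_powr s z) * exp (- w * of_real z) \<partial>lborel"
  define q where "q = (\<lambda>i z. complex_of_real (pos_powr s z) * exp (- w * of_real z) * ((exp (- h i * of_real z) - 1) / h i))"
  \<comment> \<open>Half of the decay rate Re w absorbs the growth exp(|h| z) of the difference
    quotient, the other half keeps the majorant integrable.\<close>
  have "eventually (\<lambda>i. norm (h i) < Re w / 2) sequentially"
    using h(2) w by (auto simp: tendsto_iff dist_norm dest!: spec[of _ "Re w / 2"])
  then obtain N where N: "\<And>i. N \<le> i \<Longrightarrow> norm (h i) < Re w / 2"
    by (auto simp: eventually_sequentially)
  have hne: "h i \<noteq> 0" for i using h(1) by auto
  have "(\<lambda>i. integral\<^sup>L lborel (q (i + N))) \<longlonglongrightarrow> (\<integral>z. - (complex_of_real (pos_powr (s + 1) z) * exp (- w * of_real z)) \<partial>lborel)"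
  proof (rule integral_dominated_convergence[where w="\<lambda>z. pos_powr (s + 1) z * exp (- (Re w / 2) * z)"])
    show "integrable lborel (\<lambda>z. pos_powr (s + 1) z * exp (- (Re w / 2) * z))"
      using s w by (intro pos_powr_exp_integrable) auto
    show "AE z in lborel. (\<lambda>i. q (i + N) z) \<longlonglongrightarrow> - (complex_of_real (pos_powr (s + 1) z) * exp (- w * of_real z))"
    proof (intro AE_I2 LIMSEQ_ignore_initial_segment)
      fix z :: real
      have "((\<lambda>u. exp (- u * of_real z)) has_field_derivative (- of_real z)) (at (0::complex))"
        by (auto intro!: derivative_eq_intros)
      then have "(\<lambda>i. (exp (- h i * of_real z) - 1) / h i) \<longlonglongrightarrow> - of_real z"
        using h unfolding DERIV_def tendsto_at_iff_sequentially by (auto simp: o_def)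
      then have "(\<lambda>i. q i z) \<longlonglongrightarrow> complex_of_real (pos_powr s z) * exp (- w * of_real z) * - of_real z"
        unfolding q_def by (intro tendsto_intros)
      then show "(\<lambda>i. q i z) \<longlonglongrightarrow> - (complex_of_real (pos_powr (s + 1) z) * exp (- w * of_real z))"
        by (simp add: pos_powr_Suc mult_ac)
    qed
    show "AE z in lborel. norm (q (i + N) z) \<le> pos_powr (s + 1) z * exp (- (Re w / 2) * z)" for i
    proof (intro AE_I2)
      fix z :: real
      show "norm (q (i + N) z) \<le> pos_powr (s + 1) z * exp (- (Re w / 2) * z)"
      proof (cases "0 < z")
        case True
        let ?h = "h (i + N)"
        have "norm ((exp (- ?h * of_real z) - 1) / ?h) \<le> (norm (- ?h * of_real z) * exp (norm (- ?h * of_real z))) / norm ?h"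
          unfolding norm_divide by (intro divide_right_mono norm_exp_diff_1) auto
        also have "\<dots> = z * exp (norm ?h * z)"
          using hne True by (simp add: norm_mult)
        also have "\<dots> \<le> z * exp (Re w / 2 * z)"
          using True N[of "i + N"] by (intro mult_left_mono) auto
        finally have "norm (q (i + N) z) \<le> pos_powr s z * exp (- Re w * z) * (z * exp (Re w / 2 * z))"
          unfolding q_def norm_mult norm_exp norm_of_real by (intro mult_mono) auto
        also have "\<dots> = pos_powr (s + 1) z * (exp (- Re w * z) * exp (Re w / 2 * z))"
          by (simp add: pos_powr_Suc mult_ac)
        also have "exp (- Re w * z) * exp (Re w / 2 * z) = exp (- (Re w / 2) * z)"
          by (simp add: exp_add[symmetric])
        finally show ?thesis .
      qed (auto simp: q_def pos_powr_def)
    qed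
  qed (auto simp: q_def)
  then have lim: "(\<lambda>i. integral\<^sup>L lborel (q i)) \<longlonglongrightarrow> - (\<integral>z. complex_of_real (pos_powr (s + 1) z) * exp (- w * of_real z) \<partial>lborel)"
    by (intro LIMSEQ_offset[of "\<lambda>i. integral\<^sup>L lborel (q i)" N]) simp
  have "(?G (w + h i) - ?G w) / h i = integral\<^sup>L lborel (q i)" if "N \<le> i" for i
  proof -
    have "0 < Re (w + h i)"
      using N[OF that] abs_Re_le_cmod[of "h i"] w by simp
    then have "?G (w + h i) - ?G w = (\<integral>z. complex_of_real (pos_powr s z) * exp (- (w + h i) * of_real z) - complex_of_real (pos_powr s z) * exp (- w * of_real z) \<partial>lborel)"
      by (rule Bochner_Integration.integral_diff[symmetric, OF pos_powr_cexp_integrable[OF s] pos_powr_cexp_integrable[OF s w]])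
    also have "\<dots> / h i = (\<integral>z. (complex_of_real (pos_powr s z) * exp (- (w + h i) * of_real z) - complex_of_real (pos_powr s z) * exp (- w * of_real z)) / h i \<partial>lborel)"
      by simp
    also have "\<dots> = integral\<^sup>L lborel (q i)"
      unfolding q_def by (intro Bochner_Integration.integral_cong refl)
        (simp add: field_simps exp_add[symmetric] hne exp_minus[symmetric])
    finally show ?thesis .
  qed
  then show "((\<lambda>k. (?G (w + k) - ?G w) / k) \<circ> h) \<longlonglongrightarrow> - (\<integral>z. complex_of_real (pos_powr (s + 1) z) * exp (- w * of_real z) \<partial>lborel)"
    unfolding o_def by (intro Lim_transform_eventually[OF lim]) (auto simp: eventually_sequentially intro!: exI[of _ N])
qed

text \<open>The product of the integral with w^s has derivative 0 on the convex right half-plane, by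
  the integration by parts identity; hence it is constant, and at w = 1 it is Gamma(s).\<close>

theorem pos_powr_cexp_integral:
  assumes s: "0 < s" and w: "0 < Re w"
  shows "(\<integral>z. complex_of_real (pos_powr s z) * exp (- w * of_real z) \<partial>lborel) = Gamma s * w powr (- of_real s)"
proof -
  let ?G = "\<lambda>w. \<integral>z. complex_of_real (pos_powr s z) * exp (- w * of_real z) \<partial>lborel"
  let ?K = "\<lambda>w. ?G w * w powr of_real s"
  have cv: "convex {w. 0 < Re w}" by (rule convex_halfspace_Re_gt)
  have "\<exists>c. \<forall>v\<in>{w. 0 < Re w}. ?K v = c"
  proof (rule has_field_derivative_zero_constant[OF cv])
    fix v assume "v \<in> {w. 0 < Re w}"
    then have v: "0 < Re v" by simp
    then have nz: "v \<noteq> 0" "v \<notin> \<real>\<^sub>\<le>\<^sub>0" by (auto simp: complex_nonpos_Reals_iff)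
    have "(?K has_field_derivative ?G v * (of_real s * v powr (of_real s - 1)) +
        - (\<integral>z. complex_of_real (pos_powr (s + 1) z) * exp (- v * of_real z) \<partial>lborel) * v powr of_real s) (at v)"
      by (rule DERIV_mult'[OF pos_powr_cexp_deriv[OF s v] has_field_derivative_powr[OF nz(2)]])
    also have "?G v * (of_real s * v powr (of_real s - 1)) +
        - (\<integral>z. complex_of_real (pos_powr (s + 1) z) * exp (- v * of_real z) \<partial>lborel) * v powr of_real s
      = v powr (of_real s - 1) * (of_real s * ?G v - v * (\<integral>z. complex_of_real (pos_powr (s + 1) z) * exp (- v * of_real z) \<partial>lborel))"
      using nz by (simp add: powr_diff field_simps)
    also have "\<dots> = 0" using pos_powr_cexp_parts[OF s v] by simp
    finally show "(?K has_field_derivative 0) (at v within {w. 0 < Re w})"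
      by (rule has_field_derivative_at_within)
  qed
  then obtain c where c: "\<And>v. 0 < Re v \<Longrightarrow> ?K v = c" by auto
  have "?K w = ?K 1" using c[OF w] c[of 1] by simp
  also have "?G 1 = of_real (\<integral>z. pos_powr s z * exp (- z) \<partial>lborel)"
    by (subst integral_complex_of_real[symmetric]) (simp add: exp_of_real[symmetric])
  finally have "?K w = Gamma s" by (simp add: pos_powr_exp_integral[OF s] Gamma_complex_of_real)
  moreover have "w \<noteq> 0" using w by auto
  ultimately show ?thesis by (simp add: powr_minus field_simps Gamma_complex_of_real)
qed

section \<open>The characteristic exponent\<close>

text \<open>Mean value bound on the left half-plane, which is convex and on which the exponential
  has modulus at most 1. This and the quadratic version below serve both the Levy integrals and the
  one-step errors exp(\<psi>/2^n) - 1.\<close>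

lemma norm_exp_diff_1_halfplane:
  assumes "Re z \<le> 0" shows "norm (exp z - 1) \<le> norm z"
proof -
  have "norm (exp z - exp 0) \<le> 1 * norm (z - 0)"
  proof (rule field_differentiable_bound[where S="{z. Re z \<le> 0}"])
    show "(exp has_field_derivative exp w) (at w within {z. Re z \<le> 0})" for w :: complex
      by (auto intro!: derivative_eq_intros)
  qed (use assms in \<open>auto simp: convex_halfspace_Re_le\<close>)
  then show ?thesis by simp
qed

lemma norm_exp_diff_2_halfplane:
  assumes "Re z \<le> 0" shows "norm (exp z - 1 - z) \<le> (norm z)\<^sup>2"
proof -
  have "norm ((exp z - 1 - z) - (exp 0 - 1 - 0)) \<le> norm z * norm (z - 0)"
  proof (rule field_differentiable_bound[where S="cball 0 (norm z) \<inter> {z. Re z \<le> 0}"])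
    show "((\<lambda>z. exp z - 1 - z) has_field_derivative (exp w - 1)) (at w within cball 0 (norm z) \<inter> {z. Re z \<le> 0})" for w :: complex
      by (auto intro!: derivative_eq_intros)
    show "norm (exp w - 1) \<le> norm z" if "w \<in> cball 0 (norm z) \<inter> {z. Re z \<le> 0}" for w
      using that norm_exp_diff_1_halfplane[of w] by auto
  qed (use assms in \<open>auto simp: convex_halfspace_Re_le intro!: convex_Int\<close>)
  then show ?thesis by (simp add: power2_eq_square)
qed

section \<open>Integrals of compensated exponentials against a power density\<close>

lemma pos_powr_integrable_near_0:
  assumes "0 < s" "0 \<le> c"
  shows "integrable lborel (\<lambda>y. indicator {..<c} y * pos_powr s y)"
proof -
  have "(\<lambda>y. y powr (s - 1)) absolutely_integrable_on {0..c}"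
    using integrable_on_powr_from_0[of "s - 1" c] assms by (subst absolutely_integrable_on_iff_nonneg) auto
  then have "integrable lborel (\<lambda>y. indicator {0..c} y *\<^sub>R y powr (s - 1))"
    unfolding set_integrable_def by (subst (asm) integrable_completion) auto
  then show ?thesis
    by (rule Bochner_Integration.integrable_bound) (auto simp: indicator_def pos_powr_def)
qed

lemma pos_powr_integrable_at_inf:
  assumes "s < 0" "0 < c"
  shows "integrable lborel (\<lambda>y. indicator {c..} y * pos_powr s y)"
proof -
  have "(\<lambda>y. y powr (s - 1)) absolutely_integrable_on {c..}"
    using has_integral_powr_to_inf[of "s - 1" c] assms
    by (subst absolutely_integrable_on_iff_nonneg) auto
  then have "integrable lborel (\<lambda>y. indicator {c..} y *\<^sub>R y powr (s - 1))"
    unfolding set_integrable_def by (subst (asm) integrable_completion) auto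
  then show ?thesis
    by (rule Bochner_Integration.integrable_bound) (use assms in \<open>auto simp: indicator_def pos_powr_def\<close>)
qed

lemma pos_powr_shift: "pos_powr (s + t) y = y powr t * pos_powr s y"
  by (auto simp: pos_powr_def powr_add[symmetric] algebra_simps)

text \<open>A majorant uniform over all w with Re w >= 0 and |w| <= C: the quadratic estimate of the
  compensated exponential is used below 1 and the linear one above 1. Both pieces are integrable
  exactly because 1 < \<alpha> < 2. Uniformity permits the passage to the imaginary axis.\<close>

definition compensated_bound :: "real \<Rightarrow> real \<Rightarrow> real \<Rightarrow> real" where
  "compensated_bound \<alpha> C y = C\<^sup>2 * (indicator {..<1} y * pos_powr (2 - \<alpha>) y) + (2 + C) * (indicator {1..} y * pos_powr (1 - \<alpha>) y)"

lemma compensated_bound_integrable: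
  assumes "1 < \<alpha>" "\<alpha> < 2"
  shows "integrable lborel (compensated_bound \<alpha> C)"
  unfolding compensated_bound_def using assms
  by (intro Bochner_Integration.integrable_add integrable_mult_right pos_powr_integrable_near_0 pos_powr_integrable_at_inf) auto

lemma compensated_bound:
  assumes "0 \<le> Re w" "norm w \<le> C"
  shows "norm (complex_of_real (pos_powr (- \<alpha>) y) * (exp (- w * of_real y) - 1 + w * of_real y)) \<le> compensated_bound \<alpha> C y"
proof (cases "0 < y")
  case True
  let ?z = "- w * of_real y"
  have z: "Re ?z \<le> 0" using assms True by simp
  have C: "0 \<le> C" using assms norm_ge_zero order_trans by blast
  have nz: "norm ?z \<le> C * y" using True assms by (simp add: norm_mult mult_right_mono)
  have u: "exp (- w * of_real y) - 1 + w * of_real y = exp ?z - 1 - ?z" by simp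
  show ?thesis
  proof (cases "y < 1")
    case y: True
    have "norm (exp ?z - 1 - ?z) \<le> (norm ?z)\<^sup>2" by (rule norm_exp_diff_2_halfplane[OF z])
    also have "\<dots> \<le> (C * y)\<^sup>2" using nz by (intro power_mono) auto
    finally have "norm (exp ?z - 1 - ?z) \<le> C\<^sup>2 * y powr 2" using True by (simp add: power_mult_distrib)
    then have "pos_powr (- \<alpha>) y * norm (exp ?z - 1 - ?z) \<le> pos_powr (- \<alpha>) y * (C\<^sup>2 * y powr 2)"
      by (intro mult_left_mono) auto
    also have "\<dots> = C\<^sup>2 * pos_powr (2 - \<alpha>) y"
      using pos_powr_shift[of "- \<alpha>" 2 y] by simp
    finally show ?thesis using y by (simp add: u norm_mult compensated_bound_def)
  next
    case y: False
    have "norm (exp ?z - 1 - ?z) \<le> norm (exp ?z) + norm (1::complex) + norm ?z"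
      by (intro order_trans[OF norm_triangle_ineq4] add_right_mono norm_triangle_ineq4)
    also have "norm (exp ?z) \<le> 1" using z by (simp add: norm_exp)
    finally have "norm (exp ?z - 1 - ?z) \<le> 2 + C * y" using nz by simp
    also have "\<dots> \<le> (2 + C) * y powr 1" using y by (simp add: algebra_simps)
    finally have "pos_powr (- \<alpha>) y * norm (exp ?z - 1 - ?z) \<le> pos_powr (- \<alpha>) y * ((2 + C) * y powr 1)"
      by (intro mult_left_mono) auto
    also have "\<dots> = (2 + C) * pos_powr (1 - \<alpha>) y"
      using pos_powr_shift[of "- \<alpha>" 1 y] by (simp add: mult_ac)
    finally show ?thesis using y by (simp add: u norm_mult compensated_bound_def)
  qed
qed (auto simp: pos_powr_def compensated_bound_def)

lemma compensated_integrable: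
  assumes "1 < \<alpha>" "\<alpha> < 2" "0 \<le> Re w"
  shows "integrable lborel (\<lambda>y. complex_of_real (pos_powr (- \<alpha>) y) * (exp (- w * of_real y) - 1 + w * of_real y))"
proof (rule Bochner_Integration.integrable_bound[OF compensated_bound_integrable[OF assms(1,2), of "norm w"]])
  show "AE y in lborel. norm (complex_of_real (pos_powr (- \<alpha>) y) * (exp (- w * of_real y) - 1 + w * of_real y)) \<le> norm (compensated_bound \<alpha> (norm w) y)"
    using assms by (intro AE_I2) (metis compensated_bound order_refl order_trans real_norm_def abs_ge_self)
qed measurable

text \<open>Two integrations by parts turn y^(-\<alpha>-1) into y^(1-\<alpha>) and the compensated
  exponential into w^2 exp(-w y), which leaves a Gamma integral with parameter 2 - \<alpha>. The
  factor 1/(\<alpha> (\<alpha> - 1)) comes from the two antiderivatives.\<close>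

lemma compensated_integral_interior:
  assumes \<alpha>: "1 < \<alpha>" "\<alpha> < 2" and w: "0 < Re w"
  shows "(\<integral>y. complex_of_real (pos_powr (- \<alpha>) y) * (exp (- w * of_real y) - 1 + w * of_real y) \<partial>lborel)
    = of_real (Gamma (2 - \<alpha>) / (\<alpha> * (\<alpha> - 1))) * w powr of_real \<alpha>"
proof -
  define u where "u = (\<lambda>y::real. exp (- w * of_real y) - 1 + w * of_real y)"
  define u' where "u' = (\<lambda>y::real. w - w * exp (- w * of_real y))"
  define k where "k = 1 / (\<alpha> * (\<alpha> - 1))"
  \<comment> \<open>Both integrations by parts in a single antiderivative; the coefficients are
    chosen so that the terms in y^(-\<alpha>) u'(y) cancel, which is the identity -1/\<alpha> - k (1
    - \<alpha>) = 0 below.\<close>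
  define F where "F = (\<lambda>y::real. of_real (- 1 / \<alpha>) * (of_real (y powr - \<alpha>) * u y) - of_real k * (of_real (y powr (1 - \<alpha>)) * u' y))"
  define f where "f = (\<lambda>y::real. of_real (y powr (- \<alpha> - 1)) * u y - of_real k * (of_real (y powr (1 - \<alpha>)) * (w\<^sup>2 * exp (- w * of_real y))))"
  define g1 where "g1 = (\<lambda>y::real. of_real (pos_powr (- \<alpha>) y) * u y)"
  define g2 where "g2 = (\<lambda>y::real. of_real k * w\<^sup>2 * (of_real (pos_powr (2 - \<alpha>) y) * exp (- w * of_real y)))"
  have i1: "integrable lborel g1"
    unfolding g1_def u_def using compensated_integrable[OF \<alpha>, of w] w by simp
  have i2: "integrable lborel g2"
    unfolding g2_def using pos_powr_cexp_integrable[of "2 - \<alpha>" w] w \<alpha> by (intro integrable_mult_right) auto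
  have eq: "indicator (einterval 0 \<infinity>) z *\<^sub>R f z = g1 z - g2 z" for z
    by (auto simp: f_def g1_def g2_def pos_powr_def indicator_def einterval_def zero_ereal_def)
  have "(LBINT z=0..\<infinity>. f z) = 0 - 0"
  proof (rule interval_integral_FTC_integrable[where F=F])
    fix x :: real assume "0 < ereal x"
    then have x: "0 < x" by simp
    have p: "((\<lambda>z. complex_of_real (z powr s)) has_vector_derivative of_real (s * x powr (s - 1))) (at x)" for s
      using x by (intro has_vector_derivative_of_real) (auto simp: has_real_derivative_iff_has_vector_derivative[symmetric] intro!: derivative_eq_intros)
    have du: "(u has_vector_derivative u' x) (at x)"
      unfolding u_def u'_def by (rule has_vector_derivative_real_field) (auto intro!: derivative_eq_intros)
    have du': "(u' has_vector_derivative (w\<^sup>2 * exp (- w * of_real x))) (at x)"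
      unfolding u_def u'_def by (rule has_vector_derivative_real_field) (auto intro!: derivative_eq_intros simp: power2_eq_square)
    have A: "(F has_vector_derivative of_real (- 1 / \<alpha>) * (of_real (x powr - \<alpha>) * u' x + of_real (- \<alpha> * x powr (- \<alpha> - 1)) * u x)
       - of_real k * (of_real (x powr (1 - \<alpha>)) * (w\<^sup>2 * exp (- w * of_real x)) + of_real ((1 - \<alpha>) * x powr (1 - \<alpha> - 1)) * u' x)) (at x)"
      unfolding F_def
      by (intro has_vector_derivative_diff has_vector_derivative_mult_right has_vector_derivative_mult p du du')
    have B: "of_real (- 1 / \<alpha>) * (of_real (x powr - \<alpha>) * u' x + of_real (- \<alpha> * x powr (- \<alpha> - 1)) * u x)
       - of_real k * (of_real (x powr (1 - \<alpha>)) * (w\<^sup>2 * exp (- w * of_real x)) + of_real ((1 - \<alpha>) * x powr (1 - \<alpha> - 1)) * u' x)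
       = of_real ((- 1 / \<alpha>) * - \<alpha>) * of_real (x powr (- \<alpha> - 1)) * u x + of_real (- 1 / \<alpha> - k * (1 - \<alpha>)) * of_real (x powr - \<alpha>) * u' x
       - of_real k * (of_real (x powr (1 - \<alpha>)) * (w\<^sup>2 * exp (- w * of_real x)))"
      unfolding of_real_mult of_real_diff by (simp add: ring_distribs mult_ac)
    have C: "(- 1 / \<alpha>) * - \<alpha> = 1" "- 1 / \<alpha> - k * (1 - \<alpha>) = 0"
      using \<alpha> by (simp_all add: k_def divide_simps)
    show "(F has_vector_derivative f x) (at x)"
      using A unfolding B C f_def by simp
    show "isCont f x"
      using x unfolding f_def u_def by (auto intro!: continuous_intros)
  next
    show "set_integrable lborel (einterval 0 \<infinity>) f"
      using i1 i2 unfolding set_integrable_def eq by simp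
    \<comment> \<open>Each of u and u' needs two estimates: one of higher order in y for the
      boundary term at 0, and one of lower order for the boundary term at infinity.\<close>
    have nu': "norm (u' y) \<le> norm w ^ 2 * y" "norm (u' y) \<le> 2 * norm w" if "0 < y" for y
    proof -
      have e: "u' y = - w * (exp (- w * of_real y) - 1)" by (simp add: u'_def algebra_simps)
      have "norm (exp (- w * of_real y) - 1) \<le> norm (- w * of_real y)"
        using that w by (intro norm_exp_diff_1_halfplane) auto
      then have "norm w * norm (exp (- w * of_real y) - 1) \<le> norm w * norm (- w * of_real y)"
        by (intro mult_left_mono) auto
      then show "norm (u' y) \<le> norm w ^ 2 * y"
        unfolding e using that by (simp add: norm_mult power2_eq_square)
      have "norm (exp (- w * of_real y) - 1) \<le> norm (exp (- w * of_real y)) + norm (1::complex)"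
        by (rule norm_triangle_ineq4)
      also have "\<dots> \<le> 2" using that w by (simp add: norm_exp)
      finally have "norm w * norm (exp (- w * of_real y) - 1) \<le> norm w * 2"
        by (intro mult_left_mono) auto
      then show "norm (u' y) \<le> 2 * norm w" unfolding e by (simp add: norm_mult)
    qed
    have nu: "norm (u y) \<le> norm w ^ 2 * y ^ 2" "norm (u y) \<le> 2 + norm w * y" if "0 < y" for y
    proof -
      have e: "u y = exp (- w * of_real y) - 1 - (- w * of_real y)" by (simp add: u_def)
      have "norm (u y) \<le> (norm (- w * of_real y))\<^sup>2"
        unfolding e using that w by (intro norm_exp_diff_2_halfplane) auto
      then show "norm (u y) \<le> norm w ^ 2 * y ^ 2" by (simp add: norm_mult power_mult_distrib)
      have "norm (u y) \<le> norm (exp (- w * of_real y)) + norm (1::complex) + norm (- w * of_real y)"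
        unfolding e by (intro order_trans[OF norm_triangle_ineq4] add_right_mono norm_triangle_ineq4)
      also have "\<dots> \<le> 1 + 1 + norm w * y"
        using that w by (intro add_mono) (auto simp: norm_exp norm_mult)
      finally show "norm (u y) \<le> 2 + norm w * y" by simp
    qed
    have k: "0 \<le> k" using \<alpha> by (simp add: k_def)
    have nF: "norm (F y) \<le> 1 / \<alpha> * (y powr - \<alpha> * norm (u y)) + k * (y powr (1 - \<alpha>) * norm (u' y))" for y
      unfolding F_def using \<alpha> k
      by (intro order_trans[OF norm_triangle_ineq4]) (simp add: norm_mult norm_divide)
    have "(F \<longlongrightarrow> 0) (at_right 0)"
    proof (rule Lim_null_comparison)
      show "\<forall>\<^sub>F y in at_right 0. norm (F y) \<le> 1 / \<alpha> * (y powr - \<alpha> * (norm w ^ 2 * y ^ 2)) + k * (y powr (1 - \<alpha>) * (norm w ^ 2 * y))"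
      proof (rule eventually_at_right_less[THEN eventually_mono])
        fix y :: real assume "0 < y"
        then show "norm (F y) \<le> 1 / \<alpha> * (y powr - \<alpha> * (norm w ^ 2 * y ^ 2)) + k * (y powr (1 - \<alpha>) * (norm w ^ 2 * y))"
          using nu nu' \<alpha> k by (intro order_trans[OF nF] add_mono mult_left_mono) auto
      qed
      show "((\<lambda>y. 1 / \<alpha> * (y powr - \<alpha> * (norm w ^ 2 * y ^ 2)) + k * (y powr (1 - \<alpha>) * (norm w ^ 2 * y))) \<longlongrightarrow> 0) (at_right 0)"
        using \<alpha> by real_asymp
    qed
    then show "((F \<circ> real_of_ereal) \<longlongrightarrow> 0) (at_right 0)"
      by (simp add: zero_ereal_def ereal_tendsto_simps)
    have "(F \<longlongrightarrow> 0) at_top"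
    proof (rule Lim_null_comparison)
      show "\<forall>\<^sub>F y in at_top. norm (F y) \<le> 1 / \<alpha> * (y powr - \<alpha> * (2 + norm w * y)) + k * (y powr (1 - \<alpha>) * (2 * norm w))"
      proof (rule eventually_gt_at_top[of 0, THEN eventually_mono])
        fix y :: real assume "0 < y"
        then show "norm (F y) \<le> 1 / \<alpha> * (y powr - \<alpha> * (2 + norm w * y)) + k * (y powr (1 - \<alpha>) * (2 * norm w))"
          using nu nu' \<alpha> k by (intro order_trans[OF nF] add_mono mult_left_mono) auto
      qed
      have L: "((\<lambda>y. y powr - \<alpha>) \<longlongrightarrow> 0) at_top" "((\<lambda>y. y powr - \<alpha> * y) \<longlongrightarrow> 0) at_top" "((\<lambda>y. y powr (1 - \<alpha>)) \<longlongrightarrow> 0) at_top"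
        using \<alpha> by real_asymp+
      have "((\<lambda>y. 1 / \<alpha> * (2 * y powr - \<alpha> + norm w * (y powr - \<alpha> * y)) + k * (2 * norm w) * y powr (1 - \<alpha>)) \<longlongrightarrow> 1 / \<alpha> * (2 * 0 + norm w * 0) + k * (2 * norm w) * 0) at_top"
        by (intro tendsto_intros L)
      then show "((\<lambda>y. 1 / \<alpha> * (y powr - \<alpha> * (2 + norm w * y)) + k * (y powr (1 - \<alpha>) * (2 * norm w))) \<longlongrightarrow> 0) at_top"
        by (simp add: algebra_simps)
    qed
    then show "((F \<circ> real_of_ereal) \<longlongrightarrow> 0) (at_left \<infinity>)"
      by (simp add: ereal_tendsto_simps)
  qed auto
  then have "(\<integral>y. g1 y - g2 y \<partial>lborel) = 0"
    by (simp add: interval_lebesgue_integral_def set_lebesgue_integral_def eq)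
  then have "integral\<^sup>L lborel g1 = integral\<^sup>L lborel g2"
    using i1 i2 by simp
  also have "\<dots> = of_real k * w\<^sup>2 * (Gamma (2 - \<alpha>) * w powr (- of_real (2 - \<alpha>)))"
    unfolding g2_def using pos_powr_cexp_integral[of "2 - \<alpha>" w] w \<alpha>
    by (simp add: Gamma_complex_of_real[symmetric])
  also have "w\<^sup>2 * w powr (- of_real (2 - \<alpha>)) = w powr of_real \<alpha>"
  proof -
    have "w \<noteq> 0" using w by auto
    then have "w\<^sup>2 * w powr (- of_real (2 - \<alpha>)) = w powr (2 + - of_real (2 - \<alpha>))"
      by (subst powr_add) simp
    then show ?thesis by simp
  qed
  then have "of_real k * w\<^sup>2 * (Gamma (2 - \<alpha>) * w powr (- of_real (2 - \<alpha>))) = of_real (k * Gamma (2 - \<alpha>)) * w powr of_real \<alpha>"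
    by (simp only: mult.assoc mult.left_commute[of "w\<^sup>2"] of_real_mult of_real_eq_id id_apply)
  finally show ?thesis by (simp add: g1_def u_def k_def)
qed

text \<open>The axis is approached from inside the half-plane along 1/(n+1) - i \<theta>. The
  integrals converge by the uniform majorant, and the power is continuous at -i \<theta> since this
  point is off the branch cut when \<theta> is not 0.\<close>

lemma compensated_integral_boundary:
  assumes \<alpha>: "1 < \<alpha>" "\<alpha> < 2" and \<theta>: "\<theta> \<noteq> 0"
  shows "(\<integral>y. complex_of_real (pos_powr (- \<alpha>) y) * (iexp (\<theta> * y) - 1 - \<i> * of_real (\<theta> * y)) \<partial>lborel)
    = of_real (Gamma (2 - \<alpha>) / (\<alpha> * (\<alpha> - 1))) * (- \<i> * of_real \<theta>) powr of_real \<alpha>"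
proof -
  define w where "w = (\<lambda>n. of_real (1 / real (Suc n)) - \<i> * of_real \<theta>)"
  have Rw: "0 < Re (w n)" for n by (simp add: w_def)
  have "w \<longlonglongrightarrow> of_real 0 - \<i> * of_real \<theta>"
    unfolding w_def using LIMSEQ_inverse_real_of_nat by (intro tendsto_intros) (simp add: inverse_eq_divide)
  then have wlim: "w \<longlonglongrightarrow> - \<i> * of_real \<theta>" by simp
  have nw: "norm (w n) \<le> 1 + \<bar>\<theta>\<bar>" for n
  proof -
    have "norm (w n) \<le> norm (complex_of_real (1 / real (Suc n))) + norm (\<i> * of_real \<theta>)"
      unfolding w_def by (rule norm_triangle_ineq4)
    also have "\<dots> \<le> 1 + \<bar>\<theta>\<bar>" by (simp add: norm_mult norm_divide del: of_nat_Suc)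
    finally show ?thesis .
  qed
  let ?I = "\<lambda>w. \<integral>y. complex_of_real (pos_powr (- \<alpha>) y) * (exp (- w * of_real y) - 1 + w * of_real y) \<partial>lborel"
  have "(\<lambda>n. ?I (w n)) \<longlonglongrightarrow> ?I (- \<i> * of_real \<theta>)"
  proof (rule integral_dominated_convergence[OF _ _ compensated_bound_integrable[OF \<alpha>, of "1 + \<bar>\<theta>\<bar>"]])
    show "AE y in lborel. (\<lambda>n. complex_of_real (pos_powr (- \<alpha>) y) * (exp (- w n * of_real y) - 1 + w n * of_real y))
      \<longlonglongrightarrow> complex_of_real (pos_powr (- \<alpha>) y) * (exp (- (- \<i> * of_real \<theta>) * of_real y) - 1 + (- \<i> * of_real \<theta>) * of_real y)"
      by (intro AE_I2 tendsto_intros wlim)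
    show "AE y in lborel. norm (complex_of_real (pos_powr (- \<alpha>) y) * (exp (- w n * of_real y) - 1 + w n * of_real y)) \<le> compensated_bound \<alpha> (1 + \<bar>\<theta>\<bar>) y" for n
      using Rw nw by (intro AE_I2 compensated_bound) (auto simp: less_imp_le)
  qed auto
  moreover have "(\<lambda>n. ?I (w n)) \<longlonglongrightarrow> of_real (Gamma (2 - \<alpha>) / (\<alpha> * (\<alpha> - 1))) * (- \<i> * of_real \<theta>) powr of_real \<alpha>"
    unfolding compensated_integral_interior[OF \<alpha> Rw]
    using \<theta> by (intro tendsto_intros tendsto_powr_complex wlim) (auto simp: complex_nonpos_Reals_iff)
  ultimately have "?I (- \<i> * of_real \<theta>) = of_real (Gamma (2 - \<alpha>) / (\<alpha> * (\<alpha> - 1))) * (- \<i> * of_real \<theta>) powr of_real \<alpha>"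
    by (rule LIMSEQ_unique)
  then show ?thesis by (simp add: mult_ac)
qed


section \<open>The factorised stable exponent and its trigonometry\<close>

lemma imag_powr:
  assumes "0 < \<theta>"
  shows "(\<i> * complex_of_real \<theta>) powr of_real b = of_real (\<theta> powr b) * cis (b * (pi / 2))"
    and "(- \<i> * complex_of_real \<theta>) powr of_real b = of_real (\<theta> powr b) * cis (- b * (pi / 2))"
proof -
  have "Ln (of_real \<theta> * \<i>) = of_real (ln \<theta>) + \<i> * of_real (pi / 2)"
    using assms Ln_times_of_real[of \<theta> \<i>] by (simp add: Ln_of_real)
  then have l: "Ln (\<i> * of_real \<theta>) = of_real (ln \<theta>) + \<i> * of_real (pi / 2)"
    by (simp only: mult.commute)
  have "Ln (of_real \<theta> * (- \<i>)) = of_real (ln \<theta>) - \<i> * of_real (pi / 2)"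
    using assms Ln_times_of_real[of \<theta> "- \<i>"] by (simp add: Ln_of_real)
  then have l': "Ln (- \<i> * of_real \<theta>) = of_real (ln \<theta>) - \<i> * of_real (pi / 2)"
    by (simp only: mult.commute)
  have nz: "\<i> * complex_of_real \<theta> \<noteq> 0" "- \<i> * complex_of_real \<theta> \<noteq> 0" using assms by auto
  have r: "complex_of_real (\<theta> powr b) = exp (of_real b * of_real (ln \<theta>))"
    using assms by (simp add: powr_def exp_of_real[symmetric])
  show "(\<i> * complex_of_real \<theta>) powr of_real b = of_real (\<theta> powr b) * cis (b * (pi / 2))"
    using nz(1) unfolding powr_def[of "\<i> * complex_of_real \<theta>"] l r cis_conv_exp exp_add[symmetric]
    by (simp add: algebra_simps)
  show "(- \<i> * complex_of_real \<theta>) powr of_real b = of_real (\<theta> powr b) * cis (- b * (pi / 2))"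
    using nz(2) unfolding powr_def[of "- \<i> * complex_of_real \<theta>"] l' r cis_conv_exp exp_add[symmetric]
    by (simp add: algebra_simps)
qed

text \<open>The product is kept rather than the polar form of \<open>stable_exponent_pos\<close>,
  because the factor (-i \<theta>)^\<beta> later cancels against the transform of the kernel of H.
  The exponent \<open>\<beta>\<close> belongs to upward and \<open>\<gamma>\<close> to downward
  movement.\<close>

definition stable_exponent :: "real \<Rightarrow> real \<Rightarrow> real \<Rightarrow> complex" where
  "stable_exponent \<beta> \<gamma> \<theta> = - ((\<i> * of_real \<theta>) powr of_real \<gamma> * (- \<i> * of_real \<theta>) powr of_real \<beta>)"

lemma stable_exponent_0 [simp]: "stable_exponent \<beta> \<gamma> 0 = 0"
  by (simp add: stable_exponent_def)

lemma stable_exponent_pos: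
  assumes "0 < \<theta>"
  shows "stable_exponent \<beta> \<gamma> \<theta> = - (of_real (\<theta> powr (\<beta> + \<gamma>)) * cis ((\<gamma> - \<beta>) * (pi / 2)))"
  unfolding stable_exponent_def imag_powr[OF assms]
  by (simp add: powr_add cis_mult mult_ac) (simp add: cis_mult[symmetric] algebra_simps diff_divide_distrib add_divide_distrib)

text \<open>Reflecting the process exchanges the two indices. The facts that follow are therefore
  shown for \<theta> > 0 and all pairs of indices, and the negative half-line comes by
  swapping.\<close>

lemma stable_exponent_uminus: "stable_exponent \<beta> \<gamma> (- \<theta>) = stable_exponent \<gamma> \<beta> \<theta>"
  by (simp add: stable_exponent_def mult.commute)

lemma norm_stable_exponent:
  assumes "0 < \<beta>" "0 < \<gamma>"
  shows "norm (stable_exponent \<beta> \<gamma> \<theta>) = \<bar>\<theta>\<bar> powr (\<beta> + \<gamma>)"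
proof -
  have "norm (stable_exponent \<beta> \<gamma> \<theta>) = \<theta> powr (\<beta> + \<gamma>)" if "0 < \<theta>" for \<beta> \<gamma> \<theta>
    using that by (simp add: stable_exponent_pos norm_mult)
  from this[of \<theta> \<beta> \<gamma>] this[of "- \<theta>" \<gamma> \<beta>] show ?thesis
    using assms by (cases \<theta> "0::real" rule: linorder_cases) (auto simp: stable_exponent_uminus add.commute)
qed

text \<open>The phase (\<gamma> - \<beta>) \<pi>/2 lies strictly between -\<pi>/2 and \<pi>/2, so
  its cosine is positive. Strict negativity is what makes the characteristic function of X at time N
  vanish as N grows.\<close>

lemma Re_stable_exponent:
  assumes "0 < \<beta>" "\<beta> < 1" "0 < \<gamma>" "\<gamma> < 1" "\<theta> \<noteq> 0"
  shows "Re (stable_exponent \<beta> \<gamma> \<theta>) < 0"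
proof -
  have "Re (stable_exponent \<beta> \<gamma> \<theta>) < 0" if "0 < \<theta>" "0 < \<beta>" "\<beta> < 1" "0 < \<gamma>" "\<gamma> < 1" for \<beta> \<gamma> \<theta>
  proof -
    have "(\<gamma> - \<beta>) * (pi / 2) < 1 * (pi / 2)" "(- 1) * (pi / 2) < (\<gamma> - \<beta>) * (pi / 2)"
      using that by (intro mult_strict_right_mono; simp)+
    then have "0 < cos ((\<gamma> - \<beta>) * (pi / 2))"
      by (intro cos_gt_zero_pi) auto
    then show ?thesis using that by (simp add: stable_exponent_pos)
  qed
  from this[of \<theta> \<beta> \<gamma>] this[of "- \<theta>" \<gamma> \<beta>] show ?thesis
    using assms by (cases \<theta> "0::real" rule: linorder_cases) (auto simp: stable_exponent_uminus)
qed

lemma stable_exponent_measurable [measurable]: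
  "stable_exponent \<beta> \<gamma> \<in> borel_measurable borel"
proof -
  have "stable_exponent \<beta> \<gamma> = (\<lambda>\<theta>. if 0 < \<theta> then - (of_real (\<theta> powr (\<beta> + \<gamma>)) * cis ((\<gamma> - \<beta>) * (pi / 2)))
    else if \<theta> < 0 then - (of_real ((- \<theta>) powr (\<gamma> + \<beta>)) * cis ((\<beta> - \<gamma>) * (pi / 2))) else 0)"
    using stable_exponent_pos stable_exponent_uminus by (auto simp: fun_eq_iff) (metis add.inverse_inverse neg_0_less_iff_less stable_exponent_pos stable_exponent_uminus)+
  also have "\<dots> \<in> borel_measurable borel" by measurable
  finally show ?thesis .
qed

lemma stable_exponent_scale:
  assumes "0 < c"
  shows "stable_exponent \<beta> \<gamma> (c * \<theta>) = of_real (c powr (\<beta> + \<gamma>)) * stable_exponent \<beta> \<gamma> \<theta>"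
proof -
  have "stable_exponent \<beta> \<gamma> (c * \<theta>) = of_real (c powr (\<beta> + \<gamma>)) * stable_exponent \<beta> \<gamma> \<theta>" if "0 < \<theta>" for \<beta> \<gamma> \<theta>
    using that assms by (simp add: stable_exponent_pos powr_mult)
  from this[of \<theta> \<beta> \<gamma>] this[of "- \<theta>" \<gamma> \<beta>] show ?thesis
    by (cases \<theta> "0::real" rule: linorder_cases) (auto simp: stable_exponent_uminus add.commute)
qed

text \<open>Upward jumps contribute the phase of (-i)^\<alpha> with weight sin(\<pi> \<beta>),
  downward jumps that of i^\<alpha> with weight sin(\<pi> \<gamma>). In half-angles the
  sum-to-product formulas merge them into the single phase of the product form.\<close>

lemma sin_cis_combination:
  "of_real (sin (pi * \<beta>)) * cis (- (\<beta> + \<gamma>) * (pi / 2)) + of_real (sin (pi * \<gamma>)) * cis ((\<beta> + \<gamma>) * (pi / 2))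
    = of_real (sin (pi * (\<beta> + \<gamma>))) * cis ((\<gamma> - \<beta>) * (pi / 2))"
proof -
  define p q where "p = \<beta> * (pi / 2)" and "q = \<gamma> * (pi / 2)"
  have e: "pi * \<beta> = 2 * p" "pi * \<gamma> = 2 * q" "pi * (\<beta> + \<gamma>) = 2 * (p + q)" "- (\<beta> + \<gamma>) * (pi / 2) = - (p + q)"
    "(\<beta> + \<gamma>) * (pi / 2) = p + q" "(\<gamma> - \<beta>) * (pi / 2) = q - p"
    by (simp_all add: p_def q_def field_simps)
  have s: "sin (2 * p) + sin (2 * q) = 2 * sin (p + q) * cos (q - p)"
    "sin (2 * q) - sin (2 * p) = 2 * cos (p + q) * sin (q - p)"
    using sin_plus_sin[of "2 * q" "2 * p"] sin_diff_sin[of "2 * q" "2 * p"]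
    by (simp_all only: add_divide_distrib diff_divide_distrib) (simp_all add: add.commute)
  have "(sin (2 * p) + sin (2 * q)) * cos (p + q) = sin (2 * (p + q)) * cos (q - p)"
    "(sin (2 * q) - sin (2 * p)) * sin (p + q) = sin (2 * (p + q)) * sin (q - p)"
    unfolding s sin_double[of "p + q"] by simp_all
  moreover have "cis (- (p + q)) = cnj (cis (p + q))" by (simp only: cis_cnj)
  ultimately show ?thesis unfolding e
    by (simp add: complex_eq_iff ring_distribs mult.commute)
qed

lemma Gamma_reflection_real: "Gamma x * Gamma (1 - x) = pi / sin (pi * x)" for x :: real
proof -
  have "complex_of_real (Gamma x * Gamma (1 - x)) = complex_of_real (pi / sin (pi * x))"
    using Gamma_reflection_complex[of "of_real x"]
    by (simp add: Gamma_complex_of_real[symmetric] sin_of_real[symmetric])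
  then show ?thesis using of_real_eq_iff by blast
qed

text \<open>The reflection formula, applied once to Gamma(b) Gamma(1-b) and once to
  Gamma(\<alpha>-1) Gamma(2-\<alpha>). It shows that the normalisation of the Levy density gives
  exponent coefficient 1.\<close>

lemma levy_constant:
  assumes \<alpha>: "1 < \<alpha>" "\<alpha> < 2" and b: "0 < b" "b < 1"
  shows "Gamma (\<alpha> + 1) / (Gamma b * Gamma (1 - b)) * (Gamma (2 - \<alpha>) / (\<alpha> * (\<alpha> - 1))) = - sin (pi * b) / sin (pi * \<alpha>)"
proof -
  have G: "Gamma (\<alpha> + 1) = \<alpha> * ((\<alpha> - 1) * Gamma (\<alpha> - 1))"
  proof -
    have "\<alpha> \<notin> \<int>\<^sub>\<le>\<^sub>0" "\<alpha> - 1 \<notin> \<int>\<^sub>\<le>\<^sub>0" using \<alpha> by (auto dest: nonpos_Ints_nonpos)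
    then show ?thesis using Gamma_plus1[of \<alpha>] Gamma_plus1[of "\<alpha> - 1"] by (simp add: add.commute)
  qed
  have R: "Gamma (\<alpha> - 1) * Gamma (2 - \<alpha>) = - pi / sin (pi * \<alpha>)"
    using Gamma_reflection_real[of "\<alpha> - 1"] by (simp add: right_diff_distrib sin_diff)
  have "Gamma (\<alpha> + 1) / (Gamma b * Gamma (1 - b)) * (Gamma (2 - \<alpha>) / (\<alpha> * (\<alpha> - 1)))
    = (Gamma (\<alpha> - 1) * Gamma (2 - \<alpha>)) / (Gamma b * Gamma (1 - b))"
    unfolding G using \<alpha> by simp
  also have "\<dots> = - sin (pi * b) / sin (pi * \<alpha>)"
    unfolding R Gamma_reflection_real by simp
  finally show ?thesis .
qed

text \<open>Since \<alpha> > 1 the jumps can be compensated in full, without truncation. Each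
  half-line then yields a power of -i \<theta> or i \<theta>, and the normalising constants make the
  sum collapse to the factorised exponent.\<close>

lemma jump_exponent:
  assumes \<beta>: "0 < \<beta>" "\<beta> < 1" and \<gamma>: "0 < \<gamma>" "\<gamma> < 1" and s: "1 < \<beta> + \<gamma>"
  defines "\<alpha> \<equiv> \<beta> + \<gamma>"
  shows "of_real (Gamma (\<alpha> + 1) / (Gamma \<beta> * Gamma (1 - \<beta>))) *
       (\<integral>y. complex_of_real (pos_powr (- \<alpha>) y) * (iexp (\<theta> * y) - 1 - \<i> * of_real (\<theta> * y)) \<partial>lborel)
     + of_real (Gamma (\<alpha> + 1) / (Gamma \<gamma> * Gamma (1 - \<gamma>))) *
       (\<integral>y. complex_of_real (pos_powr (- \<alpha>) y) * (iexp (- \<theta> * y) - 1 - \<i> * of_real (- \<theta> * y)) \<partial>lborel)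
     = stable_exponent \<beta> \<gamma> \<theta>"
    (is "?L \<beta> \<gamma> \<theta> = _")
proof -
  have \<alpha>: "1 < \<alpha>" "\<alpha> < 2" using assms by auto
  have sn: "sin (pi * \<alpha>) \<noteq> 0"
  proof -
    have "0 < sin (pi * \<alpha> - pi)"
      using \<alpha> by (intro sin_gt_zero) (simp_all add: algebra_simps)
    then show ?thesis by (simp add: sin_diff)
  qed
  have pos: "of_real (Gamma (\<alpha> + 1) / (Gamma \<beta> * Gamma (1 - \<beta>))) *
       (\<integral>y. complex_of_real (pos_powr (- \<alpha>) y) * (iexp (\<theta> * y) - 1 - \<i> * of_real (\<theta> * y)) \<partial>lborel)
     + of_real (Gamma (\<alpha> + 1) / (Gamma \<gamma> * Gamma (1 - \<gamma>))) *
       (\<integral>y. complex_of_real (pos_powr (- \<alpha>) y) * (iexp (- \<theta> * y) - 1 - \<i> * of_real (- \<theta> * y)) \<partial>lborel)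
     = stable_exponent \<beta> \<gamma> \<theta>" if \<theta>: "0 < \<theta>" and \<alpha>': "\<alpha> = \<beta> + \<gamma>" and \<beta>: "0 < \<beta>" "\<beta> < 1" and \<gamma>: "0 < \<gamma>" "\<gamma> < 1" for \<beta> \<gamma> \<theta>
  proof -
    define \<kappa> where "\<kappa> = Gamma (2 - \<alpha>) / (\<alpha> * (\<alpha> - 1))"
    have i1: "(\<integral>y. complex_of_real (pos_powr (- \<alpha>) y) * (iexp (\<theta> * y) - 1 - \<i> * of_real (\<theta> * y)) \<partial>lborel)
      = of_real \<kappa> * (of_real (\<theta> powr \<alpha>) * cis (- \<alpha> * (pi / 2)))"
      using compensated_integral_boundary[OF \<alpha>, of \<theta>] imag_powr(2)[OF \<theta>, of \<alpha>] \<theta> by (simp add: \<kappa>_def)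
    have i2: "(\<integral>y. complex_of_real (pos_powr (- \<alpha>) y) * (iexp (- \<theta> * y) - 1 - \<i> * of_real (- \<theta> * y)) \<partial>lborel)
      = of_real \<kappa> * (of_real (\<theta> powr \<alpha>) * cis (\<alpha> * (pi / 2)))"
      using compensated_integral_boundary[OF \<alpha>, of "- \<theta>"] imag_powr(1)[OF \<theta>, of \<alpha>] \<theta> by (simp add: \<kappa>_def)
    have k: "complex_of_real (Gamma (\<alpha> + 1) / (Gamma \<beta> * Gamma (1 - \<beta>))) * of_real \<kappa> = of_real (- sin (pi * \<beta>) / sin (pi * \<alpha>))"
      "complex_of_real (Gamma (\<alpha> + 1) / (Gamma \<gamma> * Gamma (1 - \<gamma>))) * of_real \<kappa> = of_real (- sin (pi * \<gamma>) / sin (pi * \<alpha>))"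
      using levy_constant[OF \<alpha> \<beta>] levy_constant[OF \<alpha> \<gamma>] unfolding \<kappa>_def of_real_mult[symmetric] by simp_all
    show ?thesis
      unfolding i1 i2 mult.assoc[symmetric] k
      using sin_cis_combination[of \<beta> \<gamma>] sn \<theta>
      by (simp add: stable_exponent_pos \<alpha>'[symmetric] field_simps) (simp add: distrib_left[symmetric] mult.left_commute add.commute mult.commute)
  qed
  show ?thesis
  proof (cases \<theta> "0::real" rule: linorder_cases)
    case less
    then have "0 < - \<theta>" by simp
    from pos[OF this _ \<gamma> \<beta>] show ?thesis
      by (simp add: \<alpha>_def add.commute stable_exponent_uminus)
  next
    case equal
    then show ?thesis by simp
  next
    case greater
    from pos[OF this \<alpha>_def[THEN meta_eq_to_obj_eq] \<beta> \<gamma>] show ?thesis .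
  qed
qed

section \<open>From the Levy density to the characteristic function\<close>

lemma lborel_integral_reflect: "(\<integral>x. f (- x) \<partial>lborel) = integral\<^sup>L lborel f"
  for f :: "real \<Rightarrow> 'a :: {banach, second_countable_topology}"
  using lborel_integral_real_affine[of "-1" f 0] by simp

lemma lborel_integrable_reflect: "integrable lborel f \<Longrightarrow> integrable lborel (\<lambda>x. f (- x))"
  for f :: "real \<Rightarrow> 'a :: {banach, second_countable_topology}"
  using lborel_integrable_real_affine[of f "-1" 0] by simp

text \<open>The admissible interval for \<rho> when \<alpha> is in (1,2) is precisely the condition
  that both \<alpha> \<rho> and \<alpha> (1 - \<rho>) lie below 1.\<close>

lemma stable_parameters:
  fixes \<alpha> \<rho> :: real
  assumes "admissible \<alpha> \<rho>" "1 < \<alpha>" "\<alpha> < 2"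
  shows "0 < \<alpha> * \<rho>" "\<alpha> * \<rho> < 1" "0 < \<alpha> * (1 - \<rho>)" "\<alpha> * (1 - \<rho>) < 1"
proof -
  have r: "1 - 1 / \<alpha> < \<rho>" "\<rho> < 1 / \<alpha>" using assms by (auto simp: admissible_def)
  have "0 < 1 - 1 / \<alpha>" "1 / \<alpha> < 1" using assms by auto
  then have "0 < \<rho>" "\<rho> < 1" using r by auto
  then show "0 < \<alpha> * \<rho>" "0 < \<alpha> * (1 - \<rho>)" using assms by auto
  show "\<alpha> * \<rho> < 1" "\<alpha> * (1 - \<rho>) < 1" using r assms by (simp_all add: field_simps)
qed

text \<open>Truncated and full compensation differ by i \<theta> times the first moment of the jumps
  of size at least 1, finite for \<alpha> > 1. The difference is linear in \<theta>, so it only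
  changes the drift.\<close>

lemma levy_density_integral:
  assumes \<beta>: "0 < \<beta>" "\<beta> < 1" and \<gamma>: "0 < \<gamma>" "\<gamma> < 1" and \<alpha>: "1 < \<alpha>" "\<alpha> = \<beta> + \<gamma>" and \<beta>\<rho>: "\<beta> = \<alpha> * \<rho>"
  shows "\<exists>d. \<forall>\<theta>. (CLINT y|lborel. (iexp (\<theta> * y) - 1 - \<i> * complex_of_real (\<theta> * y * indicator {-1<..<1} y))
                                  * complex_of_real (levy_density \<alpha> \<rho> y))
     = stable_exponent \<beta> \<gamma> \<theta> + \<i> * of_real (d * \<theta>)"
proof -
  define c1 c2 where "c1 = Gamma (\<alpha> + 1) / (Gamma \<beta> * Gamma (1 - \<beta>))" and "c2 = Gamma (\<alpha> + 1) / (Gamma \<gamma> * Gamma (1 - \<gamma>))"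
  \<comment> \<open>This is y times the Levy density restricted to |y| >= 1, as \<open>rp\<close>
    below confirms; its integral is the extra drift d.\<close>
  define r where "r = (\<lambda>y::real. c1 * (indicator {1..} y * pos_powr (1 - \<alpha>) y) - c2 * (indicator {1..} (- y) * pos_powr (1 - \<alpha>) (- y)))"
  have comm: "\<i> * of_real a * complex_of_real b = \<i> * of_real (b * a)" for a b
    by simp
  show ?thesis
proof (intro exI[of _ "integral\<^sup>L lborel r"] allI)
  fix \<theta> :: real
  have \<alpha>2: "\<alpha> < 2" using \<alpha>(2) \<beta> \<gamma> by linarith
  have "\<gamma> = \<alpha> - \<beta>" using \<alpha>(2) by simp
  then have "\<gamma> = \<alpha> * (1 - \<rho>)" using \<beta>\<rho> by (simp add: algebra_simps)
  then have cc: "c_plus \<alpha> \<rho> = c1" "c_minus \<alpha> \<rho> = c2" using \<beta>\<rho> by (auto simp: c_plus_def c_minus_def c1_def c2_def)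
  \<comment> \<open>The parameter of \<open>pos_powr\<close> is the Gamma exponent, so -\<alpha>
    stands for the power y^(-\<alpha>-1).\<close>
  have dens: "levy_density \<alpha> \<rho> y = c1 * pos_powr (- \<alpha>) y + c2 * pos_powr (- \<alpha>) (- y)" for y
    by (auto simp: levy_density_def cc pos_powr_def)
  define h where "h = (\<lambda>\<theta> y::real. complex_of_real (pos_powr (- \<alpha>) y) * (iexp (\<theta> * y) - 1 - \<i> * of_real (\<theta> * y)))"
  have hi: "integrable lborel (h \<theta>)" for \<theta>
  proof -
    have "(\<lambda>y. complex_of_real (pos_powr (- \<alpha>) y) * (exp (- (- \<i> * of_real \<theta>) * of_real y) - 1 + (- \<i> * of_real \<theta>) * of_real y)) = h \<theta>"
      by (simp add: h_def fun_eq_iff mult.assoc)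
    then show ?thesis
      using compensated_integrable[OF \<alpha>(1) \<alpha>2, of "- \<i> * of_real \<theta>"] by simp
  qed
  have ri: "integrable lborel r"
    unfolding r_def using pos_powr_integrable_at_inf[of "1 - \<alpha>" 1] \<alpha>
    by (intro Bochner_Integration.integrable_diff integrable_mult_right lborel_integrable_reflect[of "\<lambda>y. indicator {1..} y * pos_powr (1 - \<alpha>) y"]) auto
  have s: "pos_powr (1 - \<alpha>) z = z * pos_powr (- \<alpha>) z" for z using pos_powr_Suc[of "- \<alpha>" z] by simp
  have rp: "r y = y * (1 - indicator {-1<..<1} y) * levy_density \<alpha> \<rho> y" for y
      proof -
        consider "y \<le> - 1" | "- 1 < y" "y < 1" | "1 \<le> y" by linarith
        then show ?thesis
        proof cases
          case 1
          then have v: "pos_powr (- \<alpha>) y = 0" "indicator {1..} y = (0::real)" "indicator {1..} (- y) = (1::real)" "indicator {-1<..<1} y = (0::real)"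
            by (simp_all add: pos_powr_def)
          have e: "c1 * (0 * p) - c2 * (1 * (- y * q)) = y * (1 - 0) * (c1 * 0 + c2 * q)" for p q
            by (simp add: algebra_simps)
          show ?thesis unfolding r_def dens v s by (rule e)
        next
          case 2
          then have v: "indicator {1..} y = (0::real)" "indicator {1..} (- y) = (0::real)" "indicator {-1<..<1} y = (1::real)"
            by simp_all
          have e: "c1 * (0 * p) - c2 * (0 * q) = y * (1 - 1) * u" for p q u by simp
          show ?thesis unfolding r_def v by (rule e)
        next
          case 3
          then have v: "pos_powr (- \<alpha>) (- y) = 0" "indicator {1..} y = (1::real)" "indicator {1..} (- y) = (0::real)" "indicator {-1<..<1} y = (0::real)"
            by (simp_all add: pos_powr_def)
          have e: "c1 * (1 * (y * p)) - c2 * (0 * q) = y * (1 - 0) * (c1 * p + c2 * 0)" for p q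
            by (simp add: algebra_simps)
          show ?thesis unfolding r_def dens v s by (rule e)
        qed
      qed
  have e1: "(CLINT y|lborel. (iexp (\<theta> * y) - 1 - \<i> * complex_of_real (\<theta> * y * indicator {-1<..<1} y)) * complex_of_real (levy_density \<alpha> \<rho> y))
    = (CLINT y|lborel. (of_real c1 * h \<theta> y + of_real c2 * h (- \<theta>) (- y)) + \<i> * of_real \<theta> * of_real (r y))"
  proof (intro Bochner_Integration.integral_cong refl)
    fix y :: real
    have e: "(E - 1 - \<i> * of_real (\<theta> * y * I)) * of_real (a * p + b * q)
      = (of_real a * (of_real p * (E - 1 - \<i> * of_real (\<theta> * y))) + of_real b * (of_real q * (E - 1 - \<i> * of_real (\<theta> * y))))
        + \<i> * of_real \<theta> * of_real (y * (1 - I) * (a * p + b * q))" for E I a b p q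
      by (simp add: algebra_simps)
    show "(iexp (\<theta> * y) - 1 - \<i> * complex_of_real (\<theta> * y * indicator {-1<..<1} y)) * complex_of_real (levy_density \<alpha> \<rho> y)
      = (of_real c1 * h \<theta> y + of_real c2 * h (- \<theta>) (- y)) + \<i> * of_real \<theta> * of_real (r y)"
      unfolding h_def rp dens minus_mult_minus by (rule e)
  qed
  have e2: "(CLINT y|lborel. (of_real c1 * h \<theta> y + of_real c2 * h (- \<theta>) (- y)) + \<i> * of_real \<theta> * of_real (r y)) = (of_real c1 * integral\<^sup>L lborel (h \<theta>) + of_real c2 * (\<integral>y. h (- \<theta>) (- y) \<partial>lborel)) + \<i> * of_real \<theta> * (\<integral>y. of_real (r y) \<partial>lborel)"
    using hi[of \<theta>] lborel_integrable_reflect[OF hi[of "- \<theta>"]] ri by simp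
  have e3: "(of_real c1 * integral\<^sup>L lborel (h \<theta>) + of_real c2 * (\<integral>y. h (- \<theta>) (- y) \<partial>lborel)) + \<i> * of_real \<theta> * (\<integral>y. of_real (r y) \<partial>lborel) = stable_exponent \<beta> \<gamma> \<theta> + \<i> * of_real (integral\<^sup>L lborel r * \<theta>)"
  proof -
    have "(\<integral>y. h (- \<theta>) (- y) \<partial>lborel) = integral\<^sup>L lborel (h (- \<theta>))"
      by (rule lborel_integral_reflect)
    moreover have "of_real c1 * integral\<^sup>L lborel (h \<theta>) + of_real c2 * integral\<^sup>L lborel (h (- \<theta>)) = stable_exponent \<beta> \<gamma> \<theta>"
      using jump_exponent[OF \<beta> \<gamma>, of \<theta>] \<alpha> by (simp add: h_def c1_def c2_def)
    moreover have "(\<integral>y. complex_of_real (r y) \<partial>lborel) = of_real (integral\<^sup>L lborel r)"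
      by (rule integral_complex_of_real)
    ultimately show ?thesis by (simp only: comm)
  qed
  show "(CLINT y|lborel. (iexp (\<theta> * y) - 1 - \<i> * complex_of_real (\<theta> * y * indicator {-1<..<1} y)) * complex_of_real (levy_density \<alpha> \<rho> y))
    = stable_exponent \<beta> \<gamma> \<theta> + \<i> * of_real (integral\<^sup>L lborel r * \<theta>)"
    by (rule trans[OF e1 trans[OF e2 e3]])
qed
qed

text \<open>t = 1 forces the real part to be 0; a nonzero imaginary part would give the value -1 at
  t = \<pi>/|Im z|. Letting t vary avoids the ambiguity by multiples of 2 \<pi> i of a single
  equation.\<close>

lemma exp_of_real_multiples_eq_1:
  assumes "\<And>t::real. 0 \<le> t \<Longrightarrow> exp (of_real t * z) = 1"
  shows "z = (0::complex)"
proof (rule ccontr)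
  assume z: "z \<noteq> 0"
  have "norm (exp (of_real 1 * z)) = 1" using assms[of 1] by (metis norm_one zero_le_one)
  then have R: "Re z = 0" by simp
  then have I: "Im z \<noteq> 0" using z by (simp add: complex_eq_iff)
  have "exp (of_real (pi / \<bar>Im z\<bar>) * z) = exp (\<i> * of_real (pi * sgn (Im z)))"
    using I R by (intro arg_cong[of _ _ exp]) (auto simp: complex_eq_iff sgn_if)
  also have "\<dots> = - 1" using I by (auto simp: sgn_if exp_minus)
  finally show False using assms[of "pi / \<bar>Im z\<bar>"] by simp
qed

text \<open>The Levy-Khintchine formula leaves an unknown total drift e. Comparing times t
  2^(-\<alpha>) and t under self-similarity with factor 2, the homogeneous part cancels and e
  (2^(1-\<alpha>) - 1) = 0 remains, so e = 0 because \<alpha> is not 1.\<close>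

lemma stable_char:
  assumes X: "strictly_stable_process M X \<alpha> \<rho>" and ad: "admissible \<alpha> \<rho>" and \<alpha>: "1 < \<alpha>" "\<alpha> < 2" and t: "0 \<le> t"
  shows "char (distr M borel (X t)) \<theta> = exp (of_real t * stable_exponent (\<alpha> * \<rho>) (\<alpha> * (1 - \<rho>)) \<theta>)"
proof -
  define \<beta> \<gamma> where "\<beta> = \<alpha> * \<rho>" and "\<gamma> = \<alpha> * (1 - \<rho>)"
  note p = stable_parameters[OF ad \<alpha>, folded \<beta>_def \<gamma>_def]
  have s: "\<alpha> = \<beta> + \<gamma>" by (simp add: \<beta>_def \<gamma>_def algebra_simps)
  have meas: "X t \<in> borel_measurable M" if "0 \<le> t" for t
    using X that by (simp add: strictly_stable_process_def levy_process_def)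
  obtain d where d: "\<And>\<theta>. (CLINT y|lborel. (iexp (\<theta> * y) - 1 - \<i> * complex_of_real (\<theta> * y * indicator {-1<..<1} y))
      * complex_of_real (levy_density \<alpha> \<rho> y)) = stable_exponent \<beta> \<gamma> \<theta> + \<i> * of_real (d * \<theta>)"
    using levy_density_integral[OF p \<alpha>(1) s \<beta>_def] by blast
  obtain a where a: "\<And>t \<theta>. 0 \<le> t \<Longrightarrow> char (distr M borel (X t)) \<theta>
      = exp (complex_of_real t * (\<i> * complex_of_real (a * \<theta>) + (stable_exponent \<beta> \<gamma> \<theta> + \<i> * of_real (d * \<theta>))))"
    using X unfolding strictly_stable_process_def d by blast
  define e where "e = a + d"
  have ch: "char (distr M borel (X t)) \<theta> = exp (of_real t * (stable_exponent \<beta> \<gamma> \<theta> + \<i> * of_real (e * \<theta>)))" if "0 \<le> t" for t \<theta>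
    unfolding a[OF that] by (intro arg_cong[of _ _ exp]) (simp add: e_def algebra_simps)
  \<comment> \<open>Only the one-dimensional marginal, J = {t}, of the self-similarity hypothesis is
    taken.\<close>
  have scale: "char (distr M borel (X (t * 2 powr (- \<alpha>)))) (2 * \<theta>) = char (distr M borel (X t)) \<theta>" if t: "0 \<le> t" for t \<theta>
  proof -
    have "\<forall>c>0. \<forall>J. finite J \<and> J \<subseteq> {0..} \<longrightarrow>
        distr M (PiM J (\<lambda>_. borel)) (\<lambda>\<omega>. \<lambda>t\<in>J. c * X (t * c powr (-\<alpha>)) \<omega>)
      = distr M (PiM J (\<lambda>_. borel)) (\<lambda>\<omega>. \<lambda>t\<in>J. X t \<omega>)"
      using X unfolding strictly_stable_process_def by blast
    from this[rule_format, of 2 "{t}"]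
    have eq: "distr M (PiM {t} (\<lambda>_. borel)) (\<lambda>\<omega>. \<lambda>t\<in>{t}. 2 * X (t * 2 powr (-\<alpha>)) \<omega>)
      = distr M (PiM {t} (\<lambda>_. borel)) (\<lambda>\<omega>. \<lambda>t\<in>{t}. X t \<omega>)" using t by simp
    have m: "(\<lambda>\<omega>. \<lambda>t\<in>{t}. 2 * X (t * 2 powr (-\<alpha>)) \<omega>) \<in> M \<rightarrow>\<^sub>M PiM {t} (\<lambda>_. borel)"
      "(\<lambda>\<omega>. \<lambda>t\<in>{t}. X t \<omega>) \<in> M \<rightarrow>\<^sub>M PiM {t} (\<lambda>_. borel)"
      using t meas by (auto intro!: measurable_restrict borel_measurable_times)
    have iexp_m: "(\<lambda>f. iexp (\<theta> * f t)) \<in> borel_measurable (PiM {t} (\<lambda>_. borel))"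
      by measurable
    have "integral\<^sup>L (distr M (PiM {t} (\<lambda>_. borel)) (\<lambda>\<omega>. \<lambda>t\<in>{t}. 2 * X (t * 2 powr (-\<alpha>)) \<omega>)) (\<lambda>f. iexp (\<theta> * f t))
      = integral\<^sup>L (distr M (PiM {t} (\<lambda>_. borel)) (\<lambda>\<omega>. \<lambda>t\<in>{t}. X t \<omega>)) (\<lambda>f. iexp (\<theta> * f t))"
      unfolding eq ..
    then have "(\<integral>\<omega>. iexp (\<theta> * (2 * X (t * 2 powr - \<alpha>) \<omega>)) \<partial>M) = (\<integral>\<omega>. iexp (\<theta> * X t \<omega>) \<partial>M)"
      unfolding integral_distr[OF m(1) iexp_m] integral_distr[OF m(2) iexp_m] by simp
    moreover have "char (distr M borel (X s)) u = (\<integral>\<omega>. iexp (u * X s \<omega>) \<partial>M)" if "0 \<le> s" for s u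
      unfolding char_def using meas[OF that] by (intro integral_distr) auto
    ultimately show ?thesis
      using t by (simp add: mult.assoc mult.left_commute[of \<theta> 2])
  qed
  have "2 powr (- \<alpha>) * e * 2 - e = 0"
  proof -
    have "exp (of_real t * (\<i> * of_real (2 powr (- \<alpha>) * e * 2 - e))) = 1" if t: "0 \<le> t" for t
    proof -
      have se: "stable_exponent \<beta> \<gamma> 2 = of_real (2 powr \<alpha>) * stable_exponent \<beta> \<gamma> 1"
        using stable_exponent_scale[of 2 \<beta> \<gamma> 1] s by simp
      have "complex_of_real (2 powr - \<alpha>) * of_real (2 powr \<alpha>) = 1"
        unfolding of_real_mult[symmetric] by (simp add: powr_add[symmetric])
      then have se': "complex_of_real (2 powr - \<alpha>) * (of_real (2 powr \<alpha>) * z) = z" for z by (simp add: mult.assoc[symmetric])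
      have "exp (of_real (t * 2 powr (- \<alpha>)) * (stable_exponent \<beta> \<gamma> 2 + \<i> * of_real (e * 2)))
        = exp (of_real t * (stable_exponent \<beta> \<gamma> 1 + \<i> * of_real e))"
        using scale[OF t, of 1] t by (simp add: ch)
      then have E: "exp (of_real (t * 2 powr (- \<alpha>)) * (stable_exponent \<beta> \<gamma> 2 + \<i> * of_real (e * 2))
         - of_real t * (stable_exponent \<beta> \<gamma> 1 + \<i> * of_real e)) = 1"
        by (simp add: exp_diff)
      have "of_real (t * 2 powr (- \<alpha>)) * (stable_exponent \<beta> \<gamma> 2 + \<i> * of_real (e * 2))
         - of_real t * (stable_exponent \<beta> \<gamma> 1 + \<i> * of_real e) = of_real t * (\<i> * of_real (2 powr (- \<alpha>) * e * 2 - e))"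
        unfolding se by (simp add: distrib_left right_diff_distrib mult.assoc se')
      with E show ?thesis by (simp only:)
    qed
    from exp_of_real_multiples_eq_1[OF this] show ?thesis by (metis complex_i_not_zero mult_eq_0_iff of_real_eq_0_iff)
  qed
  then have "e * (2 powr (1 - \<alpha>) - 1) = 0" by (simp add: powr_diff powr_minus field_simps)
  moreover have "2 powr (1 - \<alpha>) < 2 powr 0" using \<alpha> by (intro powr_less_mono) auto
  ultimately have "e = 0" by auto
  then show ?thesis using ch[OF t] by (simp add: \<beta>_def \<gamma>_def)
qed

section \<open>The candidate harmonic function\<close>

lemma integrable_window:
  assumes "0 < s" "0 \<le> c"
  shows "integrable lborel (\<lambda>b. indicator {0<..<c} b * pos_powr s b)"
proof -
  have "(\<lambda>b. indicator {0<..<c} b * pos_powr s b) = (\<lambda>b. indicator {..<c} b * pos_powr s b)"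
    by (auto simp: fun_eq_iff indicator_def pos_powr_def)
  then show ?thesis using pos_powr_integrable_near_0[OF assms] by simp
qed

lemma pos_powr_mult: "pos_powr s u * pos_powr t u = pos_powr (s + t - 1) u"
  by (auto simp: pos_powr_def powr_add[symmetric] algebra_simps)

lemma pos_powr_antimono: "s \<le> 1 \<Longrightarrow> 0 < u \<Longrightarrow> u \<le> v \<Longrightarrow> pos_powr s v \<le> pos_powr s u"
  by (auto simp: pos_powr_def intro!: powr_mono2')

lemma pos_powr_isCont: "0 < u \<Longrightarrow> isCont (pos_powr s) u"
proof -
  assume u: "0 < u"
  have "isCont (\<lambda>z. z powr (s - 1)) u" using u by (intro continuous_intros) auto
  moreover have "\<forall>\<^sub>F z in nhds u. pos_powr s z = z powr (s - 1)"
    using eventually_nhds_in_open[of "{0<..}" u] u by (auto elim!: eventually_mono simp: pos_powr_def)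
  ultimately show ?thesis by (subst isCont_cong) auto
qed

text \<open>Up to a constant, the potential density at 0 of the process started at x and killed
  above level c. The variable b plays the maximum: (b-x)^(\<beta>-1) accounts for the climb from x
  to b, b^(\<gamma>-1) for the descent from b to 0. The level is a parameter because the upper bound
  works with c > 1.\<close>

definition killed_potential :: "real \<Rightarrow> real \<Rightarrow> real \<Rightarrow> real \<Rightarrow> real" where
  "killed_potential \<beta> \<gamma> c x = (\<integral>b. indicator {0<..<c} b * pos_powr \<gamma> b * pos_powr \<beta> (b - x) \<partial>lborel)"

locale stable_indices =
  fixes \<beta> \<gamma> :: real
  assumes \<beta>: "0 < \<beta>" "\<beta> < 1" and \<gamma>: "0 < \<gamma>" "\<gamma> < 1" and \<alpha>: "1 < \<beta> + \<gamma>"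
begin

abbreviation "H \<equiv> killed_potential \<beta> \<gamma>"

text \<open>The integrand of H at x = 0, where the two singularities merge into
  u^(\<beta>+\<gamma>-2), integrable as \<beta> + \<gamma> > 1. It majorises the integrand for every
  x, which bounds H by its value at 0.\<close>

definition dom :: "real \<Rightarrow> real \<Rightarrow> real" where
  "dom c u = indicator {0<..<c} u * pos_powr (\<beta> + \<gamma> - 1) u"

lemma dom_integrable: "0 \<le> c \<Longrightarrow> integrable lborel (dom c)"
  unfolding dom_def using \<alpha> by (intro integrable_window) auto

text \<open>In the variable u = b - x the singularity of the kernel stays at 0. For x <= 0 the
  original form of the integrand lies below \<open>dom\<close>, for x >= 0 this shifted form does;
  each estimate of H uses the form suited to the sign of x.\<close>

lemma H_shift: "H c x = (\<integral>u. indicator {0<..<c} (u + x) * pos_powr \<gamma> (u + x) * pos_powr \<beta> u \<partial>lborel)"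
  unfolding killed_potential_def
  by (subst lborel_integral_real_affine[of 1 _ x]) (auto simp: add.commute)

lemma H_integrand_le:
  assumes "x \<le> 0"
  shows "indicator {0<..<c} b * pos_powr \<gamma> b * pos_powr \<beta> (b - x) \<le> dom c b"
proof (cases "0 < b \<and> b < c")
  case True
  then have "pos_powr \<gamma> b * pos_powr \<beta> (b - x) \<le> pos_powr \<gamma> b * pos_powr \<beta> b"
    using assms \<beta> by (intro mult_left_mono pos_powr_antimono) auto
  then show ?thesis using True by (simp add: dom_def pos_powr_mult add.commute)
qed (auto simp: dom_def indicator_def)

lemma H_shift_integrand_le:
  assumes "0 \<le> x"
  shows "indicator {0<..<c} (u + x) * pos_powr \<gamma> (u + x) * pos_powr \<beta> u \<le> dom c u"
proof (cases "0 < u \<and> u + x < c")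
  case True
  then have "pos_powr \<gamma> (u + x) * pos_powr \<beta> u \<le> pos_powr \<gamma> u * pos_powr \<beta> u"
    using assms \<gamma> by (intro mult_right_mono pos_powr_antimono) auto
  then show ?thesis using True assms by (simp add: dom_def pos_powr_mult add.commute)
qed (auto simp: dom_def indicator_def pos_powr_def)

lemma H_integrable:
  assumes "0 \<le> c"
  shows "integrable lborel (\<lambda>b. indicator {0<..<c} b * pos_powr \<gamma> b * pos_powr \<beta> (b - x))"
proof (cases "x \<le> 0")
  case True
  then show ?thesis
    by (intro Bochner_Integration.integrable_bound[OF dom_integrable[OF assms]])
       (use H_integrand_le[OF True] in \<open>auto intro!: AE_I2 intro: order_trans[OF _ abs_ge_self]\<close>)
next
  case False
  then have "integrable lborel (\<lambda>u. indicator {0<..<c} (u + x) * pos_powr \<gamma> (u + x) * pos_powr \<beta> u)"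
    by (intro Bochner_Integration.integrable_bound[OF dom_integrable[OF assms]])
       (use H_shift_integrand_le[of x] in \<open>auto intro!: AE_I2 intro: order_trans[OF _ abs_ge_self]\<close>)
  from lborel_integrable_real_affine[OF this, of 1 "- x"] show ?thesis by (simp add: add.commute)
qed

lemma H_nonneg: "0 \<le> H c x"
  unfolding killed_potential_def by (intro integral_nonneg_AE AE_I2) auto

lemma H_0: "H c 0 = integral\<^sup>L lborel (dom c)"
  unfolding killed_potential_def dom_def
  by (intro Bochner_Integration.integral_cong refl) (simp add: mult.assoc pos_powr_mult add.commute)

lemma H_le_H0:
  assumes "0 \<le> c" shows "H c x \<le> H c 0"
proof (cases "x \<le> 0")
  case True
  show ?thesis unfolding H_0 unfolding killed_potential_def
    by (intro integral_mono H_integrable dom_integrable assms H_integrand_le True)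
next
  case False
  then have "integrable lborel (\<lambda>u. indicator {0<..<c} (u + x) * pos_powr \<gamma> (u + x) * pos_powr \<beta> u)"
    by (intro Bochner_Integration.integrable_bound[OF dom_integrable[OF assms]])
       (use H_shift_integrand_le[of x] in \<open>auto intro!: AE_I2 intro: order_trans[OF _ abs_ge_self]\<close>)
  then show ?thesis unfolding H_0 unfolding H_shift
    using False by (intro integral_mono dom_integrable assms H_shift_integrand_le) auto
qed

lemma H_eq_0: "c \<le> x \<Longrightarrow> H c x = 0"
  unfolding killed_potential_def
  by (intro integral_eq_zero_AE AE_I2) (auto simp: indicator_def pos_powr_def)

text \<open>Dominated convergence on each closed half-line, with the form of the integrand that
  \<open>dom\<close> majorises there; the two closed pieces are then glued at 0.\<close>

lemma H_continuous: 
  assumes c: "0 \<le> c"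
  shows "continuous_on UNIV (H c)"
proof -
  have "continuous_on {..0} (H c)"
    unfolding continuous_on_sequentially
  proof (intro allI ballI impI, elim conjE)
    fix u :: "nat \<Rightarrow> real" and x :: real assume x: "x \<in> {..0}" and u: "\<forall>n. u n \<in> {..0}" "u \<longlonglongrightarrow> x"
    show "(H c \<circ> u) \<longlonglongrightarrow> H c x"
      unfolding o_def killed_potential_def
    proof (rule integral_dominated_convergence[OF _ _ dom_integrable[OF c]])
      show "AE b in lborel. (\<lambda>n. indicator {0<..<c} b * pos_powr \<gamma> b * pos_powr \<beta> (b - u n)) \<longlonglongrightarrow> indicator {0<..<c} b * pos_powr \<gamma> b * pos_powr \<beta> (b - x)"
      proof (intro AE_I2)
        fix b :: real
        show "(\<lambda>n. indicator {0<..<c} b * pos_powr \<gamma> b * pos_powr \<beta> (b - u n)) \<longlonglongrightarrow> indicator {0<..<c} b * pos_powr \<gamma> b * pos_powr \<beta> (b - x)"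
        proof (cases "0 < b")
          case True
          then have "0 < b - x" using x by simp
          then show ?thesis
            by (intro tendsto_mult tendsto_const isCont_tendsto_compose[OF pos_powr_isCont] tendsto_diff u(2))
        qed (simp add: pos_powr_def)
      qed
      show "AE b in lborel. norm (indicator {0<..<c} b * pos_powr \<gamma> b * pos_powr \<beta> (b - u n)) \<le> dom c b" for n
        using H_integrand_le u(1) by (intro AE_I2) auto
    qed (auto simp: dom_def)
  qed
  moreover have "continuous_on {0..} (H c)"
    unfolding continuous_on_sequentially
  proof (intro allI ballI impI, elim conjE)
    fix v :: "nat \<Rightarrow> real" and x :: real assume x: "x \<in> {0..}" and v: "\<forall>n. v n \<in> {0..}" "v \<longlonglongrightarrow> x"
    show "(H c \<circ> v) \<longlonglongrightarrow> H c x"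
      unfolding o_def H_shift
    proof (rule integral_dominated_convergence[OF _ _ dom_integrable[OF c]])
      \<comment> \<open>At u = c - x the shifted window indicator is discontinuous, so pointwise
        convergence may fail there.\<close>
      have "AE u in lborel. u \<noteq> c - x" by (rule AE_lborel_singleton)
      then show "AE u in lborel. (\<lambda>n. indicator {0<..<c} (u + v n) * pos_powr \<gamma> (u + v n) * pos_powr \<beta> u) \<longlonglongrightarrow> indicator {0<..<c} (u + x) * pos_powr \<gamma> (u + x) * pos_powr \<beta> u"
      proof eventually_elim
        fix u :: real assume ne: "u \<noteq> c - x"
        show "(\<lambda>n. indicator {0<..<c} (u + v n) * pos_powr \<gamma> (u + v n) * pos_powr \<beta> u) \<longlonglongrightarrow> indicator {0<..<c} (u + x) * pos_powr \<gamma> (u + x) * pos_powr \<beta> u"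
        proof (cases "0 < u")
          case True
          then have p: "0 < u + x" using x by simp
          have ux: "(\<lambda>n. u + v n) \<longlonglongrightarrow> u + x" by (intro tendsto_intros v(2))
          have "(\<lambda>n. indicator {0<..<c} (u + v n) :: real) \<longlonglongrightarrow> indicator {0<..<c} (u + x)"
          proof (cases "u + x < c")
            case True
            have "\<forall>\<^sub>F n in sequentially. u + v n \<in> {0<..<c}"
              by (rule topological_tendstoD[OF ux]) (use True p in auto)
            then have "\<forall>\<^sub>F n in sequentially. indicator {0<..<c} (u + v n) = (1::real)" by eventually_elim simp
            then show ?thesis using True p by (intro tendsto_eventually) simp
          next
            case False
            then have "c < u + x" using ne by simp
            have "\<forall>\<^sub>F n in sequentially. u + v n \<in> {c<..}"
              by (rule topological_tendstoD[OF ux]) (use \<open>c < u + x\<close> in auto)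
            then have "\<forall>\<^sub>F n in sequentially. indicator {0<..<c} (u + v n) = (0::real)" by eventually_elim simp
            then show ?thesis using False by (intro tendsto_eventually) simp
          qed
          then show ?thesis
            by (intro tendsto_mult tendsto_const isCont_tendsto_compose[OF pos_powr_isCont[OF p] ux])
        qed (simp add: pos_powr_def)
      qed
      show "AE u in lborel. norm (indicator {0<..<c} (u + v n) * pos_powr \<gamma> (u + v n) * pos_powr \<beta> u) \<le> dom c u" for n
        using H_shift_integrand_le v(1) by (intro AE_I2) auto
    qed (auto simp: dom_def)
  qed
  ultimately have "continuous_on ({..0} \<union> {0..}) (H c)"
    by (intro continuous_on_closed_Un) auto
  moreover have "{..0} \<union> {0..} = (UNIV :: real set)" by auto
  ultimately show ?thesis by simp
qed

lemma H_lim: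
  assumes "0 \<le> c" "u \<longlonglongrightarrow> y" shows "(\<lambda>n. H c (u n)) \<longlonglongrightarrow> H c y"
  using H_continuous[OF assms(1)] assms(2)
  by (auto simp: continuous_on_eq_continuous_at intro: isCont_tendsto_compose)

lemma H_measurable [measurable]: "0 \<le> c \<Longrightarrow> H c \<in> borel_measurable borel"
  using H_continuous by (rule borel_measurable_continuous_onI)

text \<open>To the right H vanishes beyond c. To the left (b-x)^(\<beta>-1) <= (-x)^(\<beta>-1),
  which tends to 0 because \<beta> < 1.\<close>

lemma H_far:
  assumes c: "0 \<le> c" and \<epsilon>: "0 < \<epsilon>"
  shows "\<exists>K>0. \<forall>x. K < \<bar>x\<bar> \<longrightarrow> H c x \<le> \<epsilon>"
proof -
  define C where "C = (\<integral>b. indicator {0<..<c} b * pos_powr \<gamma> b \<partial>lborel)"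
  have Ci: "integrable lborel (\<lambda>b. indicator {0<..<c} b * pos_powr \<gamma> b)"
    using \<gamma> c by (intro integrable_window) auto
  have b: "H c x \<le> C * (- x) powr (\<beta> - 1)" if "x < 0" for x
  proof -
    have "H c x \<le> (\<integral>b. (indicator {0<..<c} b * pos_powr \<gamma> b) * (- x) powr (\<beta> - 1) \<partial>lborel)"
      unfolding killed_potential_def
    proof (intro integral_mono H_integrable c integrable_mult_left[OF Ci])
      fix b :: real
      show "indicator {0<..<c} b * pos_powr \<gamma> b * pos_powr \<beta> (b - x) \<le> indicator {0<..<c} b * pos_powr \<gamma> b * (- x) powr (\<beta> - 1)"
      proof (cases "0 < b")
        case True
        have "pos_powr \<beta> (b - x) \<le> pos_powr \<beta> (- x)"
          using that True \<beta> by (intro pos_powr_antimono) auto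
        also have "\<dots> = (- x) powr (\<beta> - 1)" using that by (simp add: pos_powr_def)
        finally show ?thesis by (intro mult_left_mono) auto
      qed (simp add: pos_powr_def)
    qed
    then show ?thesis by (simp add: C_def)
  qed
  have "((\<lambda>x. C * x powr (\<beta> - 1)) \<longlongrightarrow> C * 0) at_top"
    using \<beta> by (intro tendsto_mult tendsto_const tendsto_neg_powr filterlim_ident) auto
  then have "\<forall>\<^sub>F x in at_top. C * x powr (\<beta> - 1) < \<epsilon>"
    using \<epsilon> by (intro order_tendstoD) auto
  then obtain K where K: "\<And>x. K \<le> x \<Longrightarrow> C * x powr (\<beta> - 1) < \<epsilon>" by (auto simp: eventually_at_top_linorder)
  show ?thesis
  proof (intro exI[of _ "max 1 (max K c)"] conjI allI impI)
    fix x assume x: "max 1 (max K c) < \<bar>x\<bar>"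
    show "H c x \<le> \<epsilon>"
    proof (cases "x < 0")
      case True
      then show ?thesis using b[OF True] K[of "- x"] x by simp
    next
      case False
      then show ?thesis using x H_eq_0[of c x] \<epsilon> by simp
    qed
  qed simp
qed

text \<open>On the additional window [1,c) both power factors are decreasing and so at most their
  values at b = 1, namely 1 and (1-x)^(\<beta>-1). This is the cost of raising the cut-off in the
  upper bound.\<close>

lemma H_level:
  assumes "1 \<le> c" "x < 1"
  shows "H 1 x \<le> H c x" "H c x \<le> H 1 x + (c - 1) * (1 - x) powr (\<beta> - 1)"
proof -
  show "H 1 x \<le> H c x"
    unfolding killed_potential_def using assms
    by (intro integral_mono H_integrable) (auto simp: indicator_def)
  have i: "integrable lborel (\<lambda>b. indicator {1..<c} b * (1 - x) powr (\<beta> - 1))"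
    using assms by (intro integrable_mult_left integrable_real_indicator) auto
  have "H c x \<le> (\<integral>b. indicator {0<..<1} b * pos_powr \<gamma> b * pos_powr \<beta> (b - x) + indicator {1..<c} b * (1 - x) powr (\<beta> - 1) \<partial>lborel)"
    unfolding killed_potential_def
  proof (intro integral_mono H_integrable Bochner_Integration.integrable_add i)
    fix b :: real
    show "indicator {0<..<c} b * pos_powr \<gamma> b * pos_powr \<beta> (b - x) \<le> indicator {0<..<1} b * pos_powr \<gamma> b * pos_powr \<beta> (b - x) + indicator {1..<c} b * (1 - x) powr (\<beta> - 1)"
    proof (cases "1 \<le> b \<and> b < c")
      case True
      have "pos_powr \<gamma> b \<le> pos_powr \<gamma> 1" using True \<gamma> by (intro pos_powr_antimono) auto
      moreover have "pos_powr \<beta> (b - x) \<le> pos_powr \<beta> (1 - x)" using True \<beta> assms by (intro pos_powr_antimono) auto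
      ultimately have "pos_powr \<gamma> b * pos_powr \<beta> (b - x) \<le> 1 * (1 - x) powr (\<beta> - 1)"
        using assms by (intro mult_mono) (auto simp: pos_powr_def)
      then show ?thesis using True by (auto simp: indicator_def)
    qed (auto simp: indicator_def)
  qed (use assms in auto)
  also have "\<dots> = H 1 x + (c - 1) * (1 - x) powr (\<beta> - 1)"
    unfolding killed_potential_def
    using assms by (subst Bochner_Integration.integral_add[OF H_integrable i]) auto
  finally show "H c x \<le> H 1 x + (c - 1) * (1 - x) powr (\<beta> - 1)" .
qed

section \<open>Explicit values of the candidate at level 1\<close>

lemma H_1_0: "(\<beta> + \<gamma> - 1) * H 1 0 = 1"
proof -
  have "((\<lambda>x. x powr (\<beta> + \<gamma> - 2)) has_integral (1 powr (\<beta> + \<gamma> - 2 + 1) / (\<beta> + \<gamma> - 2 + 1))) {0..1::real}"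
    using \<alpha> by (intro has_integral_powr_from_0) auto
  then have "((\<lambda>x. x powr (\<beta> + \<gamma> - 2)) has_integral (1 / (\<beta> + \<gamma> - 1))) {0<..<1::real}"
    by (simp add: has_integral_Icc_iff_Ioo)
  then have "((\<lambda>x. if x \<in> {0<..<1} then x powr (\<beta> + \<gamma> - 2) else 0) has_integral (1 / (\<beta> + \<gamma> - 1))) UNIV"
    by (simp only: has_integral_restrict_UNIV)
  moreover have "(\<lambda>x. if x \<in> {0<..<1} then x powr (\<beta> + \<gamma> - 2) else 0) = dom 1"
    by (auto simp: dom_def fun_eq_iff pos_powr_def algebra_simps)
  moreover have "(dom 1 has_integral integral\<^sup>L lborel (dom 1)) UNIV"
    by (rule has_integral_integral_lborel[OF dom_integrable]) simp
  ultimately have "H 1 0 = 1 / (\<beta> + \<gamma> - 1)" unfolding H_0 using has_integral_unique by metis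
  then show ?thesis using \<alpha> by simp
qed

text \<open>Substitution b = x t, which turns b - x into x (t - 1); the powers of x collect to
  \<beta> + \<gamma> - 1.\<close>

lemma H_1_pos:
  assumes "0 < x" "x < 1"
  shows "H 1 x = x powr (\<beta> + \<gamma> - 1) * (LINT t:{1..1/x}|lborel. (t - 1) powr (\<beta> - 1) * t powr (\<gamma> - 1))"
proof -
  have "H 1 x = x * (\<integral>t. indicator {0<..<1} (x * t) * pos_powr \<gamma> (x * t) * pos_powr \<beta> (x * t - x) \<partial>lborel)"
    unfolding killed_potential_def
    using assms by (subst lborel_integral_real_affine[of x _ 0]) auto
  also have "(\<integral>t. indicator {0<..<1} (x * t) * pos_powr \<gamma> (x * t) * pos_powr \<beta> (x * t - x) \<partial>lborel)
    = (\<integral>t. x powr (\<beta> + \<gamma> - 2) * (indicator {1..1/x} t * ((t - 1) powr (\<beta> - 1) * t powr (\<gamma> - 1))) \<partial>lborel)"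
  proof (rule integral_cong_AE)
    \<comment> \<open>The window is open while the interval of the set integral is closed; they
      differ at this endpoint.\<close>
    have "AE t in lborel. t \<noteq> 1 / x" by (rule AE_lborel_singleton)
    then show "AE t in lborel. indicator {0<..<1} (x * t) * pos_powr \<gamma> (x * t) * pos_powr \<beta> (x * t - x)
      = x powr (\<beta> + \<gamma> - 2) * (indicator {1..1/x} t * ((t - 1) powr (\<beta> - 1) * t powr (\<gamma> - 1)))"
    proof eventually_elim
      fix t assume ne: "t \<noteq> 1 / x"
      show "indicator {0<..<1} (x * t) * pos_powr \<gamma> (x * t) * pos_powr \<beta> (x * t - x)
        = x powr (\<beta> + \<gamma> - 2) * (indicator {1..1/x} t * ((t - 1) powr (\<beta> - 1) * t powr (\<gamma> - 1)))"
      proof (cases "1 < t \<and> t < 1 / x")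
        case True
        have e: "x * t - x = x * (t - 1)" by (simp add: algebra_simps)
        have lt: "x * t < 1" using True assms by (simp add: field_simps)
        have "pos_powr \<gamma> (x * t) = x powr (\<gamma> - 1) * t powr (\<gamma> - 1)" "pos_powr \<beta> (x * t - x) = x powr (\<beta> - 1) * (t - 1) powr (\<beta> - 1)"
          unfolding e using True assms by (simp_all add: pos_powr_def powr_mult)
        moreover have "x powr (\<beta> + \<gamma> - 2) = x powr (\<gamma> - 1) * x powr (\<beta> - 1)"
          by (simp add: powr_add[symmetric] algebra_simps)
        ultimately show ?thesis using True lt assms by simp
      next
        case False
        then consider "t \<le> 1" | "1 / x < t" using ne by linarith
        then show ?thesis
        proof cases
          case 1
          then have "x * t - x \<le> 0" using assms by simp
          then show ?thesis using 1 by (auto simp: pos_powr_def indicator_def)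
        next
          case 2
          then have "1 < x * t" using assms by (simp add: field_simps)
          then show ?thesis using 2 by (auto simp: indicator_def)
        qed
      qed
    qed
  qed measurable
  also have "x * \<dots> = (x * x powr (\<beta> + \<gamma> - 2)) * (LINT t:{1..1/x}|lborel. (t - 1) powr (\<beta> - 1) * t powr (\<gamma> - 1))"
    by (simp add: set_lebesgue_integral_def)
  also have "x * x powr (\<beta> + \<gamma> - 2) = x powr (\<beta> + \<gamma> - 1)"
    using powr_mult_base[of x "\<beta> + \<gamma> - 2"] assms by (simp add: algebra_simps)
  finally show ?thesis .
qed

text \<open>With z = -x the substitution is b = z (t - 1), so that b - x = z t. This exchanges the
  roles of the two exponents relative to positive x.\<close>

lemma H_1_neg:
  assumes "x < 0"
  shows "H 1 x = (- x) powr (\<beta> + \<gamma> - 1) * (LINT t:{1..1 - 1/x}|lborel. (t - 1) powr (\<gamma> - 1) * t powr (\<beta> - 1))"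
proof -
  define z where "z = - x"
  have z: "0 < z" "x = - z" using assms by (auto simp: z_def)
  have "H 1 x = z * (\<integral>t. indicator {0<..<1} (z * (t - 1)) * pos_powr \<gamma> (z * (t - 1)) * pos_powr \<beta> (z * t) \<partial>lborel)"
    unfolding killed_potential_def
    using z by (subst lborel_integral_real_affine[of z _ "- z"]) (auto simp: algebra_simps)
  also have "(\<integral>t. indicator {0<..<1} (z * (t - 1)) * pos_powr \<gamma> (z * (t - 1)) * pos_powr \<beta> (z * t) \<partial>lborel)
    = (\<integral>t. z powr (\<beta> + \<gamma> - 2) * (indicator {1..1 - 1/x} t * ((t - 1) powr (\<gamma> - 1) * t powr (\<beta> - 1))) \<partial>lborel)"
  proof (rule integral_cong_AE)
    have "AE t in lborel. t \<noteq> 1 - 1 / x" by (rule AE_lborel_singleton)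
    then show "AE t in lborel. indicator {0<..<1} (z * (t - 1)) * pos_powr \<gamma> (z * (t - 1)) * pos_powr \<beta> (z * t)
      = z powr (\<beta> + \<gamma> - 2) * (indicator {1..1 - 1/x} t * ((t - 1) powr (\<gamma> - 1) * t powr (\<beta> - 1)))"
    proof eventually_elim
      fix t assume ne: "t \<noteq> 1 - 1 / x"
      have iff: "z * (t - 1) < 1 \<longleftrightarrow> t < 1 - 1 / x" using z by (simp add: field_simps)
      show "indicator {0<..<1} (z * (t - 1)) * pos_powr \<gamma> (z * (t - 1)) * pos_powr \<beta> (z * t)
        = z powr (\<beta> + \<gamma> - 2) * (indicator {1..1 - 1/x} t * ((t - 1) powr (\<gamma> - 1) * t powr (\<beta> - 1)))"
      proof (cases "1 < t \<and> t < 1 - 1 / x")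
        case True
        have "pos_powr \<gamma> (z * (t - 1)) = z powr (\<gamma> - 1) * (t - 1) powr (\<gamma> - 1)" "pos_powr \<beta> (z * t) = z powr (\<beta> - 1) * t powr (\<beta> - 1)"
          using True z(1) by (simp_all add: pos_powr_def powr_mult)
        moreover have "z powr (\<beta> + \<gamma> - 2) = z powr (\<gamma> - 1) * z powr (\<beta> - 1)"
          by (simp add: powr_add[symmetric] algebra_simps)
        moreover have "z * (t - 1) < 1" "0 < z * (t - 1)" using True z(1) iff by auto
        ultimately show ?thesis using True by simp
      next
        case False
        then consider "t \<le> 1" | "1 - 1 / x < t" using ne by linarith
        then show ?thesis
        proof cases
          case 1
          then have "z * (t - 1) \<le> 0" using z(1) by (simp add: mult_le_0_iff)
          then show ?thesis using 1 by (auto simp: pos_powr_def indicator_def)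
        next
          case 2
          then have "\<not> z * (t - 1) < 1" using iff by simp
          then show ?thesis using 2 by (auto simp: indicator_def)
        qed
      qed
    qed
  qed measurable
  also have "z * \<dots> = (z * z powr (\<beta> + \<gamma> - 2)) * (LINT t:{1..1 - 1/x}|lborel. (t - 1) powr (\<gamma> - 1) * t powr (\<beta> - 1))"
    by (simp add: set_lebesgue_integral_def)
  also have "z * z powr (\<beta> + \<gamma> - 2) = (- x) powr (\<beta> + \<gamma> - 1)"
    using powr_mult_base[of z "\<beta> + \<gamma> - 2"] z by (simp add: algebra_simps)
  finally show ?thesis .
qed

section \<open>The Abel-type integral responsible for harmonicity\<close>

definition weight :: "real \<Rightarrow> real \<Rightarrow> real" where
  "weight c u = (\<integral>b. indicator {0<..<c} b * pos_powr \<gamma> b * pos_powr (1 - \<gamma>) (u - b) \<partial>lborel)"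

text \<open>Under b = u t the exponents \<gamma> - 1 and -\<gamma> and the Jacobian add up to u^0,
  so the integral does not depend on u. This scale invariance is the reason why
  \<open>weight\<close> is constant between 0 and the cut-off.\<close>

lemma Beta_integrable: "0 < u \<Longrightarrow> integrable lborel (\<lambda>b. pos_powr \<gamma> b * pos_powr (1 - \<gamma>) (u - b))"
  and Beta_integral: "0 < u \<Longrightarrow> (\<integral>b. pos_powr \<gamma> b * pos_powr (1 - \<gamma>) (u - b) \<partial>lborel) = Beta \<gamma> (1 - \<gamma>)"
proof -
  have i: "integrable lborel (\<lambda>t. indicator {0<..<1} t * (t powr (\<gamma> - 1) * (1 - t) powr ((1 - \<gamma>) - 1)))"
  proof -
    have "integrable lborel (\<lambda>t. indicator {0..1} t *\<^sub>R (t powr (\<gamma> - 1) * (1 - t) powr ((1 - \<gamma>) - 1)))"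
      using integrable_Beta[of \<gamma> "1 - \<gamma>"] \<gamma> by (simp add: set_integrable_def)
    then show ?thesis
      by (rule Bochner_Integration.integrable_bound) (auto simp: indicator_def)
  qed
  have "((\<lambda>t. t powr (\<gamma> - 1) * (1 - t) powr ((1 - \<gamma>) - 1)) has_integral Beta \<gamma> (1 - \<gamma>)) {0<..<1}"
    using has_integral_Beta_real[of \<gamma> "1 - \<gamma>"] \<gamma> by (simp add: has_integral_Icc_iff_Ioo)
  then have "((\<lambda>t. if t \<in> {0<..<1} then t powr (\<gamma> - 1) * (1 - t) powr ((1 - \<gamma>) - 1) else 0) has_integral Beta \<gamma> (1 - \<gamma>)) UNIV"
    by (simp only: has_integral_restrict_UNIV)
  also have "(\<lambda>t. if t \<in> {0<..<1} then t powr (\<gamma> - 1) * (1 - t) powr ((1 - \<gamma>) - 1) else 0) = (\<lambda>t. indicator {0<..<1} t * (t powr (\<gamma> - 1) * (1 - t) powr ((1 - \<gamma>) - 1)))"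
    by (auto simp: fun_eq_iff indicator_def)
  finally have A: "((\<lambda>t. indicator {0<..<1} t * (t powr (\<gamma> - 1) * (1 - t) powr ((1 - \<gamma>) - 1))) has_integral Beta \<gamma> (1 - \<gamma>)) UNIV" .
  have v: "(\<integral>t. indicator {0<..<1} t * (t powr (\<gamma> - 1) * (1 - t) powr ((1 - \<gamma>) - 1)) \<partial>lborel) = Beta \<gamma> (1 - \<gamma>)"
    by (rule has_integral_unique[OF has_integral_integral_lborel[OF i] A])
  have e: "pos_powr \<gamma> (u * t) * pos_powr (1 - \<gamma>) (u - u * t) = (1 / u) * (indicator {0<..<1} t * (t powr (\<gamma> - 1) * (1 - t) powr ((1 - \<gamma>) - 1)))"
    if u: "0 < u" for u t
  proof (cases "0 < t \<and> t < 1")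
    case True
    have d: "u - u * t = u * (1 - t)" by (simp add: algebra_simps)
    have "u powr (\<gamma> - 1) * u powr (- \<gamma>) = u powr ((\<gamma> - 1) + - \<gamma>)" by (simp only: powr_add)
    also have "\<dots> = 1 / u" using u by (simp add: powr_minus_divide)
    finally have "u powr (\<gamma> - 1) * u powr (- \<gamma>) = 1 / u" .
    then have "(1 / u) * (indicator {0<..<1} t * (t powr (\<gamma> - 1) * (1 - t) powr ((1 - \<gamma>) - 1)))
      = (u powr (\<gamma> - 1) * u powr (- \<gamma>)) * (t powr (\<gamma> - 1) * (1 - t) powr ((1 - \<gamma>) - 1))"
      using True by simp
    then show ?thesis unfolding d using True u by (simp add: pos_powr_def powr_mult mult_ac)
  next
    case False
    then have "u * t \<le> 0 \<or> u - u * t \<le> 0" using u by (auto simp: mult_le_0_iff)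
    then show ?thesis using False by (auto simp: pos_powr_def)
  qed
  show "integrable lborel (\<lambda>b. pos_powr \<gamma> b * pos_powr (1 - \<gamma>) (u - b))" if u: "0 < u" for u
  proof -
    have "integrable lborel (\<lambda>t. pos_powr \<gamma> (0 + u * t) * pos_powr (1 - \<gamma>) (u - (0 + u * t)))"
      unfolding add_0 e[OF u] using i by (intro integrable_mult_right)
    then show ?thesis using lborel_integrable_real_affine_iff[of u "\<lambda>b. pos_powr \<gamma> b * pos_powr (1 - \<gamma>) (u - b)" 0] u by simp
  qed
  show "(\<integral>b. pos_powr \<gamma> b * pos_powr (1 - \<gamma>) (u - b) \<partial>lborel) = Beta \<gamma> (1 - \<gamma>)" if u: "0 < u" for u
  proof -
    have "(\<integral>b. pos_powr \<gamma> b * pos_powr (1 - \<gamma>) (u - b) \<partial>lborel) = u * (\<integral>t. pos_powr \<gamma> (u * t) * pos_powr (1 - \<gamma>) (u - u * t) \<partial>lborel)"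
      using u by (subst lborel_integral_real_affine[of u _ 0]) auto
    also have "\<dots> = Beta \<gamma> (1 - \<gamma>)"
      unfolding e[OF u] integral_mult_right_zero v using u by simp
    finally show ?thesis .
  qed
qed

lemma weight_integrable: "integrable lborel (\<lambda>b. indicator {0<..<c} b * pos_powr \<gamma> b * pos_powr (1 - \<gamma>) (u - b))"
proof (cases "0 < u")
  case True
  show ?thesis
    by (rule Bochner_Integration.integrable_bound[OF Beta_integrable[OF True]]) (auto simp: indicator_def)
next
  case False
  then have "(\<lambda>b. indicator {0<..<c} b * pos_powr \<gamma> b * pos_powr (1 - \<gamma>) (u - b)) = (\<lambda>_. 0)"
    by (auto simp: fun_eq_iff indicator_def pos_powr_def)
  then show ?thesis by simp
qed

lemma weight_nonneg: "0 \<le> weight c u"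
  unfolding weight_def by (intro integral_nonneg_AE AE_I2) auto

lemma weight_le: "weight c u \<le> Beta \<gamma> (1 - \<gamma>)"
proof (cases "0 < u")
  case True
  show ?thesis unfolding weight_def Beta_integral[OF True, symmetric]
    by (intro integral_mono weight_integrable Beta_integrable True) (auto simp: indicator_def)
next
  case False
  then have "(\<lambda>b. indicator {0<..<c} b * pos_powr \<gamma> b * pos_powr (1 - \<gamma>) (u - b)) = (\<lambda>_. 0)"
    by (auto simp: fun_eq_iff indicator_def pos_powr_def)
  moreover have "0 < Beta \<gamma> (1 - \<gamma>)" using \<gamma> by (simp add: Beta_def Gamma_real_pos)
  ultimately show ?thesis unfolding weight_def by simp
qed

lemma weight_neg: "u \<le> 0 \<Longrightarrow> weight c u = 0"
  unfolding weight_def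
  by (intro integral_eq_zero_AE AE_I2) (auto simp: indicator_def pos_powr_def)

text \<open>For u <= c the kernel (u-b)_+^(-\<gamma>) already vanishes for b >= u, so the cut-off at
  c is not felt and the full Beta integral results.\<close>

lemma weight_pos: "0 < u \<Longrightarrow> u \<le> c \<Longrightarrow> weight c u = Beta \<gamma> (1 - \<gamma>)"
  unfolding weight_def Beta_integral[symmetric]
  by (intro Bochner_Integration.integral_cong refl) (auto simp: indicator_def pos_powr_def)

lemma weight_measurable [measurable]: "weight c \<in> borel_measurable borel"
  unfolding weight_def by measurable

end

section \<open>Fourier representation of the smoothed candidate\<close>

text \<open>Below 1 the power is integrable and r is bounded; above 1 the power is at most 1 and r
  is integrable.\<close>

lemma integrable_pos_powr_mult:
  fixes r :: "real \<Rightarrow> real"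
  assumes s: "0 < s" "s \<le> 1" and r: "integrable lborel r" and B: "\<And>z. \<bar>r z\<bar> \<le> B"
  shows "integrable lborel (\<lambda>z. pos_powr s z * r z)"
proof (rule Bochner_Integration.integrable_bound)
  have [measurable]: "r \<in> borel_measurable borel" using r by auto
  show "integrable lborel (\<lambda>z. (indicator {..<1} z * pos_powr s z) * B + \<bar>r z\<bar>)"
    using s r by (intro Bochner_Integration.integrable_add integrable_mult_left pos_powr_integrable_near_0 integrable_abs) auto
  have B0: "0 \<le> B" using B[of 0] by linarith
  show "AE z in lborel. norm (pos_powr s z * r z) \<le> norm ((indicator {..<1} z * pos_powr s z) * B + \<bar>r z\<bar>)"
  proof (intro AE_I2)
    fix z
    have "norm (pos_powr s z * r z) \<le> (indicator {..<1} z * pos_powr s z) * B + \<bar>r z\<bar>"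
    proof (cases "z < 1")
      case True
      have "pos_powr s z * \<bar>r z\<bar> \<le> pos_powr s z * B" by (intro mult_left_mono B) auto
      then show ?thesis using True by (simp add: abs_mult)
    next
      case False
      then have "pos_powr s z \<le> pos_powr s 1" using s by (intro pos_powr_antimono) auto
      then have "pos_powr s z * \<bar>r z\<bar> \<le> 1 * \<bar>r z\<bar>" by (intro mult_right_mono) (auto simp: pos_powr_def)
      then show ?thesis using False by (simp add: abs_mult)
    qed
    then show "norm (pos_powr s z * r z) \<le> norm ((indicator {..<1} z * pos_powr s z) * B + \<bar>r z\<bar>)"
      by (rule order_trans) (simp only: real_norm_def abs_ge_self)
  qed
  show "(\<lambda>z. pos_powr s z * r z) \<in> borel_measurable lborel" by measurable
qed

text \<open>The factor exp(-\<epsilon> z) makes the double integral absolutely convergent, so Fubini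
  applies; the inner integral is the Laplace transform of the power at \<epsilon> - i
  \<theta>.\<close>

lemma damped_power_fourier:
  fixes Q :: "real \<Rightarrow> complex" and q :: "real \<Rightarrow> real"
  assumes s: "0 < s" and Q: "integrable lborel Q" and q: "\<And>u. complex_of_real (q u) = (\<integral>\<theta>. Q \<theta> * iexp (\<theta> * u) \<partial>lborel)" and \<epsilon>: "0 < \<epsilon>"
  shows "(\<integral>z. complex_of_real (pos_powr s z * exp (- \<epsilon> * z) * q (y + z)) \<partial>lborel)
    = complex_of_real (Gamma s) * (\<integral>\<theta>. (of_real \<epsilon> - \<i> * of_real \<theta>) powr (- of_real s) * Q \<theta> * iexp (\<theta> * y) \<partial>lborel)"
proof -
  have [measurable]: "Q \<in> borel_measurable borel" using Q by auto
  have e: "exp (- (of_real \<epsilon> - \<i> * of_real \<theta>) * complex_of_real z) = of_real (exp (- \<epsilon> * z)) * iexp (\<theta> * z)" for \<theta> z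
    by (simp add: exp_of_real[symmetric] exp_add[symmetric] algebra_simps)
  let ?k = "\<lambda>z. pos_powr s z * exp (- \<epsilon> * z)"
  have ki: "integrable lborel ?k" by (rule pos_powr_exp_integrable[OF s \<epsilon>])
  let ?f = "\<lambda>\<theta> z. Q \<theta> * iexp (\<theta> * y) * (complex_of_real (pos_powr s z) * exp (- (of_real \<epsilon> - \<i> * of_real \<theta>) * complex_of_real z))"
  have I: "integrable (lborel \<Otimes>\<^sub>M lborel) (\<lambda>(\<theta>, z). ?f \<theta> z)"
  proof (rule lborel_pair.Fubini_integrable)
    show "(\<lambda>(\<theta>, z). ?f \<theta> z) \<in> borel_measurable (lborel \<Otimes>\<^sub>M lborel)"
      unfolding e by measurable
    have "integrable lborel (\<lambda>\<theta>. norm (Q \<theta>) * (\<integral>z. ?k z \<partial>lborel))" using Q by auto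
    then show "integrable lborel (\<lambda>\<theta>. \<integral>z. norm (case (\<theta>, z) of (\<theta>, z) \<Rightarrow> ?f \<theta> z) \<partial>lborel)"
      unfolding e by (simp add: norm_mult)
    show "AE \<theta> in lborel. integrable lborel (\<lambda>z. case (\<theta>, z) of (\<theta>, z) \<Rightarrow> ?f \<theta> z)"
      using pos_powr_cexp_integrable[OF s, of "of_real \<epsilon> - \<i> * of_real _"] \<epsilon> by (intro AE_I2) (auto intro!: integrable_mult_right)
  qed
  have "(\<integral>z. (\<integral>\<theta>. ?f \<theta> z \<partial>lborel) \<partial>lborel) = (\<integral>\<theta>. (\<integral>z. ?f \<theta> z \<partial>lborel) \<partial>lborel)"
    by (rule lborel_pair.Fubini_integral) (use I in simp)
  moreover have "(\<integral>\<theta>. ?f \<theta> z \<partial>lborel) = complex_of_real (?k z * q (y + z))" for z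
  proof -
    have "(\<integral>\<theta>. ?f \<theta> z \<partial>lborel) = (\<integral>\<theta>. of_real (?k z) * (Q \<theta> * iexp (\<theta> * (y + z))) \<partial>lborel)"
      unfolding e by (intro Bochner_Integration.integral_cong refl) (simp add: distrib_left exp_add)
    then show ?thesis by (simp add: q)
  qed
  moreover have "(\<integral>z. ?f \<theta> z \<partial>lborel) = complex_of_real (Gamma s) * ((of_real \<epsilon> - \<i> * of_real \<theta>) powr (- of_real s) * Q \<theta> * iexp (\<theta> * y))" for \<theta>
    using \<epsilon> by (simp only: integral_mult_right_zero) (subst pos_powr_cexp_integral[OF s]; simp add: mult_ac Gamma_complex_of_real)
  ultimately show ?thesis by (simp only: integral_mult_right_zero)
qed

text \<open>Letting the damping tend to 0: integration against z_+^(s-1) acts on frequencies as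
  multiplication by Gamma(s) (-i \<theta>)^(-s). The inequality |\<epsilon> - i \<theta>| >=
  |\<theta>| supplies the majorant on the frequency side.\<close>

lemma power_fourier:
  fixes Q :: "real \<Rightarrow> complex" and q :: "real \<Rightarrow> real"
  assumes s: "0 < s" and Q: "integrable lborel Q" and q: "\<And>u. complex_of_real (q u) = (\<integral>\<theta>. Q \<theta> * iexp (\<theta> * u) \<partial>lborel)"
    and Qs: "integrable lborel (\<lambda>\<theta>. \<bar>\<theta>\<bar> powr (- s) * norm (Q \<theta>))"
    and qs: "integrable lborel (\<lambda>z. pos_powr s z * q (y + z))"
  shows "complex_of_real (\<integral>z. pos_powr s z * q (y + z) \<partial>lborel)
    = complex_of_real (Gamma s) * (\<integral>\<theta>. (- \<i> * of_real \<theta>) powr (- of_real s) * Q \<theta> * iexp (\<theta> * y) \<partial>lborel)"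
proof -
  define \<epsilon> where "\<epsilon> = (\<lambda>n. inverse (real (Suc n)))"
  have \<epsilon>0: "0 < \<epsilon> n" for n by (simp add: \<epsilon>_def)
  have \<epsilon>lim: "\<epsilon> \<longlonglongrightarrow> 0" unfolding \<epsilon>_def by (rule LIMSEQ_inverse_real_of_nat)
  have [measurable]: "Q \<in> borel_measurable borel" using Q by auto
  have qsm: "(\<lambda>z. pos_powr s z * q (y + z)) \<in> borel_measurable borel" using qs by auto
  have cqs: "integrable lborel (\<lambda>z. norm (complex_of_real (pos_powr s z * q (y + z))))" using integrable_norm[OF qs] by (simp only: norm_of_real real_norm_def)
  have L: "(\<lambda>n. \<integral>z. complex_of_real (pos_powr s z * exp (- \<epsilon> n * z) * q (y + z)) \<partial>lborel) \<longlonglongrightarrow> (\<integral>z. complex_of_real (pos_powr s z * q (y + z)) \<partial>lborel)"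
  proof (rule integral_dominated_convergence[OF _ _ cqs])
    show "(\<lambda>z. complex_of_real (pos_powr s z * q (y + z))) \<in> borel_measurable lborel"
      by (rule borel_measurable_integrable[OF integrable_of_real[OF qs]])
    have eq: "pos_powr s z * exp (- \<epsilon> n * z) * q (y + z) = exp (- \<epsilon> n * z) * (pos_powr s z * q (y + z))" for n z by simp
    show "(\<lambda>z. complex_of_real (pos_powr s z * exp (- \<epsilon> n * z) * q (y + z))) \<in> borel_measurable lborel" for n
    proof -
      note [measurable] = borel_measurable_integrable[OF integrable_of_real[OF qs, where 'a=complex]]
      have "(\<lambda>z. complex_of_real (exp (- \<epsilon> n * z)) * complex_of_real (pos_powr s z * q (y + z))) \<in> borel_measurable lborel"
        by (intro borel_measurable_times borel_measurable_integrable[OF integrable_of_real[OF qs, where 'a=complex]]) measurable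
      then show ?thesis unfolding eq by (simp only: of_real_mult)
    qed
    show "AE z in lborel. (\<lambda>n. complex_of_real (pos_powr s z * exp (- \<epsilon> n * z) * q (y + z))) \<longlonglongrightarrow> complex_of_real (pos_powr s z * q (y + z))"
    proof (intro AE_I2)
      fix z
      have "(\<lambda>n. complex_of_real (pos_powr s z * exp (- \<epsilon> n * z) * q (y + z))) \<longlonglongrightarrow> complex_of_real (pos_powr s z * exp (- 0 * z) * q (y + z))"
        by (intro tendsto_intros \<epsilon>lim)
      then show "(\<lambda>n. complex_of_real (pos_powr s z * exp (- \<epsilon> n * z) * q (y + z))) \<longlonglongrightarrow> complex_of_real (pos_powr s z * q (y + z))" by simp
    qed
    show "AE z in lborel. norm (complex_of_real (pos_powr s z * exp (- \<epsilon> n * z) * q (y + z))) \<le> norm (complex_of_real (pos_powr s z * q (y + z)))" for n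
    proof (intro AE_I2)
      fix z
      show "norm (complex_of_real (pos_powr s z * exp (- \<epsilon> n * z) * q (y + z))) \<le> norm (complex_of_real (pos_powr s z * q (y + z)))"
      proof (cases "0 < z")
        case True
        then have "exp (- \<epsilon> n * z) \<le> 1" using \<epsilon>0[of n] by (simp add: less_imp_le)
        then have "exp (- \<epsilon> n * z) * norm (pos_powr s z * q (y + z)) \<le> 1 * norm (pos_powr s z * q (y + z))"
          by (intro mult_right_mono) auto
        then show ?thesis unfolding eq norm_of_real abs_mult real_norm_def by simp
      qed (simp add: pos_powr_def)
    qed
  qed
  have R: "(\<lambda>n. \<integral>\<theta>. (of_real (\<epsilon> n) - \<i> * of_real \<theta>) powr (- of_real s) * Q \<theta> * iexp (\<theta> * y) \<partial>lborel)
    \<longlonglongrightarrow> (\<integral>\<theta>. (- \<i> * of_real \<theta>) powr (- of_real s) * Q \<theta> * iexp (\<theta> * y) \<partial>lborel)"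
  proof (rule integral_dominated_convergence[OF _ _ Qs])
    have pm: "(\<lambda>\<theta>. (of_real \<epsilon> - \<i> * of_real \<theta>) powr (- complex_of_real s)) \<in> borel_measurable borel" if "0 < \<epsilon>" for \<epsilon>
      by (intro borel_measurable_continuous_onI continuous_intros) (use that in \<open>auto simp: complex_nonpos_Reals_iff\<close>)
    show "(\<lambda>\<theta>. (of_real (\<epsilon> n) - \<i> * of_real \<theta>) powr (- complex_of_real s) * Q \<theta> * iexp (\<theta> * y)) \<in> borel_measurable lborel" for n
      using pm[OF \<epsilon>0[of n]] by measurable
    have lim: "(\<lambda>n. (of_real (\<epsilon> n) - \<i> * of_real \<theta>) powr (- complex_of_real s)) \<longlonglongrightarrow> (- \<i> * of_real \<theta>) powr (- of_real s)" if "\<theta> \<noteq> 0" for \<theta>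
    proof (rule tendsto_powr_complex)
      show "- \<i> * complex_of_real \<theta> \<notin> \<real>\<^sub>\<le>\<^sub>0" using that by (simp add: complex_nonpos_Reals_iff)
      have "(\<lambda>n. of_real (\<epsilon> n) - \<i> * complex_of_real \<theta>) \<longlonglongrightarrow> of_real 0 - \<i> * of_real \<theta>" by (intro tendsto_intros \<epsilon>lim)
      then show "(\<lambda>n. of_real (\<epsilon> n) - \<i> * complex_of_real \<theta>) \<longlonglongrightarrow> - \<i> * of_real \<theta>" by simp
    qed simp
    \<comment> \<open>Measurability of the limiting symbol is inherited from the damped symbols,
      which are continuous. At \<theta> = 0, on the branch cut, the limit is replaced by 0, which
      agrees with the convention for powers of 0.\<close>
    have pm0: "(\<lambda>\<theta>. if \<theta> \<noteq> 0 then (- \<i> * of_real \<theta>) powr (- complex_of_real s) else 0) \<in> borel_measurable borel"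
    proof (rule borel_measurable_LIMSEQ_metric)
      show "(\<lambda>\<theta>. if \<theta> \<noteq> 0 then (of_real (\<epsilon> n) - \<i> * of_real \<theta>) powr (- complex_of_real s) else 0) \<in> borel_measurable borel" for n
        using pm[OF \<epsilon>0[of n]] by measurable
    qed (use lim in auto)
    have e0: "(\<lambda>\<theta>. if \<theta> \<noteq> 0 then (- \<i> * of_real \<theta>) powr (- complex_of_real s) else 0) = (\<lambda>\<theta>. (- \<i> * of_real \<theta>) powr (- complex_of_real s))"
      by (auto simp: fun_eq_iff)
    note [measurable] = pm0[unfolded e0]
    show "(\<lambda>\<theta>. (- \<i> * of_real \<theta>) powr (- complex_of_real s) * Q \<theta> * iexp (\<theta> * y)) \<in> borel_measurable lborel"
      by measurable
    have ne: "AE \<theta> in lborel. \<theta> \<noteq> (0::real)" by (rule AE_lborel_singleton)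
    then show "AE \<theta> in lborel. (\<lambda>n. (of_real (\<epsilon> n) - \<i> * of_real \<theta>) powr (- complex_of_real s) * Q \<theta> * iexp (\<theta> * y))
      \<longlonglongrightarrow> (- \<i> * of_real \<theta>) powr (- of_real s) * Q \<theta> * iexp (\<theta> * y)"
      by eventually_elim (intro tendsto_mult lim tendsto_const)
    show "AE \<theta> in lborel. norm ((of_real (\<epsilon> n) - \<i> * of_real \<theta>) powr (- complex_of_real s) * Q \<theta> * iexp (\<theta> * y)) \<le> \<bar>\<theta>\<bar> powr (- s) * norm (Q \<theta>)" for n
      using ne
    proof eventually_elim
      fix \<theta> :: real assume "\<theta> \<noteq> 0"
      let ?w = "of_real (\<epsilon> n) - \<i> * complex_of_real \<theta>"
      have "\<bar>\<theta>\<bar> \<le> norm ?w" using abs_Im_le_cmod[of ?w] by simp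
      then have "norm ?w powr (- s) \<le> \<bar>\<theta>\<bar> powr (- s)" using s \<open>\<theta> \<noteq> 0\<close> by (intro powr_mono2') auto
      moreover have "norm (?w powr (- complex_of_real s)) = norm ?w powr (- s)" by (subst norm_powr_real_powr') auto
      ultimately show "norm (?w powr (- complex_of_real s) * Q \<theta> * iexp (\<theta> * y)) \<le> \<bar>\<theta>\<bar> powr (- s) * norm (Q \<theta>)"
        by (simp add: norm_mult mult_right_mono)
    qed
  qed
  have "(\<integral>z. complex_of_real (pos_powr s z * q (y + z)) \<partial>lborel) = complex_of_real (Gamma s) * (\<integral>\<theta>. (- \<i> * of_real \<theta>) powr (- of_real s) * Q \<theta> * iexp (\<theta> * y) \<partial>lborel)"
    by (rule LIMSEQ_unique[OF L]) (unfold damped_power_fourier[OF s Q q \<epsilon>0], intro tendsto_mult tendsto_const R)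
  then show ?thesis by (simp only: integral_complex_of_real)
qed

lemma power_fourier_reflected:
  fixes Q :: "real \<Rightarrow> complex" and q :: "real \<Rightarrow> real"
  assumes s: "0 < s" and Q: "integrable lborel Q" and q: "\<And>u. complex_of_real (q u) = (\<integral>\<theta>. Q \<theta> * iexp (\<theta> * u) \<partial>lborel)"
    and Qs: "integrable lborel (\<lambda>\<theta>. \<bar>\<theta>\<bar> powr (- s) * norm (Q \<theta>))"
    and qs: "integrable lborel (\<lambda>z. pos_powr s z * q (y - z))"
  shows "complex_of_real (\<integral>z. pos_powr s z * q (y - z) \<partial>lborel)
    = complex_of_real (Gamma s) * (\<integral>\<theta>. (\<i> * of_real \<theta>) powr (- of_real s) * Q \<theta> * iexp (\<theta> * y) \<partial>lborel)"
proof -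
  have refl: "(\<integral>x. f (- x) \<partial>lborel) = integral\<^sup>L lborel f" for f :: "real \<Rightarrow> complex"
    using lborel_integral_real_affine[of "-1" f 0] by simp
  have refi: "integrable lborel f \<Longrightarrow> integrable lborel (\<lambda>x. f (- x))" for f :: "real \<Rightarrow> complex"
    using lborel_integrable_real_affine[of f "-1" 0] by simp
  have refir: "integrable lborel f \<Longrightarrow> integrable lborel (\<lambda>x. f (- x))" for f :: "real \<Rightarrow> real"
    using lborel_integrable_real_affine[of f "-1" 0] by simp
  have "complex_of_real (\<integral>z. pos_powr s z * q (- (- y + z)) \<partial>lborel)
    = complex_of_real (Gamma s) * (\<integral>\<theta>. (- \<i> * of_real \<theta>) powr (- of_real s) * Q (- \<theta>) * iexp (\<theta> * (- y)) \<partial>lborel)"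
  proof (rule power_fourier[where q="\<lambda>u. q (- u)" and Q="\<lambda>\<theta>. Q (- \<theta>)", OF s refi[OF Q]])
    show "complex_of_real (q (- u)) = (\<integral>\<theta>. Q (- \<theta>) * iexp (\<theta> * u) \<partial>lborel)" for u
      unfolding q using refl[of "\<lambda>\<theta>. Q \<theta> * iexp (\<theta> * - u)"] by simp
    show "integrable lborel (\<lambda>\<theta>. \<bar>\<theta>\<bar> powr - s * norm (Q (- \<theta>)))" using refir[OF Qs] by simp
    show "integrable lborel (\<lambda>z. pos_powr s z * q (- (- y + z)))" using qs by simp
  qed
  also have "(\<integral>\<theta>. (- \<i> * of_real \<theta>) powr (- of_real s) * Q (- \<theta>) * iexp (\<theta> * (- y)) \<partial>lborel)
    = (\<integral>\<theta>. (\<i> * of_real \<theta>) powr (- of_real s) * Q \<theta> * iexp (\<theta> * y) \<partial>lborel)"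
    using refl[of "\<lambda>\<theta>. (\<i> * of_real \<theta>) powr (- of_real s) * Q \<theta> * iexp (\<theta> * y)"] by simp
  finally show ?thesis by simp
qed

section \<open>Gaussian transforms and superposition of translates\<close>

lemma std_normal_fourier:
  "complex_of_real (exp (- x\<^sup>2 / 2)) = (\<integral>\<tau>. of_real (std_normal_density \<tau>) * iexp (\<tau> * x) \<partial>lborel)"
proof -
  have "complex_of_real (exp (- x\<^sup>2 / 2)) = char std_normal_distribution x"
    unfolding char_std_normal_distribution by simp
  also have "\<dots> = (\<integral>\<tau>. std_normal_density \<tau> *\<^sub>R iexp (x * \<tau>) \<partial>lborel)"
    unfolding char_def by (rule integral_density) auto
  finally show ?thesis by (simp add: scaleR_conv_of_real mult.commute[of x])
qed

lemma std_normal_integrable_c: "integrable lborel (\<lambda>\<tau>. complex_of_real (std_normal_density \<tau>) * iexp (\<tau> * x))"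
  by (rule Bochner_Integration.integrable_bound[OF integrable_std_normal_moment[of 0]]) (auto simp: norm_mult)

lemma std_normal_integrable_tc: "integrable lborel (\<lambda>\<tau>. complex_of_real (\<tau> * std_normal_density \<tau>) * iexp (\<tau> * x))"
  by (rule Bochner_Integration.integrable_bound[OF integrable_std_normal_moment[of 1]]) (auto simp: norm_mult abs_mult mult.commute)

text \<open>The function \<phi>(\<tau>) exp(i \<tau> x) vanishes at both ends, so its derivative
  integrates to 0; since \<phi>'(\<tau>) = -\<tau> \<phi>(\<tau>), this is the claim.\<close>

lemma std_normal_fourier_deriv:
  "\<i> * complex_of_real (x * exp (- x\<^sup>2 / 2)) = (\<integral>\<tau>. of_real (\<tau> * std_normal_density \<tau>) * iexp (\<tau> * x) \<partial>lborel)"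
proof -
  let ?\<phi> = std_normal_density
  let ?F = "\<lambda>\<tau>. complex_of_real (?\<phi> \<tau>) * iexp (\<tau> * x)"
  let ?f = "\<lambda>\<tau>. \<i> * of_real x * (of_real (?\<phi> \<tau>) * iexp (\<tau> * x)) - of_real (\<tau> * ?\<phi> \<tau>) * iexp (\<tau> * x)"
  have d: "(?\<phi> has_real_derivative - (\<tau> * ?\<phi> \<tau>)) (at \<tau>)" for \<tau>
  proof -
    have "((\<lambda>x. (1 / sqrt (2 * pi)) * exp (- x\<^sup>2 / 2)) has_real_derivative (1 / sqrt (2 * pi)) * (exp (- \<tau>\<^sup>2 / 2) * (- \<tau>))) (at \<tau>)"
      by (intro DERIV_cmult) (auto intro!: derivative_eq_intros)
    then show ?thesis by (simp add: std_normal_density_def[abs_def] mult_ac)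
  qed
  have fi: "integrable lborel ?f"
    by (intro Bochner_Integration.integrable_diff integrable_mult_right std_normal_integrable_c std_normal_integrable_tc)
  have top: "((\<lambda>\<tau>. ?\<phi> \<tau>) \<longlongrightarrow> 0) at_top" and bot: "((\<lambda>\<tau>. ?\<phi> \<tau>) \<longlongrightarrow> 0) at_bot"
    unfolding std_normal_density_def by real_asymp+
  have "(LBINT \<tau>=-\<infinity>..\<infinity>. ?f \<tau>) = 0 - 0"
  proof (rule interval_integral_FTC_integrable[where F="?F"])
    fix \<tau> :: real
    have "((\<lambda>\<tau>. complex_of_real (?\<phi> \<tau>)) has_vector_derivative of_real (- (\<tau> * ?\<phi> \<tau>))) (at \<tau>)"
      by (intro has_vector_derivative_of_real) (use d[of \<tau>] in \<open>simp only: has_real_derivative_iff_has_vector_derivative\<close>)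
    moreover have "((\<lambda>\<tau>. iexp (\<tau> * x)) has_vector_derivative (\<i> * of_real x * iexp (\<tau> * x))) (at \<tau>)"
    proof -
      have "((\<lambda>z. exp (\<i> * of_real x * z)) has_field_derivative (\<i> * of_real x * exp (\<i> * of_real x * of_real \<tau>))) (at (of_real \<tau>))"
        by (auto intro!: derivative_eq_intros)
      from has_vector_derivative_real_field[OF this] show ?thesis by (simp add: mult_ac)
    qed
    ultimately have "(?F has_vector_derivative of_real (?\<phi> \<tau>) * (\<i> * of_real x * iexp (\<tau> * x)) + of_real (- (\<tau> * ?\<phi> \<tau>)) * iexp (\<tau> * x)) (at \<tau>)"
      by (rule has_vector_derivative_mult)
    moreover have "of_real (?\<phi> \<tau>) * (\<i> * of_real x * iexp (\<tau> * x)) + of_real (- (\<tau> * ?\<phi> \<tau>)) * iexp (\<tau> * x) = ?f \<tau>" by (simp add: algebra_simps)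
    ultimately show "(?F has_vector_derivative ?f \<tau>) (at \<tau>)" by (simp only:)
    show "isCont ?f \<tau>" unfolding std_normal_density_def by (intro continuous_intros) auto
  next
    show "set_integrable lborel (einterval (-\<infinity>) \<infinity>) ?f" using fi by (simp add: set_integrable_def)
    have n: "norm (?F \<tau>) = ?\<phi> \<tau>" for \<tau> by (simp add: norm_mult)
    have "(?F \<longlongrightarrow> 0) at_bot" by (subst tendsto_norm_zero_iff[symmetric], unfold n, rule bot)
    then show "((?F \<circ> real_of_ereal) \<longlongrightarrow> 0) (at_right (-\<infinity>))" by (simp add: ereal_tendsto_simps)
    have "(?F \<longlongrightarrow> 0) at_top" by (subst tendsto_norm_zero_iff[symmetric], unfold n, rule top)
    then show "((?F \<circ> real_of_ereal) \<longlongrightarrow> 0) (at_left \<infinity>)" by (simp add: ereal_tendsto_simps)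
  qed auto
  then have "integral\<^sup>L lborel ?f = 0" by (simp add: interval_lebesgue_integral_def set_lebesgue_integral_def)
  then have "\<i> * of_real x * (\<integral>\<tau>. of_real (?\<phi> \<tau>) * iexp (\<tau> * x) \<partial>lborel) = (\<integral>\<tau>. of_real (\<tau> * ?\<phi> \<tau>) * iexp (\<tau> * x) \<partial>lborel)"
    by (subst (asm) Bochner_Integration.integral_diff[OF integrable_mult_right[OF std_normal_integrable_c] std_normal_integrable_tc]) (simp only: integral_mult_right_zero right_minus_eq)
  then show ?thesis unfolding std_normal_fourier[symmetric] by (simp only: of_real_mult mult.assoc)
qed

lemma abs_powr_normal_integrable:
  assumes p: "- 1 < p" "p \<le> 4" and s: "0 < s"
  shows "integrable lborel (\<lambda>\<theta>. \<bar>\<theta>\<bar> powr p * std_normal_density (\<theta> / s))"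
proof (rule Bochner_Integration.integrable_bound)
  let ?a = "\<lambda>\<theta>. indicator {..<1} \<theta> * pos_powr (p + 1) \<theta>"
  have ai: "integrable lborel ?a" using p by (intro pos_powr_integrable_near_0) auto
  have ai': "integrable lborel (\<lambda>\<theta>. ?a (- \<theta>))" using lborel_integrable_real_affine[OF ai, of "-1" 0] by simp
  have m: "integrable lborel (\<lambda>\<theta>. std_normal_density (\<theta> / s) * (\<theta> / s) ^ 4)"
    using lborel_integrable_real_affine[OF integrable_std_normal_moment[of 4], of "1 / s" 0] s by simp
  \<comment> \<open>The first two terms dominate on |\<theta>| < 1, where p > -1 matters. Outside,
    |\<theta>|^p <= \<theta>^4 and the fourth moment dominates; s^4 undoes the rescaling.\<close>
  show "integrable lborel (\<lambda>\<theta>. ?a \<theta> + ?a (- \<theta>) + s ^ 4 * (std_normal_density (\<theta> / s) * (\<theta> / s) ^ 4))"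
    by (intro Bochner_Integration.integrable_add ai ai' integrable_mult_right m)
  have f1: "std_normal_density x \<le> 1" for x
  proof -
    have "exp (- x\<^sup>2 / 2) \<le> 1" by simp
    moreover have "1 \<le> sqrt (2 * pi)" using pi_gt3 by (simp add: real_le_rsqrt)
    ultimately have "exp (- x\<^sup>2 / 2) / sqrt (2 * pi) \<le> 1 / 1" by (intro frac_le) auto
    then show ?thesis by (simp add: std_normal_density_def)
  qed
  show "AE \<theta> in lborel. norm (\<bar>\<theta>\<bar> powr p * std_normal_density (\<theta> / s)) \<le> norm (?a \<theta> + ?a (- \<theta>) + s ^ 4 * (std_normal_density (\<theta> / s) * (\<theta> / s) ^ 4))"
  proof (intro AE_I2)
    fix \<theta>
    have nn: "0 \<le> ?a \<theta>" "0 \<le> ?a (- \<theta>)" "0 \<le> s ^ 4 * (std_normal_density (\<theta> / s) * (\<theta> / s) ^ 4)" by auto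
    have "\<bar>\<theta>\<bar> powr p * std_normal_density (\<theta> / s) \<le> ?a \<theta> + ?a (- \<theta>) + s ^ 4 * (std_normal_density (\<theta> / s) * (\<theta> / s) ^ 4)"
    proof (cases "\<bar>\<theta>\<bar> < 1")
      case True
      have "\<bar>\<theta>\<bar> powr p \<le> ?a \<theta> + ?a (- \<theta>)"
        using True by (cases \<theta> "0::real" rule: linorder_cases) (auto simp: pos_powr_def)
      moreover have "\<bar>\<theta>\<bar> powr p * std_normal_density (\<theta> / s) \<le> \<bar>\<theta>\<bar> powr p * 1" by (intro mult_left_mono f1) auto
      ultimately show ?thesis using nn by linarith
    next
      case False
      then have "\<bar>\<theta>\<bar> powr p \<le> \<bar>\<theta>\<bar> powr 4" using p by (intro powr_mono) auto
      also have "\<dots> = \<theta> ^ 4" using False powr_realpow[of "\<bar>\<theta>\<bar>" 4] by (simp add: power_abs[symmetric])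
      finally have "\<bar>\<theta>\<bar> powr p * std_normal_density (\<theta> / s) \<le> \<theta> ^ 4 * std_normal_density (\<theta> / s)" by (intro mult_right_mono) auto
      also have "\<dots> = s ^ 4 * (std_normal_density (\<theta> / s) * (\<theta> / s) ^ 4)" using s by (simp add: power_divide)
      finally show ?thesis using nn by linarith
    qed
    then show "norm (\<bar>\<theta>\<bar> powr p * std_normal_density (\<theta> / s)) \<le> norm (?a \<theta> + ?a (- \<theta>) + s ^ 4 * (std_normal_density (\<theta> / s) * (\<theta> / s) ^ 4))"
      unfolding real_norm_def by (intro order_trans[OF _ abs_ge_self]) (simp only: abs_of_nonneg mult_nonneg_nonneg powr_ge_zero normal_density_nonneg)
  qed
qed measurable

text \<open>Superposing translates by b with density m multiplies the frequency density by the
  transform of m. Its bound and measurability are recorded separately, since they are what the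
  integrability of the smoothed candidate rests on.\<close>

lemma fourier_mixture:
  fixes R :: "real \<Rightarrow> complex" and m :: "real \<Rightarrow> real"
  assumes m: "integrable lborel m" and R: "integrable lborel R"
  defines "mh \<equiv> \<lambda>\<theta>. \<integral>b. complex_of_real (m b) * iexp (- (\<theta> * b)) \<partial>lborel"
  shows "(\<integral>b. complex_of_real (m b) * (\<integral>\<theta>. R \<theta> * iexp (\<theta> * (y - b)) \<partial>lborel) \<partial>lborel) = (\<integral>\<theta>. R \<theta> * mh \<theta> * iexp (\<theta> * y) \<partial>lborel)"
    and "norm (mh \<theta>) \<le> (\<integral>b. \<bar>m b\<bar> \<partial>lborel)"
    and "mh \<in> borel_measurable borel"
proof -
  have [measurable]: "m \<in> borel_measurable borel" "R \<in> borel_measurable borel" using m R by auto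
  show "mh \<in> borel_measurable borel" unfolding mh_def by measurable
  show "norm (mh \<theta>) \<le> (\<integral>b. \<bar>m b\<bar> \<partial>lborel)" unfolding mh_def
    using integral_norm_bound[of lborel "\<lambda>b. complex_of_real (m b) * iexp (- (\<theta> * b))"] by (simp add: norm_mult)
  let ?f = "\<lambda>\<theta> b. R \<theta> * iexp (\<theta> * y) * (complex_of_real (m b) * iexp (- (\<theta> * b)))"
  have mi: "integrable lborel (\<lambda>b. complex_of_real (m b) * iexp (- (\<theta> * b)))" for \<theta>
    by (rule Bochner_Integration.integrable_bound[OF m]) (auto simp: norm_mult)
  have I: "integrable (lborel \<Otimes>\<^sub>M lborel) (\<lambda>(\<theta>, b). ?f \<theta> b)"
  proof (rule lborel_pair.Fubini_integrable)
    show "(\<lambda>(\<theta>, b). ?f \<theta> b) \<in> borel_measurable (lborel \<Otimes>\<^sub>M lborel)" by measurable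
    have "integrable lborel (\<lambda>\<theta>. norm (R \<theta>) * (\<integral>b. \<bar>m b\<bar> \<partial>lborel))" using R by auto
    then show "integrable lborel (\<lambda>\<theta>. \<integral>b. norm (case (\<theta>, b) of (\<theta>, b) \<Rightarrow> ?f \<theta> b) \<partial>lborel)"
      by (simp add: norm_mult)
    show "AE \<theta> in lborel. integrable lborel (\<lambda>b. case (\<theta>, b) of (\<theta>, b) \<Rightarrow> ?f \<theta> b)"
      by (intro AE_I2) (simp only: prod.case, intro integrable_mult_right mi)
  qed
  have "(\<integral>b. (\<integral>\<theta>. ?f \<theta> b \<partial>lborel) \<partial>lborel) = (\<integral>\<theta>. (\<integral>b. ?f \<theta> b \<partial>lborel) \<partial>lborel)"
    by (rule lborel_pair.Fubini_integral) (use I in simp)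
  moreover have "(\<integral>\<theta>. ?f \<theta> b \<partial>lborel) = complex_of_real (m b) * (\<integral>\<theta>. R \<theta> * iexp (\<theta> * (y - b)) \<partial>lborel)" for b
    unfolding integral_mult_right_zero[symmetric]
    by (intro Bochner_Integration.integral_cong refl) (simp add: exp_add[symmetric] algebra_simps)
  moreover have "(\<integral>b. ?f \<theta> b \<partial>lborel) = R \<theta> * mh \<theta> * iexp (\<theta> * y)" for \<theta>
    unfolding mh_def by (subst integral_mult_right_zero) (simp only: mult_ac)
  ultimately show "(\<integral>b. complex_of_real (m b) * (\<integral>\<theta>. R \<theta> * iexp (\<theta> * (y - b)) \<partial>lborel) \<partial>lborel) = (\<integral>\<theta>. R \<theta> * mh \<theta> * iexp (\<theta> * y) \<partial>lborel)"
    by (simp only:)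
qed

text \<open>Fubini in the space variable, matching \<open>fourier_mixture\<close> on the frequency
  side. With m the truncated b^(\<gamma>-1), the inner integral over b is H for the kernel
  z_+^(\<beta>-1) and \<open>weight\<close> for the kernel (-z)_+^(-\<gamma>).\<close>

lemma kernel_mixture:
  fixes m k r :: "real \<Rightarrow> real"
  assumes m [measurable]: "m \<in> borel_measurable borel" "\<And>b. 0 \<le> m b"
    and k [measurable]: "k \<in> borel_measurable borel" "\<And>z. 0 \<le> k z"
    and r: "integrable lborel r"
    and V: "\<And>u. integrable lborel (\<lambda>b. m b * k (b - u))" "\<And>u. (\<integral>b. m b * k (b - u) \<partial>lborel) \<le> B"
  shows "(\<integral>b. m b * (\<integral>z. k z * r (y - b + z) \<partial>lborel) \<partial>lborel) = (\<integral>u. (\<integral>b. m b * k (b - u) \<partial>lborel) * r (y - u) \<partial>lborel)"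
proof -
  have [measurable]: "r \<in> borel_measurable borel" using r by auto
  have rr: "integrable lborel (\<lambda>u. r (y - u))"
    using lborel_integrable_real_affine[OF r, of "-1" y] by simp
  let ?f = "\<lambda>u b. m b * k (b - u) * r (y - u)"
  have I: "integrable (lborel \<Otimes>\<^sub>M lborel) (\<lambda>(u, b). ?f u b)"
  proof (rule lborel_pair.Fubini_integrable)
    show "(\<lambda>(u, b). ?f u b) \<in> borel_measurable (lborel \<Otimes>\<^sub>M lborel)" by measurable
    have "integrable lborel (\<lambda>u. (\<integral>b. m b * k (b - u) \<partial>lborel) * \<bar>r (y - u)\<bar>)"
    proof (rule Bochner_Integration.integrable_bound[OF integrable_mult_right[OF rr, of B]])
      show "AE u in lborel. norm ((\<integral>b. m b * k (b - u) \<partial>lborel) * \<bar>r (y - u)\<bar>) \<le> norm (B * r (y - u))"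
      proof (intro AE_I2)
        fix u
        have "0 \<le> (\<integral>b. m b * k (b - u) \<partial>lborel)" using m k by (intro integral_nonneg_AE AE_I2) auto
        then show "norm ((\<integral>b. m b * k (b - u) \<partial>lborel) * \<bar>r (y - u)\<bar>) \<le> norm (B * r (y - u))"
          using V(2)[of u] by (simp add: abs_mult mult_right_mono)
      qed
    qed measurable
    then show "integrable lborel (\<lambda>u. \<integral>b. norm (case (u, b) of (u, b) \<Rightarrow> ?f u b) \<partial>lborel)"
      using m k by (simp add: abs_mult)
    show "AE u in lborel. integrable lborel (\<lambda>b. case (u, b) of (u, b) \<Rightarrow> ?f u b)"
      using V(1) by (intro AE_I2) auto
  qed
  have "(\<integral>b. (\<integral>u. ?f u b \<partial>lborel) \<partial>lborel) = (\<integral>u. (\<integral>b. ?f u b \<partial>lborel) \<partial>lborel)"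
    by (rule lborel_pair.Fubini_integral) (use I in simp)
  moreover have "(\<integral>u. ?f u b \<partial>lborel) = m b * (\<integral>z. k z * r (y - b + z) \<partial>lborel)" for b
  proof -
    have "(\<integral>z. k z * r (y - b + z) \<partial>lborel) = (\<integral>u. k (b - u) * r (y - u) \<partial>lborel)"
      by (subst lborel_integral_real_affine[of "-1" _ b]) auto
    then show ?thesis by (simp add: mult.assoc)
  qed
  ultimately show ?thesis by simp
qed

text \<open>Frequency density of the centred Gaussian with standard deviation 1/s, so smoothing
  disappears as s tends to infinity.\<close>

definition gauss_freq :: "real \<Rightarrow> real \<Rightarrow> complex" where
  "gauss_freq s \<theta> = complex_of_real (std_normal_density (\<theta> / s) / sqrt (2 * pi))"

lemma gauss_freq_measurable [measurable]: "gauss_freq s \<in> borel_measurable borel"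
  unfolding gauss_freq_def by measurable

lemma norm_gauss_freq: "norm (gauss_freq s \<theta>) = std_normal_density (\<theta> / s) / sqrt (2 * pi)"
  by (simp add: gauss_freq_def norm_divide)

lemma gauss_freq_integrable:
  assumes "0 < s" "-1 < p" "p \<le> 4"
  shows "integrable lborel (\<lambda>\<theta>. \<bar>\<theta>\<bar> powr p * norm (gauss_freq s \<theta>))"
  using integrable_divide[OF abs_powr_normal_integrable[OF assms(2,3,1)], of "sqrt (2 * pi)"]
  by (simp add: norm_gauss_freq)

lemma gauss_fourier:
  assumes s: "0 < s"
  shows "complex_of_real (s * std_normal_density (s * u)) = (\<integral>\<theta>. gauss_freq s \<theta> * iexp (\<theta> * u) \<partial>lborel)"
proof -
  have "complex_of_real (exp (- (s * u)\<^sup>2 / 2)) = (1 / s) *\<^sub>R (\<integral>\<theta>. of_real (std_normal_density (\<theta> / s)) * iexp (\<theta> * u) \<partial>lborel)"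
    unfolding std_normal_fourier using s by (subst lborel_integral_real_affine[of "1 / s" _ 0]) auto
  then have e: "(\<integral>\<theta>. of_real (std_normal_density (\<theta> / s)) * iexp (\<theta> * u) \<partial>lborel) = of_real s * complex_of_real (exp (- (s * u)\<^sup>2 / 2))"
    using s by (simp add: scaleR_conv_of_real)
  have "(\<integral>\<theta>. gauss_freq s \<theta> * iexp (\<theta> * u) \<partial>lborel) = (\<integral>\<theta>. (of_real (std_normal_density (\<theta> / s)) * iexp (\<theta> * u)) / of_real (sqrt (2 * pi)) \<partial>lborel)"
    by (simp add: gauss_freq_def)
  also have "\<dots> = of_real s * complex_of_real (exp (- (s * u)\<^sup>2 / 2)) / of_real (sqrt (2 * pi))"
    by (subst integral_divide_zero) (simp only: e)
  finally show ?thesis by (simp add: std_normal_density_def)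
qed

text \<open>The left-hand side is the derivative in u of the Gaussian density s \<phi>(s u),
  corresponding to multiplication of the frequency density by i \<theta>.\<close>

lemma gauss_fourier_deriv:
  assumes s: "0 < s"
  shows "complex_of_real (- (s ^ 3 * u * std_normal_density (s * u))) = (\<integral>\<theta>. (\<i> * of_real \<theta> * gauss_freq s \<theta>) * iexp (\<theta> * u) \<partial>lborel)"
proof -
  have "\<i> * complex_of_real (s * u * exp (- (s * u)\<^sup>2 / 2)) = (1 / s) *\<^sub>R (\<integral>\<theta>. of_real (\<theta> / s * std_normal_density (\<theta> / s)) * iexp (\<theta> * u) \<partial>lborel)"
    unfolding std_normal_fourier_deriv using s by (subst lborel_integral_real_affine[of "1 / s" _ 0]) auto
  then have e: "(\<integral>\<theta>. of_real (\<theta> / s * std_normal_density (\<theta> / s)) * iexp (\<theta> * u) \<partial>lborel) = of_real s * (\<i> * complex_of_real (s * u * exp (- (s * u)\<^sup>2 / 2)))"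
    using s by (simp add: scaleR_conv_of_real)
  have "(\<integral>\<theta>. (\<i> * of_real \<theta> * gauss_freq s \<theta>) * iexp (\<theta> * u) \<partial>lborel)
    = (\<integral>\<theta>. (\<i> * of_real s / of_real (sqrt (2 * pi))) * (of_real (\<theta> / s * std_normal_density (\<theta> / s)) * iexp (\<theta> * u)) \<partial>lborel)"
    using s by (intro Bochner_Integration.integral_cong refl) (simp add: gauss_freq_def)
  also have "\<dots> = (\<i> * of_real s / of_real (sqrt (2 * pi))) * (of_real s * (\<i> * complex_of_real (s * u * exp (- (s * u)\<^sup>2 / 2))))"
    by (simp only: integral_mult_right_zero e)
  also have "\<dots> = (\<i> * \<i>) * of_real (s ^ 3 * u * (exp (- (s * u)\<^sup>2 / 2) / sqrt (2 * pi)))"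
  proof -
    have "(\<i> * a / d) * (a * (\<i> * (a * u * e))) = (\<i> * \<i>) * (a * a * a * u * (e / d))" for a d u e :: complex
      by (simp only: times_divide_eq_right times_divide_eq_left mult_ac)
    then show ?thesis unfolding of_real_mult of_real_divide power3_eq_cube .
  qed
  finally show ?thesis by (simp add: std_normal_density_def)
qed

section \<open>The smoothed candidate and its generator\<close>

context stable_indices
begin

abbreviation "\<psi> \<equiv> stable_exponent \<beta> \<gamma>"

text \<open>The Gamma quotient comes from the two power transforms, the Beta value bounds the
  variation of \<open>weight\<close>, and the third absolute moment comes from the tail estimate in
  \<open>weight_smooth_bound\<close>.\<close>

definition smooth_const :: real where
  "smooth_const = Gamma \<beta> / Gamma (1 - \<gamma>) * (Beta \<gamma> (1 - \<gamma>) * (\<integral>x. std_normal_density x * \<bar>x\<bar> ^ 3 \<partial>lborel))"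

text \<open>Frequency density of H convolved with a Gaussian of standard deviation 1/s: the
  transform of the kernel of H, that of the Gaussian and that of the window b^(\<gamma>-1) on
  (0,c).\<close>

definition smooth_freq :: "real \<Rightarrow> real \<Rightarrow> real \<Rightarrow> complex" where
  "smooth_freq c s \<theta> = of_real (Gamma \<beta>) * ((- \<i> * of_real \<theta>) powr (- of_real \<beta>) * gauss_freq s \<theta>)
     * (\<integral>b. complex_of_real (indicator {0<..<c} b * pos_powr \<gamma> b) * iexp (- (\<theta> * b)) \<partial>lborel)"

lemma std_normal_le_1: "std_normal_density x \<le> 1" "\<bar>x\<bar> * std_normal_density x \<le> 1"
proof -
  have p: "1 \<le> sqrt (2 * pi)" using pi_gt3 by (simp add: real_le_rsqrt)
  have "exp (- x\<^sup>2 / 2) \<le> 1" by simp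
  then have "exp (- x\<^sup>2 / 2) / sqrt (2 * pi) \<le> 1 / 1" using p by (intro frac_le) auto
  then show "std_normal_density x \<le> 1" by (simp add: std_normal_density_def)
  have "\<bar>x\<bar> \<le> 1 + x\<^sup>2 / 2" using zero_le_power2[of "\<bar>x\<bar> - 1"] by (simp add: power2_diff)
  also have "\<dots> \<le> exp (x\<^sup>2 / 2)" by (rule exp_ge_add_one_self)
  finally have "\<bar>x\<bar> * exp (- x\<^sup>2 / 2) \<le> exp (x\<^sup>2 / 2) * exp (- x\<^sup>2 / 2)" by (intro mult_right_mono) auto
  also have "\<dots> = 1" by (simp add: exp_add[symmetric])
  finally have "\<bar>x\<bar> * exp (- x\<^sup>2 / 2) / sqrt (2 * pi) \<le> 1 / 1" using p by (intro frac_le) auto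
  then show "\<bar>x\<bar> * std_normal_density x \<le> 1" by (simp add: std_normal_density_def)
qed

lemma window_integrable: "0 \<le> c \<Longrightarrow> integrable lborel (\<lambda>b. indicator {0<..<c} b * pos_powr \<gamma> b)"
  using \<gamma> by (intro integrable_window) auto

lemma neg_powr_measurable:
  "(\<lambda>\<theta>. (- \<i> * of_real \<theta>) powr (- of_real \<beta>) :: complex) \<in> borel_measurable borel"
proof -
  have "(\<lambda>\<theta>. (- \<i> * of_real \<theta>) powr (- of_real \<beta>)) = (\<lambda>\<theta>. if 0 < \<theta> then of_real (\<theta> powr (- \<beta>)) * cis (- (- \<beta>) * (pi / 2))
    else if \<theta> < 0 then of_real ((- \<theta>) powr (- \<beta>)) * cis ((- \<beta>) * (pi / 2)) else 0)"
    using imag_powr(2)[of _ "- \<beta>"] imag_powr(1)[of "- _" "- \<beta>"] by (auto simp: fun_eq_iff not_less less_le)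
  also have "\<dots> \<in> borel_measurable borel" by measurable
  finally show ?thesis .
qed

lemma neg_powr_gauss_integrable:
  assumes "0 < s"
  shows "integrable lborel (\<lambda>\<theta>. (- \<i> * of_real \<theta>) powr (- of_real \<beta>) * gauss_freq s \<theta>)"
proof (rule Bochner_Integration.integrable_bound[OF gauss_freq_integrable[OF assms, of "- \<beta>"]])
  note [measurable] = neg_powr_measurable
  show "(\<lambda>\<theta>. (- \<i> * of_real \<theta>) powr (- of_real \<beta>) * gauss_freq s \<theta>) \<in> borel_measurable lborel" by measurable
  show "AE \<theta> in lborel. norm ((- \<i> * of_real \<theta>) powr (- of_real \<beta>) * gauss_freq s \<theta>) \<le> norm (\<bar>\<theta>\<bar> powr - \<beta> * norm (gauss_freq s \<theta>))"
    by (intro AE_I2) (simp add: norm_mult norm_powr_real_powr')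
qed (use \<beta> in auto)

lemma smooth_freq_measurable [measurable]:
  assumes "0 \<le> c" shows "smooth_freq c s \<in> borel_measurable borel"
  unfolding smooth_freq_def using neg_powr_measurable fourier_mixture(3)[OF window_integrable[OF assms], of "\<lambda>_. 0"]
  by (intro borel_measurable_times) auto

lemma norm_smooth_freq:
  assumes "0 \<le> c"
  obtains C where "\<And>\<theta>. norm (smooth_freq c s \<theta>) \<le> C * (\<bar>\<theta>\<bar> powr (- \<beta>) * norm (gauss_freq s \<theta>))"
proof
  fix \<theta> :: real
  define I where "I = (\<integral>b. \<bar>indicator {0<..<c} b * pos_powr \<gamma> b\<bar> \<partial>lborel)"
  have "norm (\<integral>b. complex_of_real (indicator {0<..<c} b * pos_powr \<gamma> b) * iexp (- (\<theta> * b)) \<partial>lborel) \<le> I"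
    unfolding I_def by (rule fourier_mixture(2)[OF window_integrable[OF assms], of "\<lambda>_. 0"]) simp
  then have "norm (smooth_freq c s \<theta>) \<le> \<bar>Gamma \<beta>\<bar> * (\<bar>\<theta>\<bar> powr (- \<beta>) * norm (gauss_freq s \<theta>)) * I"
    unfolding smooth_freq_def norm_mult by (intro mult_mono) (auto simp: norm_powr_real_powr' norm_mult)
  then show "norm (smooth_freq c s \<theta>) \<le> (\<bar>Gamma \<beta>\<bar> * I) * (\<bar>\<theta>\<bar> powr (- \<beta>) * norm (gauss_freq s \<theta>))"
    by (simp only: mult_ac)
qed

text \<open>The density is at most a constant times |\<theta>|^(-\<beta>) times a Gaussian, and each
  multiplication by \<psi> raises the power by \<beta> + \<gamma>. The powers -\<beta>, \<gamma> and
  \<beta> + 2 \<gamma> all exceed -1. These are the three hypotheses of the Dynkin estimate.\<close>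

lemma smooth_freq_integrable:
  assumes c: "0 \<le> c" and s: "0 < s"
  shows "integrable lborel (smooth_freq c s)"
    and "integrable lborel (\<lambda>\<theta>. smooth_freq c s \<theta> * \<psi> \<theta>)"
    and "integrable lborel (\<lambda>\<theta>. norm (smooth_freq c s \<theta>) * (norm (\<psi> \<theta>))\<^sup>2)"
proof -
  note [measurable] = smooth_freq_measurable[OF c]
  obtain C where C: "\<And>\<theta>. norm (smooth_freq c s \<theta>) \<le> C * (\<bar>\<theta>\<bar> powr (- \<beta>) * norm (gauss_freq s \<theta>))"
    using norm_smooth_freq[OF c] by blast
  have gen: "integrable lborel (\<lambda>\<theta>. C * (\<bar>\<theta>\<bar> powr p * norm (gauss_freq s \<theta>)))" if "-1 < p" "p \<le> 4" for p
    by (intro integrable_mult_right gauss_freq_integrable s that)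
  have ge: "C * (\<bar>\<theta>\<bar> powr (- \<beta>) * norm (gauss_freq s \<theta>)) * \<bar>\<theta>\<bar> powr p = C * (\<bar>\<theta>\<bar> powr (p - \<beta>) * norm (gauss_freq s \<theta>))" for p \<theta>
    by (simp add: powr_add[symmetric])
  show "integrable lborel (smooth_freq c s)"
    by (rule Bochner_Integration.integrable_bound[OF gen[of "- \<beta>"]]) (use \<beta> C in \<open>auto intro!: AE_I2 intro: order_trans[OF _ abs_ge_self]\<close>)
  show "integrable lborel (\<lambda>\<theta>. smooth_freq c s \<theta> * \<psi> \<theta>)"
  proof (rule Bochner_Integration.integrable_bound[OF gen[of "\<beta> + \<gamma> - \<beta>"]])
    show "AE \<theta> in lborel. norm (smooth_freq c s \<theta> * \<psi> \<theta>) \<le> norm (C * (\<bar>\<theta>\<bar> powr (\<beta> + \<gamma> - \<beta>) * norm (gauss_freq s \<theta>)))"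
    proof (intro AE_I2)
      fix \<theta>
      have "norm (smooth_freq c s \<theta> * \<psi> \<theta>) \<le> C * (\<bar>\<theta>\<bar> powr (- \<beta>) * norm (gauss_freq s \<theta>)) * \<bar>\<theta>\<bar> powr (\<beta> + \<gamma>)"
        unfolding norm_mult norm_stable_exponent[OF \<beta>(1) \<gamma>(1)] by (intro mult_right_mono C) auto
      then show "norm (smooth_freq c s \<theta> * \<psi> \<theta>) \<le> norm (C * (\<bar>\<theta>\<bar> powr (\<beta> + \<gamma> - \<beta>) * norm (gauss_freq s \<theta>)))"
        unfolding ge real_norm_def by (rule order_trans[OF _ abs_ge_self])
    qed
  qed (use \<gamma> in auto)
  show "integrable lborel (\<lambda>\<theta>. norm (smooth_freq c s \<theta>) * (norm (\<psi> \<theta>))\<^sup>2)"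
  proof (rule Bochner_Integration.integrable_bound[OF gen[of "2 * (\<beta> + \<gamma>) - \<beta>"]])
    show "AE \<theta> in lborel. norm (norm (smooth_freq c s \<theta>) * (norm (\<psi> \<theta>))\<^sup>2) \<le> norm (C * (\<bar>\<theta>\<bar> powr (2 * (\<beta> + \<gamma>) - \<beta>) * norm (gauss_freq s \<theta>)))"
    proof (intro AE_I2)
      fix \<theta>
      have "(norm (\<psi> \<theta>))\<^sup>2 = \<bar>\<theta>\<bar> powr (2 * (\<beta> + \<gamma>))"
        unfolding norm_stable_exponent[OF \<beta>(1) \<gamma>(1)] power2_eq_square by (simp only: powr_add[symmetric] mult_2)
      then have "norm (norm (smooth_freq c s \<theta>) * (norm (\<psi> \<theta>))\<^sup>2) \<le> C * (\<bar>\<theta>\<bar> powr (- \<beta>) * norm (gauss_freq s \<theta>)) * \<bar>\<theta>\<bar> powr (2 * (\<beta> + \<gamma>))"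
        using C[of \<theta>] by (simp add: mult_right_mono)
      then show "norm (norm (smooth_freq c s \<theta>) * (norm (\<psi> \<theta>))\<^sup>2) \<le> norm (C * (\<bar>\<theta>\<bar> powr (2 * (\<beta> + \<gamma>) - \<beta>) * norm (gauss_freq s \<theta>)))"
        unfolding ge real_norm_def by (rule order_trans[OF _ abs_ge_self])
    qed
  qed (use \<beta> \<gamma> in auto)
qed

lemma gauss_density_integrable:
  assumes "0 < s" shows "integrable lborel (\<lambda>u. s * std_normal_density (s * u))"
  using lborel_integrable_real_affine[OF integrable_std_normal_moment[of 0], of s 0] assms by simp

text \<open>The same double integral is evaluated twice: in frequency, by the transform of the
  kernel and then of the superposition over b; in space, by Fubini, where integrating over b first
  produces H.\<close>

lemma smooth_freq_integral:
  assumes c: "0 \<le> c" and s: "0 < s"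
  shows "(\<integral>\<theta>. smooth_freq c s \<theta> * iexp (\<theta> * y) \<partial>lborel) = complex_of_real (\<integral>v. H c (y - v / s) * std_normal_density v \<partial>lborel)"
proof -
  let ?q = "\<lambda>u. s * std_normal_density (s * u)" and ?m = "\<lambda>b. indicator {0<..<c} b * pos_powr \<gamma> b"
  let ?R = "\<lambda>\<theta>. (- \<i> * of_real \<theta>) powr (- of_real \<beta>) * gauss_freq s \<theta>"
  have qi: "integrable lborel ?q" by (rule gauss_density_integrable[OF s])
  have Qi: "integrable lborel (gauss_freq s)"
    unfolding gauss_freq_def[abs_def]
    using lborel_integrable_real_affine[OF integrable_std_normal_moment[of 0], of "1 / s" 0] s
    by (intro integrable_of_real integrable_divide) simp
  have P: "complex_of_real (\<integral>z. pos_powr \<beta> z * ?q (y + z) \<partial>lborel) = of_real (Gamma \<beta>) * (\<integral>\<theta>. ?R \<theta> * iexp (\<theta> * y) \<partial>lborel)" for y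
  proof (rule power_fourier[OF \<beta>(1) Qi gauss_fourier[OF s]])
    show "integrable lborel (\<lambda>\<theta>. \<bar>\<theta>\<bar> powr - \<beta> * norm (gauss_freq s \<theta>))" using \<beta> by (intro gauss_freq_integrable s) auto
    show "integrable lborel (\<lambda>z. pos_powr \<beta> z * (s * std_normal_density (s * (y + z))))"
    proof (rule integrable_pos_powr_mult[where B=s])
      show "integrable lborel (\<lambda>z. s * std_normal_density (s * (y + z)))"
        using lborel_integrable_real_affine[OF qi, of 1 y] by simp
      show "\<bar>s * std_normal_density (s * (y + z))\<bar> \<le> s" for z
        using std_normal_le_1(1)[of "s * (y + z)"] s by (simp add: abs_mult mult_left_le)
    qed (use \<beta> in auto)
  qed
  have "complex_of_real (\<integral>b. ?m b * (\<integral>z. pos_powr \<beta> z * ?q (y - b + z) \<partial>lborel) \<partial>lborel)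
    = (\<integral>b. of_real (?m b) * (of_real (Gamma \<beta>) * (\<integral>\<theta>. ?R \<theta> * iexp (\<theta> * (y - b)) \<partial>lborel)) \<partial>lborel)"
    unfolding P[symmetric] of_real_mult[symmetric] integral_complex_of_real ..
  also have "\<dots> = of_real (Gamma \<beta>) * (\<integral>b. of_real (?m b) * (\<integral>\<theta>. ?R \<theta> * iexp (\<theta> * (y - b)) \<partial>lborel) \<partial>lborel)"
    unfolding mult.left_commute[of "complex_of_real (?m _)"] by (simp only: integral_mult_right_zero)
  also have "\<dots> = (\<integral>\<theta>. smooth_freq c s \<theta> * iexp (\<theta> * y) \<partial>lborel)"
    unfolding fourier_mixture(1)[OF window_integrable[OF c] neg_powr_gauss_integrable[OF s]]
    by (subst integral_mult_right_zero[symmetric]) (simp only: smooth_freq_def mult.assoc)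
  finally have A: "(\<integral>\<theta>. smooth_freq c s \<theta> * iexp (\<theta> * y) \<partial>lborel) = complex_of_real (\<integral>b. ?m b * (\<integral>z. pos_powr \<beta> z * ?q (y - b + z) \<partial>lborel) \<partial>lborel)" by simp
  have "(\<integral>b. ?m b * (\<integral>z. pos_powr \<beta> z * ?q (y - b + z) \<partial>lborel) \<partial>lborel) = (\<integral>u. (\<integral>b. ?m b * pos_powr \<beta> (b - u) \<partial>lborel) * ?q (y - u) \<partial>lborel)"
  proof (rule kernel_mixture[OF _ _ _ _ qi])
    show "(\<integral>b. ?m b * pos_powr \<beta> (b - u) \<partial>lborel) \<le> H c 0" for u
      using H_le_H0[OF c] by (simp add: killed_potential_def)
  qed (use H_integrable[OF c] in auto)
  also have "\<dots> = (\<integral>u. H c u * ?q (y - u) \<partial>lborel)" by (simp add: killed_potential_def)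
  \<comment> \<open>Substitution u = y - v/s, which standardises the Gaussian.\<close>
  also have "\<dots> = (1 / s) * (\<integral>v. s * (H c (y - v / s) * std_normal_density v) \<partial>lborel)"
    using s by (subst lborel_integral_real_affine[of "- 1 / s" _ y]) (auto simp: mult.left_commute[of s])
  also have "\<dots> = (\<integral>v. H c (y - v / s) * std_normal_density v \<partial>lborel)"
    unfolding integral_mult_right_zero using s by simp
  finally show ?thesis unfolding A by (simp only:)
qed

text \<open>The first Gaussian moment is 0, so the constant \<open>weight c y\<close> may be
  subtracted. What remains vanishes for |x| < s \<eta>, and for larger |x| the factor x^2/(s
  \<eta>)^2 >= 1 turns the first moment into the third.\<close>

lemma weight_smooth_bound:
  assumes s: "0 < s" and \<eta>: "0 < \<eta>" and w: "\<And>u. \<bar>u\<bar> < \<eta> \<Longrightarrow> weight c (y - u) = weight c y"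
  shows "\<bar>\<integral>x. weight c (y - x / s) * (x * std_normal_density x) \<partial>lborel\<bar> \<le> Beta \<gamma> (1 - \<gamma>) * (\<integral>x. std_normal_density x * \<bar>x\<bar> ^ 3 \<partial>lborel) / (s * \<eta>)\<^sup>2"
proof -
  let ?B = "Beta \<gamma> (1 - \<gamma>)"
  have i1: "integrable lborel (\<lambda>x. x * std_normal_density x)" using integrable_std_normal_moment[of 1] by (simp add: mult.commute)
  have i3: "integrable lborel (\<lambda>x. std_normal_density x * \<bar>x\<bar> ^ 3)" by (rule integrable_std_normal_moment_abs)
  have z: "(\<integral>x. x * std_normal_density x \<partial>lborel) = 0"
    using integral_std_normal_moment_odd[of 0] by (simp add: mult.commute)
  have wb: "\<bar>weight c u - weight c v\<bar> \<le> ?B" for u v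
    using weight_nonneg[of c u] weight_nonneg[of c v] weight_le[of c u] weight_le[of c v] by linarith
  have wi: "integrable lborel (\<lambda>x. weight c (y - x / s) * (x * std_normal_density x))"
  proof (rule Bochner_Integration.integrable_bound[OF integrable_mult_right[OF i1, of ?B]])
    show "AE x in lborel. norm (weight c (y - x / s) * (x * std_normal_density x)) \<le> norm (?B * (x * std_normal_density x))"
      using weight_nonneg weight_le by (intro AE_I2) (auto simp: abs_mult intro!: mult_right_mono order_trans[OF weight_le abs_ge_self])
  qed measurable
  have eq: "(\<integral>x. weight c (y - x / s) * (x * std_normal_density x) \<partial>lborel) = (\<integral>x. weight c (y - x / s) * (x * std_normal_density x) - weight c y * (x * std_normal_density x) \<partial>lborel)"
    using z by (subst Bochner_Integration.integral_diff[OF wi integrable_mult_right[OF i1]]) simp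
  have "\<bar>\<integral>x. weight c (y - x / s) * (x * std_normal_density x) \<partial>lborel\<bar> \<le> (\<integral>x. \<bar>weight c (y - x / s) * (x * std_normal_density x) - weight c y * (x * std_normal_density x)\<bar> \<partial>lborel)"
    unfolding eq by (rule integral_abs_bound)
  also have "\<dots> \<le> (\<integral>x. ?B / (s * \<eta>)\<^sup>2 * (std_normal_density x * \<bar>x\<bar> ^ 3) \<partial>lborel)"
  proof (rule integral_mono)
    show "integrable lborel (\<lambda>x. \<bar>weight c (y - x / s) * (x * std_normal_density x) - weight c y * (x * std_normal_density x)\<bar>)"
      by (intro integrable_abs Bochner_Integration.integrable_diff wi integrable_mult_right i1)
    fix x
    have e: "\<bar>weight c (y - x / s) * (x * std_normal_density x) - weight c y * (x * std_normal_density x)\<bar> = \<bar>weight c (y - x / s) - weight c y\<bar> * (\<bar>x\<bar> * std_normal_density x)"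
      by (simp add: left_diff_distrib[symmetric] abs_mult)
    show "\<bar>weight c (y - x / s) * (x * std_normal_density x) - weight c y * (x * std_normal_density x)\<bar> \<le> ?B / (s * \<eta>)\<^sup>2 * (std_normal_density x * \<bar>x\<bar> ^ 3)"
    proof (cases "\<bar>x / s\<bar> < \<eta>")
      case True
      have B0: "0 \<le> ?B" using weight_nonneg[of c 0] weight_le[of c 0] by linarith
      show ?thesis using w[OF True] B0 by simp
    next
      case False
      then have "s * \<eta> \<le> \<bar>x\<bar>" using s by (simp add: abs_divide pos_le_divide_eq mult.commute not_less)
      then have "(s * \<eta>)\<^sup>2 \<le> \<bar>x\<bar>\<^sup>2" using s \<eta> by (intro power_mono) auto
      then have "1 \<le> \<bar>x\<bar>\<^sup>2 / (s * \<eta>)\<^sup>2" using s \<eta> by simp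
      then have "1 * (\<bar>x\<bar> * std_normal_density x) \<le> \<bar>x\<bar>\<^sup>2 / (s * \<eta>)\<^sup>2 * (\<bar>x\<bar> * std_normal_density x)" by (intro mult_right_mono) auto
      then have "\<bar>weight c (y - x / s) - weight c y\<bar> * (1 * (\<bar>x\<bar> * std_normal_density x)) \<le> ?B * (\<bar>x\<bar>\<^sup>2 / (s * \<eta>)\<^sup>2 * (\<bar>x\<bar> * std_normal_density x))"
        by (rule mult_mono[OF wb _ order_trans[OF abs_ge_zero wb]]) simp
      then show ?thesis unfolding e by (simp add: power3_eq_cube power2_eq_square mult_ac)
    qed
  qed (intro integrable_mult_right i3)
  finally show ?thesis by simp
qed

text \<open>Multiplication by \<psi> cancels (-i \<theta>)^(-\<beta>) and leaves -(i
  \<theta>)^\<gamma>. A positive power is not the transform of a kernel of the type treated above,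
  so it is split as (i \<theta>)^(-(1-\<gamma>)) times i \<theta>: a fractional integral of the
  derivative of the Gaussian. Integrating over b gives s times the integral of \<open>weight\<close>
  against x \<phi>(x), of order s/(s \<eta>)^2.\<close>

lemma smooth_freq_generator:
  assumes c: "0 \<le> c" and s: "0 < s" and \<eta>: "0 < \<eta>" and w: "\<And>u. \<bar>u\<bar> < \<eta> \<Longrightarrow> weight c (y - u) = weight c y"
  shows "norm (\<integral>\<theta>. smooth_freq c s \<theta> * \<psi> \<theta> * iexp (\<theta> * y) \<partial>lborel) \<le> smooth_const / (s * \<eta>\<^sup>2)"
proof -
  let ?q = "\<lambda>u. - (s ^ 3 * u * std_normal_density (s * u))" and ?m = "\<lambda>b. indicator {0<..<c} b * pos_powr \<gamma> b"
  let ?Q = "\<lambda>\<theta>. \<i> * of_real \<theta> * gauss_freq s \<theta>"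
  let ?R = "\<lambda>\<theta>. (\<i> * of_real \<theta>) powr (- of_real (1 - \<gamma>)) * ?Q \<theta>"
  let ?mh = "\<lambda>\<theta>. \<integral>b. complex_of_real (?m b) * iexp (- (\<theta> * b)) \<partial>lborel"
  have qeq: "?q u = - (s\<^sup>2 * ((s * u) * std_normal_density (s * u)))" for u by (simp add: power2_eq_square power3_eq_cube)
  have i1: "integrable lborel (\<lambda>x. x * std_normal_density x)" using integrable_std_normal_moment[of 1] by (simp add: mult.commute)
  have qi: "integrable lborel ?q" unfolding qeq
    using lborel_integrable_real_affine[OF i1, of s 0] s by simp
  have qb: "\<bar>?q u\<bar> \<le> s\<^sup>2" for u
  proof -
    have "\<bar>?q u\<bar> = s\<^sup>2 * (\<bar>s * u\<bar> * std_normal_density (s * u))" unfolding qeq by (simp add: abs_mult)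
    also have "\<dots> \<le> s\<^sup>2 * 1" by (intro mult_left_mono std_normal_le_1) auto
    finally show ?thesis by simp
  qed
  have nQ: "norm (?Q \<theta>) = \<bar>\<theta>\<bar> * norm (gauss_freq s \<theta>)" for \<theta> by (simp add: norm_mult)
  have Qi: "integrable lborel ?Q"
    by (rule Bochner_Integration.integrable_bound[OF gauss_freq_integrable[OF s, of 1]]) (auto simp: norm_mult)
  have Qs: "integrable lborel (\<lambda>\<theta>. \<bar>\<theta>\<bar> powr - (1 - \<gamma>) * norm (?Q \<theta>))"
  proof -
    have "\<bar>\<theta>\<bar> powr - (1 - \<gamma>) * norm (?Q \<theta>) = \<bar>\<theta>\<bar> powr \<gamma> * norm (gauss_freq s \<theta>)" for \<theta>
    proof -
      have "\<bar>\<theta>\<bar> powr - (1 - \<gamma>) * \<bar>\<theta>\<bar> = \<bar>\<theta>\<bar> powr \<gamma>"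
        using powr_mult_base[of "\<bar>\<theta>\<bar>" "- (1 - \<gamma>)"] by (simp add: mult.commute)
      then show ?thesis unfolding nQ mult.assoc[symmetric] by (simp only:)
    qed
    then show ?thesis using gauss_freq_integrable[OF s, of \<gamma>] \<gamma> by simp
  qed
  have P: "complex_of_real (\<integral>z. pos_powr (1 - \<gamma>) z * ?q (y - z) \<partial>lborel) = of_real (Gamma (1 - \<gamma>)) * (\<integral>\<theta>. ?R \<theta> * iexp (\<theta> * y) \<partial>lborel)" for y
  proof (rule power_fourier_reflected[OF _ Qi gauss_fourier_deriv[OF s] Qs])
    show "integrable lborel (\<lambda>z. pos_powr (1 - \<gamma>) z * ?q (y - z))"
    proof (rule integrable_pos_powr_mult[where B="s\<^sup>2"])
      show "integrable lborel (\<lambda>z. ?q (y - z))" using lborel_integrable_real_affine[OF qi, of "-1" y] by simp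
      show "\<bar>?q (y - z)\<bar> \<le> s\<^sup>2" for z by (rule qb)
    qed (use \<gamma> in auto)
  qed (use \<gamma> in auto)
  have Rm: "?R \<theta> = (\<i> * of_real \<theta>) powr of_real \<gamma> * gauss_freq s \<theta>" for \<theta>
  proof (cases "\<theta> = 0")
    case False
    have "(\<i> * of_real \<theta>) powr (- of_real (1 - \<gamma>)) * (\<i> * of_real \<theta>) = (\<i> * of_real \<theta>) powr (- of_real (1 - \<gamma>) + 1)"
      using False by (subst powr_add) simp
    then show ?thesis by (simp add: mult.assoc[symmetric])
  qed (use \<gamma> in auto)
  have F\<psi>: "smooth_freq c s \<theta> * \<psi> \<theta> = - of_real (Gamma \<beta>) * (?R \<theta> * ?mh \<theta>)" for \<theta>
  proof (cases "\<theta> = 0")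
    case False
    have "(- \<i> * of_real \<theta>) powr (- of_real \<beta>) * (- \<i> * of_real \<theta>) powr of_real \<beta> = (- \<i> * complex_of_real \<theta>) powr (- of_real \<beta> + of_real \<beta>)"
      by (rule powr_add[symmetric])
    also have "\<dots> = 1" using False by simp
    finally have "(- \<i> * of_real \<theta>) powr (- of_real \<beta>) * (- \<i> * of_real \<theta>) powr of_real \<beta> = (1 :: complex)" .
    then have "\<psi> \<theta> * (- \<i> * of_real \<theta>) powr (- of_real \<beta>) = - ((\<i> * of_real \<theta>) powr of_real \<gamma>)"
      unfolding stable_exponent_def by (simp add: mult_ac)
    moreover have "smooth_freq c s \<theta> * \<psi> \<theta> = of_real (Gamma \<beta>) * ((\<psi> \<theta> * (- \<i> * of_real \<theta>) powr (- of_real \<beta>)) * gauss_freq s \<theta>) * ?mh \<theta>"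
      unfolding smooth_freq_def by (simp only: mult_ac)
    ultimately show ?thesis unfolding Rm by simp
  next
    case True
    then show ?thesis using \<gamma> by (simp add: Rm)
  qed
  have Ri: "integrable lborel ?R"
  proof (rule Bochner_Integration.integrable_bound[OF Qs])
    have "(\<lambda>\<theta>. (\<i> * complex_of_real \<theta>) powr of_real \<gamma>) = (\<lambda>\<theta>. if 0 < \<theta> then of_real (\<theta> powr \<gamma>) * cis (\<gamma> * (pi / 2))
      else if \<theta> < 0 then of_real ((- \<theta>) powr \<gamma>) * cis (- \<gamma> * (pi / 2)) else 0)"
      using imag_powr(1)[of _ \<gamma>] imag_powr(2)[of "- _" \<gamma>] \<gamma> by (auto simp: fun_eq_iff not_less less_le)
    also have "\<dots> \<in> borel_measurable borel" by measurable
    finally have [measurable]: "(\<lambda>\<theta>. (\<i> * complex_of_real \<theta>) powr of_real \<gamma>) \<in> borel_measurable borel" .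
    show "?R \<in> borel_measurable lborel" unfolding Rm by measurable
    show "AE \<theta> in lborel. norm (?R \<theta>) \<le> norm (\<bar>\<theta>\<bar> powr - (1 - \<gamma>) * norm (?Q \<theta>))"
      by (intro AE_I2) (simp add: norm_mult norm_powr_real_powr')
  qed
  have "complex_of_real (\<integral>b. ?m b * (\<integral>z. pos_powr (1 - \<gamma>) z * ?q (y - b - z) \<partial>lborel) \<partial>lborel)
    = (\<integral>b. of_real (?m b) * (of_real (Gamma (1 - \<gamma>)) * (\<integral>\<theta>. ?R \<theta> * iexp (\<theta> * (y - b)) \<partial>lborel)) \<partial>lborel)"
    unfolding P[symmetric] of_real_mult[symmetric] integral_complex_of_real ..
  also have "\<dots> = of_real (Gamma (1 - \<gamma>)) * (\<integral>b. of_real (?m b) * (\<integral>\<theta>. ?R \<theta> * iexp (\<theta> * (y - b)) \<partial>lborel) \<partial>lborel)"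
    unfolding mult.left_commute[of "complex_of_real (?m _)"] by (simp only: integral_mult_right_zero)
  also have "\<dots> = of_real (Gamma (1 - \<gamma>)) * (\<integral>\<theta>. ?R \<theta> * ?mh \<theta> * iexp (\<theta> * y) \<partial>lborel)"
    unfolding fourier_mixture(1)[OF window_integrable[OF c] Ri] ..
  finally have A: "of_real (Gamma (1 - \<gamma>)) * (\<integral>\<theta>. ?R \<theta> * ?mh \<theta> * iexp (\<theta> * y) \<partial>lborel) = complex_of_real (\<integral>b. ?m b * (\<integral>z. pos_powr (1 - \<gamma>) z * ?q (y - b - z) \<partial>lborel) \<partial>lborel)" ..
  \<comment> \<open>Reflection of z brings the integral into the form expected by
    \<open>kernel_mixture\<close>, with the kernel (-z)_+^(-\<gamma>).\<close>
  have "(\<integral>z. pos_powr (1 - \<gamma>) z * ?q (y - b - z) \<partial>lborel) = (\<integral>z. pos_powr (1 - \<gamma>) (- z) * ?q (y - b + z) \<partial>lborel)" for b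
    by (subst lborel_integral_real_affine[of "-1" _ 0]) auto
  then have "(\<integral>b. ?m b * (\<integral>z. pos_powr (1 - \<gamma>) z * ?q (y - b - z) \<partial>lborel) \<partial>lborel) = (\<integral>b. ?m b * (\<integral>z. pos_powr (1 - \<gamma>) (- z) * ?q (y - b + z) \<partial>lborel) \<partial>lborel)"
    by (simp only:)
  also have "\<dots> = (\<integral>u. (\<integral>b. ?m b * pos_powr (1 - \<gamma>) (- (b - u)) \<partial>lborel) * ?q (y - u) \<partial>lborel)"
  proof (rule kernel_mixture[OF _ _ _ _ qi])
    show "(\<integral>b. ?m b * pos_powr (1 - \<gamma>) (- (b - u)) \<partial>lborel) \<le> Beta \<gamma> (1 - \<gamma>)" for u
      using weight_le[of c u] by (simp add: weight_def)
    show "integrable lborel (\<lambda>b. ?m b * pos_powr (1 - \<gamma>) (- (b - u)))" for u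
      using weight_integrable[of c u] by simp
  qed auto
  also have "\<dots> = (\<integral>u. weight c u * ?q (y - u) \<partial>lborel)" by (simp add: weight_def)
  also have "\<dots> = (1 / s) * (\<integral>x. weight c (y - x / s) * ?q (x / s) \<partial>lborel)"
    using s by (subst lborel_integral_real_affine[of "- 1 / s" _ y]) auto
  also have "\<dots> = (1 / s) * (\<integral>x. (- s\<^sup>2) * (weight c (y - x / s) * (x * std_normal_density x)) \<partial>lborel)"
    using s by (intro arg_cong[of _ _ "\<lambda>z. 1 / s * z"] Bochner_Integration.integral_cong refl) (simp add: power2_eq_square power3_eq_cube)
  also have "\<dots> = (1 / s) * ((- s\<^sup>2) * (\<integral>x. weight c (y - x / s) * (x * std_normal_density x) \<partial>lborel))"
    by (simp only: integral_mult_right_zero)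
  finally have B: "(\<integral>b. ?m b * (\<integral>z. pos_powr (1 - \<gamma>) z * ?q (y - b - z) \<partial>lborel) \<partial>lborel) = - s * (\<integral>x. weight c (y - x / s) * (x * std_normal_density x) \<partial>lborel)"
    using s by (simp add: power2_eq_square)
  have G: "0 < Gamma (1 - \<gamma>)" "0 < Gamma \<beta>" using \<gamma> \<beta> by (auto intro!: Gamma_real_pos)
  have "norm (\<integral>\<theta>. ?R \<theta> * ?mh \<theta> * iexp (\<theta> * y) \<partial>lborel) * Gamma (1 - \<gamma>) = Gamma (1 - \<gamma>) * norm (\<integral>\<theta>. ?R \<theta> * ?mh \<theta> * iexp (\<theta> * y) \<partial>lborel)"
    by (rule mult.commute)
  also have "Gamma (1 - \<gamma>) * norm (\<integral>\<theta>. ?R \<theta> * ?mh \<theta> * iexp (\<theta> * y) \<partial>lborel) = norm (of_real (Gamma (1 - \<gamma>)) * (\<integral>\<theta>. ?R \<theta> * ?mh \<theta> * iexp (\<theta> * y) \<partial>lborel))"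
    using G by (simp only: norm_mult norm_of_real abs_of_pos)
  also have "\<dots> = s * \<bar>\<integral>x. weight c (y - x / s) * (x * std_normal_density x) \<partial>lborel\<bar>"
    unfolding A B using s by (simp only: norm_of_real abs_mult abs_minus abs_of_pos)
  also have "\<dots> \<le> s * (Beta \<gamma> (1 - \<gamma>) * (\<integral>x. std_normal_density x * \<bar>x\<bar> ^ 3 \<partial>lborel) / (s * \<eta>)\<^sup>2)"
    using s by (intro mult_left_mono weight_smooth_bound[OF s \<eta> w]) auto
  also have "\<dots> = Beta \<gamma> (1 - \<gamma>) * (\<integral>x. std_normal_density x * \<bar>x\<bar> ^ 3 \<partial>lborel) / (s * \<eta>\<^sup>2)"
    using s by (simp add: power2_eq_square)
  finally have N: "norm (\<integral>\<theta>. ?R \<theta> * ?mh \<theta> * iexp (\<theta> * y) \<partial>lborel) \<le> Beta \<gamma> (1 - \<gamma>) * (\<integral>x. std_normal_density x * \<bar>x\<bar> ^ 3 \<partial>lborel) / (s * \<eta>\<^sup>2) / Gamma (1 - \<gamma>)"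
    by (rule mult_imp_le_div_pos[OF G(1)])
  have "(\<integral>\<theta>. smooth_freq c s \<theta> * \<psi> \<theta> * iexp (\<theta> * y) \<partial>lborel) = - of_real (Gamma \<beta>) * (\<integral>\<theta>. ?R \<theta> * ?mh \<theta> * iexp (\<theta> * y) \<partial>lborel)"
    unfolding F\<psi> mult.assoc[of "- of_real (Gamma \<beta>)"] by (simp only: integral_mult_right_zero)
  then have "norm (\<integral>\<theta>. smooth_freq c s \<theta> * \<psi> \<theta> * iexp (\<theta> * y) \<partial>lborel) = Gamma \<beta> * norm (\<integral>\<theta>. ?R \<theta> * ?mh \<theta> * iexp (\<theta> * y) \<partial>lborel)"
    using G by (simp only: norm_mult norm_minus_cancel norm_of_real abs_of_pos)
  also have "\<dots> \<le> Gamma \<beta> * (Beta \<gamma> (1 - \<gamma>) * (\<integral>x. std_normal_density x * \<bar>x\<bar> ^ 3 \<partial>lborel) / (s * \<eta>\<^sup>2) / Gamma (1 - \<gamma>))"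
    using G by (intro mult_left_mono N) auto
  also have "\<dots> = smooth_const / (s * \<eta>\<^sup>2)" by (simp add: smooth_const_def)
  finally show ?thesis .
qed

end

section \<open>Filtration and optional times\<close>

text \<open>The stopping arguments use only independence, regular paths and a characteristic
  exponent with nonpositive real part; stability enters in \<open>stable_motion\<close>.\<close>

locale levy_motion = prob_space M for M :: "'a measure" +
  fixes X :: "real \<Rightarrow> 'a \<Rightarrow> real" and \<psi> :: "real \<Rightarrow> complex"
  assumes levy: "levy_process M X"
    and char_X: "0 \<le> t \<Longrightarrow> char (distr M borel (X t)) \<theta> = exp (of_real t * \<psi> \<theta>)"
    and Re_\<psi>: "Re (\<psi> \<theta>) \<le> 0"
    and \<psi>_measurable [measurable]: "\<psi> \<in> borel_measurable borel"
begin

lemma X_measurable: "0 \<le> t \<Longrightarrow> X t \<in> borel_measurable M"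
  using levy by (simp add: levy_process_def)

lemma X_0: "\<omega> \<in> space M \<Longrightarrow> X 0 \<omega> = 0"
  using levy by (simp add: levy_process_def)

lemma X_right_cont: "\<omega> \<in> space M \<Longrightarrow> 0 \<le> t \<Longrightarrow> continuous (at_right t) (\<lambda>s. X s \<omega>)"
  using levy by (simp add: levy_process_def)

lemma X_left_lim: "\<omega> \<in> space M \<Longrightarrow> 0 < t \<Longrightarrow> \<exists>l. ((\<lambda>s. X s \<omega>) \<longlongrightarrow> l) (at_left t)"
  using levy by (simp add: levy_process_def)

lemma X_increments_indep:
  "0 \<le> (ts :: nat \<Rightarrow> real) 0 \<Longrightarrow> (\<And>i. i < n \<Longrightarrow> ts i < ts (Suc i)) \<Longrightarrow>
    indep_vars (\<lambda>_. borel) (\<lambda>i \<omega>. X (ts (Suc i)) \<omega> - X (ts i) \<omega>) {..<n}"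
  using levy by (simp add: levy_process_def)

lemma X_increment_distr:
  "0 \<le> s \<Longrightarrow> s \<le> t \<Longrightarrow> distr M borel (\<lambda>\<omega>. X t \<omega> - X s \<omega>) = distr M borel (X (t - s))"
  using levy by (simp add: levy_process_def)

lemma X_right_lim:
  assumes "\<omega> \<in> space M" "0 \<le> t" "\<And>n. t < u n" "u \<longlonglongrightarrow> t"
  shows "(\<lambda>n. X (u n) \<omega>) \<longlonglongrightarrow> X t \<omega>"
  using X_right_cont[OF assms(1,2)] assms(3,4) unfolding continuous_within tendsto_at_iff_sequentially
  by (auto simp: o_def)

text \<open>Generated by the values at dyadic times up to t only. Independence of later increments
  then reduces to finitely many increments on a common grid, and right-continuity makes dyadic times
  sufficient to detect entry into open sets.\<close>

definition filt :: "real \<Rightarrow> 'a measure" where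
  "filt t = sigma (space M) {X (real j / 2 ^ m) -` B \<inter> space M | j m B. real j / 2 ^ m \<le> t \<and> B \<in> sets borel}"

lemma filt_gen: "{X (real j / 2 ^ m) -` B \<inter> space M | j m B. real j / 2 ^ m \<le> t \<and> B \<in> sets borel} \<subseteq> Pow (space M)"
  by auto

lemma space_filt [simp]: "space (filt t) = space M"
  unfolding filt_def by (rule space_measure_of[OF filt_gen])

lemma sets_filt: "sets (filt t) = sigma_sets (space M) {X (real j / 2 ^ m) -` B \<inter> space M | j m B. real j / 2 ^ m \<le> t \<and> B \<in> sets borel}"
  unfolding filt_def by (rule sets_measure_of[OF filt_gen])

lemma filt_mono: "s \<le> t \<Longrightarrow> sets (filt s) \<subseteq> sets (filt t)"
  unfolding sets_filt by (intro sigma_sets_mono') fastforce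

lemma filt_subset: "sets (filt t) \<subseteq> sets M"
  unfolding sets_filt
  by (rule sets.sigma_sets_subset) (auto intro!: measurable_sets X_measurable)

lemma measurable_filt_M: "f \<in> measurable (filt s) N \<Longrightarrow> f \<in> measurable M N"
  using filt_subset[of s] by (auto simp: measurable_def)

lemma X_measurable_filt: "real j / 2 ^ m \<le> t \<Longrightarrow> X (real j / 2 ^ m) \<in> borel_measurable (filt t)"
  by (rule measurableI) (auto simp: sets_filt intro!: sigma_sets.Basic)

definition dyadic_path :: "nat \<Rightarrow> nat \<Rightarrow> 'a \<Rightarrow> nat \<Rightarrow> real" where
  "dyadic_path K m \<omega> = (\<lambda>j\<in>{..K}. X (real j / 2 ^ m) \<omega>)"

lemma dyadic_path_measurable [measurable]: "dyadic_path K m \<in> M \<rightarrow>\<^sub>M PiM {..K} (\<lambda>_. borel)"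
  unfolding dyadic_path_def by (intro measurable_restrict X_measurable) auto

text \<open>The path on the fine grid up to time k/2^n is a function of its increments there, and
  these are independent of the following coarse increment.\<close>

lemma dyadic_path_indep:
  assumes m: "n \<le> m" and B: "B \<in> sets (PiM {..k * 2 ^ (m - n)} (\<lambda>_. borel))" and C: "C \<in> sets borel"
  shows "prob ((dyadic_path (k * 2 ^ (m - n)) m -` B \<inter> space M) \<inter> ((\<lambda>\<omega>. X (real (Suc k) / 2 ^ n) \<omega> - X (real k / 2 ^ n) \<omega>) -` C \<inter> space M))
    = prob (dyadic_path (k * 2 ^ (m - n)) m -` B \<inter> space M) * prob ((\<lambda>\<omega>. X (real (Suc k) / 2 ^ n) \<omega> - X (real k / 2 ^ n) \<omega>) -` C \<inter> space M)"
proof -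
  define K where "K = k * 2 ^ (m - n)"
  \<comment> \<open>Fine steps up to index K, that is time k/2^n, followed by one coarse step. The
    grid must be strictly increasing for the increment hypothesis to apply.\<close>
  define ts where "ts = (\<lambda>i. if i \<le> K then real i / 2 ^ m else real (Suc k) / 2 ^ n)"
  have pw: "(2::real) ^ m = 2 ^ n * 2 ^ (m - n)" using m by (simp add: power_add[symmetric])
  have tsK: "real K / 2 ^ m = real k / 2 ^ n" unfolding K_def pw by simp
  let ?V = "\<lambda>i \<omega>. X (ts (Suc i)) \<omega> - X (ts i) \<omega>"
  have "indep_vars (\<lambda>_. borel) ?V {..<Suc K}"
  proof (rule X_increments_indep)
    show "ts i < ts (Suc i)" if "i < Suc K" for i
    proof (cases "i = K")
      case True
      then show ?thesis using tsK by (simp add: ts_def divide_strict_right_mono)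
    next
      case False
      then show ?thesis using that by (simp add: ts_def divide_strict_right_mono)
    qed
  qed (simp add: ts_def)
  then have "indep_var (PiM {..<K} (\<lambda>_. borel)) (\<lambda>\<omega>. restrict (\<lambda>i. ?V i \<omega>) {..<K}) (PiM {K} (\<lambda>_. borel)) (\<lambda>\<omega>. restrict (\<lambda>i. ?V i \<omega>) {K})"
    by (rule indep_var_restrict) auto
  \<comment> \<open>Partial sums recover the path from its increments, as X starts at 0.\<close>
  then have "indep_var (PiM {..K} (\<lambda>_. borel)) ((\<lambda>f. \<lambda>j\<in>{..K}. \<Sum>i<j. f i) \<circ> (\<lambda>\<omega>. restrict (\<lambda>i. ?V i \<omega>) {..<K}))
     (PiM {K} (\<lambda>_. borel)) ((\<lambda>f. f) \<circ> (\<lambda>\<omega>. restrict (\<lambda>i. ?V i \<omega>) {K}))"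
    by (rule indep_var_compose)
       (auto intro!: measurable_restrict borel_measurable_sum measurable_component_singleton)
  note ind = this
  have C': "(\<lambda>f. f K) -` C \<inter> space (PiM {K} (\<lambda>_. borel)) \<in> sets (PiM {K} (\<lambda>_. borel))"
    using C by (intro measurable_sets[OF measurable_component_singleton]) auto
  have vim: "(\<lambda>x. (A x, B x)) -` (S \<times> T) \<inter> space M = A -` S \<inter> space M \<inter> (B -` T \<inter> space M)"
    for A B :: "'a \<Rightarrow> nat \<Rightarrow> real" and S T by auto
  have "prob (((\<lambda>f. \<lambda>j\<in>{..K}. \<Sum>i<j. f i) \<circ> (\<lambda>\<omega>. restrict (\<lambda>i. ?V i \<omega>) {..<K})) -` B \<inter> space M \<inter>
      (((\<lambda>f. f) \<circ> (\<lambda>\<omega>. restrict (\<lambda>i. ?V i \<omega>) {K})) -` ((\<lambda>f. f K) -` C \<inter> space (PiM {K} (\<lambda>_. borel))) \<inter> space M))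
    = prob (((\<lambda>f. \<lambda>j\<in>{..K}. \<Sum>i<j. f i) \<circ> (\<lambda>\<omega>. restrict (\<lambda>i. ?V i \<omega>) {..<K})) -` B \<inter> space M) *
      prob (((\<lambda>f. f) \<circ> (\<lambda>\<omega>. restrict (\<lambda>i. ?V i \<omega>) {K})) -` ((\<lambda>f. f K) -` C \<inter> space (PiM {K} (\<lambda>_. borel))) \<inter> space M)"
    using indep_varD[OF ind B[folded K_def] C'] unfolding vim .
  moreover have V2: "((\<lambda>f. f) \<circ> (\<lambda>\<omega>. restrict (\<lambda>i. ?V i \<omega>) {K})) -` ((\<lambda>f. f K) -` C \<inter> space (PiM {K} (\<lambda>_. borel))) \<inter> space M
     = (\<lambda>\<omega>. X (real (Suc k) / 2 ^ n) \<omega> - X (real k / 2 ^ n) \<omega>) -` C \<inter> space M"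
    using tsK by (auto simp: ts_def space_PiM)
  moreover have "((\<lambda>f. \<lambda>j\<in>{..K}. \<Sum>i<j. f i) \<circ> (\<lambda>\<omega>. restrict (\<lambda>i. ?V i \<omega>) {..<K})) \<omega> = dyadic_path K m \<omega>" if "\<omega> \<in> space M" for \<omega>
  proof -
    have "(\<Sum>i<j. (\<lambda>i\<in>{..<K}. ?V i \<omega>) i) = X (real j / 2 ^ m) \<omega>" if j: "j \<le> K" for j
    proof -
      have "(\<Sum>i<j. (\<lambda>i\<in>{..<K}. ?V i \<omega>) i) = (\<Sum>i<j. X (real (Suc i) / 2 ^ m) \<omega> - X (real i / 2 ^ m) \<omega>)"
        using j by (intro sum.cong) (auto simp: ts_def)
      also have "\<dots> = X (real j / 2 ^ m) \<omega> - X (real 0 / 2 ^ m) \<omega>" by (rule sum_lessThan_telescope)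
      finally show ?thesis using X_0[OF \<open>\<omega> \<in> space M\<close>] by simp
    qed
    then show ?thesis by (auto simp: dyadic_path_def fun_eq_iff)
  qed
  then have V1: "((\<lambda>f. \<lambda>j\<in>{..K}. \<Sum>i<j. f i) \<circ> (\<lambda>\<omega>. restrict (\<lambda>i. ?V i \<omega>) {..<K})) -` B \<inter> space M = dyadic_path K m -` B \<inter> space M"
    by (auto simp del: o_apply)
  ultimately show ?thesis unfolding K_def[symmetric] by (simp only:)
qed

text \<open>The events of dyadic paths form a generator stable under intersection, since two of them
  can be written on the finer of the two grids; independence passes from there to the generated
  sigma-algebra.\<close>

lemma filt_indep:
  "indep_set (sets (filt (real k / 2 ^ n)))
    (sigma_sets (space M) {(\<lambda>\<omega>. X (real (Suc k) / 2 ^ n) \<omega> - X (real k / 2 ^ n) \<omega>) -` C \<inter> space M | C. C \<in> sets borel})"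
proof -
  let ?D = "\<lambda>\<omega>. X (real (Suc k) / 2 ^ n) \<omega> - X (real k / 2 ^ n) \<omega>"
  let ?K = "\<lambda>m. k * 2 ^ (m - n)"
  define G where "G = {dyadic_path (?K m) m -` B \<inter> space M | m B. n \<le> m \<and> B \<in> sets (PiM {..?K m} (\<lambda>_. borel))}"
  have Dm: "?D \<in> borel_measurable M" by (intro borel_measurable_diff X_measurable) auto
  \<comment> \<open>The coarser path is obtained from the finer one by keeping every 2^(m'-m)-th
    entry.\<close>
  have refine: "\<exists>B'. B' \<in> sets (PiM {..?K m'} (\<lambda>_. borel)) \<and> dyadic_path (?K m) m -` B \<inter> space M = dyadic_path (?K m') m' -` B' \<inter> space M"
    if "n \<le> m" "m \<le> m'" "B \<in> sets (PiM {..?K m} (\<lambda>_. borel))" for m m' and B :: "(nat \<Rightarrow> real) set"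
  proof -
    let ?r = "\<lambda>f. \<lambda>j\<in>{..?K m}. f (j * 2 ^ (m' - m)) :: real"
    have KK: "?K m' = ?K m * 2 ^ (m' - m)" using that by (simp add: power_add[symmetric])
    have le: "j * 2 ^ (m' - m) \<le> ?K m'" if "j \<le> ?K m" for j
      unfolding KK using that by simp
    have r: "?r \<in> PiM {..?K m'} (\<lambda>_. borel) \<rightarrow>\<^sub>M PiM {..?K m} (\<lambda>_. borel)"
      by (intro measurable_restrict measurable_component_singleton) (use le in auto)
    have pw: "(2::real) ^ m' = 2 ^ m * 2 ^ (m' - m)" using that by (simp add: power_add[symmetric])
    have "?r (dyadic_path (?K m') m' \<omega>) = dyadic_path (?K m) m \<omega>" for \<omega>
      using le by (auto simp: dyadic_path_def fun_eq_iff pw)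
    moreover have "dyadic_path (?K m') m' \<omega> \<in> space (PiM {..?K m'} (\<lambda>_. borel))" for \<omega>
      by (auto simp: dyadic_path_def space_PiM)
    ultimately have "dyadic_path (?K m) m -` B \<inter> space M = dyadic_path (?K m') m' -` (?r -` B \<inter> space (PiM {..?K m'} (\<lambda>_. borel))) \<inter> space M"
      by auto
    then show ?thesis using measurable_sets[OF r that(3)] by blast
  qed
  have "Int_stable G"
  proof (rule Int_stableI)
    fix a b assume "a \<in> G" "b \<in> G"
    then obtain m1 B1 m2 B2 where 1: "n \<le> m1" "B1 \<in> sets (PiM {..?K m1} (\<lambda>_. borel))" "a = dyadic_path (?K m1) m1 -` B1 \<inter> space M"
      and 2: "n \<le> m2" "B2 \<in> sets (PiM {..?K m2} (\<lambda>_. borel))" "b = dyadic_path (?K m2) m2 -` B2 \<inter> space M"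
      unfolding G_def by blast
    define m where "m = max m1 m2"
    from refine[OF 1(1) _ 1(2), of m] obtain B1' where 3: "B1' \<in> sets (PiM {..?K m} (\<lambda>_. borel))" "a = dyadic_path (?K m) m -` B1' \<inter> space M"
      using 1 by (auto simp: m_def)
    from refine[OF 2(1) _ 2(2), of m] obtain B2' where 4: "B2' \<in> sets (PiM {..?K m} (\<lambda>_. borel))" "b = dyadic_path (?K m) m -` B2' \<inter> space M"
      using 2 by (auto simp: m_def)
    have "a \<inter> b = dyadic_path (?K m) m -` (B1' \<inter> B2') \<inter> space M" using 3 4 by auto
    moreover have "B1' \<inter> B2' \<in> sets (PiM {..?K m} (\<lambda>_. borel))" using 3 4 by auto
    moreover have "n \<le> m" using 1 by (simp add: m_def)
    ultimately show "a \<inter> b \<in> G" unfolding G_def by blast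
  qed
  moreover have "Int_stable {?D -` C \<inter> space M | C. C \<in> sets borel}"
  proof (rule Int_stableI)
    fix a b assume "a \<in> {?D -` C \<inter> space M | C. C \<in> sets borel}" "b \<in> {?D -` C \<inter> space M | C. C \<in> sets borel}"
    then obtain A B where "a = ?D -` A \<inter> space M" "b = ?D -` B \<inter> space M" "A \<in> sets borel" "B \<in> sets borel" by blast
    then have "a \<inter> b = ?D -` (A \<inter> B) \<inter> space M" "A \<inter> B \<in> sets borel" by auto
    then show "a \<inter> b \<in> {?D -` C \<inter> space M | C. C \<in> sets borel}" by blast
  qed
  moreover have "indep_set G {?D -` C \<inter> space M | C. C \<in> sets borel}"
    unfolding indep_sets2_eq
  proof (intro conjI ballI)
    show "G \<subseteq> events" unfolding G_def by (auto intro: measurable_sets[OF dyadic_path_measurable])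
    show "{?D -` C \<inter> space M | C. C \<in> sets borel} \<subseteq> events" using measurable_sets[OF Dm] by blast
    fix a b assume "a \<in> G" "b \<in> {?D -` C \<inter> space M | C. C \<in> sets borel}"
    then obtain m B C where 1: "n \<le> m" "B \<in> sets (PiM {..?K m} (\<lambda>_. borel))" "a = dyadic_path (?K m) m -` B \<inter> space M"
      "b = ?D -` C \<inter> space M" "C \<in> sets borel"
      unfolding G_def by blast
    show "prob (a \<inter> b) = prob a * prob b"
      unfolding 1(3,4) by (rule dyadic_path_indep[OF 1(1,2,5)])
  qed
  ultimately have I: "indep_set (sigma_sets (space M) G) (sigma_sets (space M) {?D -` C \<inter> space M | C. C \<in> sets borel})"
    by (intro indep_set_sigma_sets)
  have "sets (filt (real k / 2 ^ n)) \<subseteq> sigma_sets (space M) G"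
    unfolding sets_filt
  proof (rule sigma_sets_mono, safe)
    fix j m and B :: "real set" assume j: "real j / 2 ^ m \<le> real k / 2 ^ n" and B: "B \<in> sets borel"
    define m' where "m' = max m n"
    define j' where "j' = j * 2 ^ (m' - m)"
    have pw: "(2::real) ^ m' = 2 ^ m * 2 ^ (m' - m)" "(2::real) ^ m' = 2 ^ n * 2 ^ (m' - n)" by (simp_all add: m'_def power_add[symmetric])
    have jj: "real j' / 2 ^ m' = real j / 2 ^ m" by (simp add: j'_def pw(1))
    have KK: "real (?K m') / 2 ^ m' = real k / 2 ^ n" by (simp add: pw(2))
    have "real j' / 2 ^ m' \<le> real (?K m') / 2 ^ m'" unfolding jj KK by (rule j)
    then have "real j' \<le> real (?K m')" by (simp only: divide_le_cancel) simp
    then have le: "j' \<le> ?K m'" by (simp only: of_nat_le_iff)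
    let ?B' = "(\<lambda>f. f j') -` B \<inter> space (PiM {..?K m'} (\<lambda>_. borel)) :: (nat \<Rightarrow> real) set"
    have "?B' \<in> sets (PiM {..?K m'} (\<lambda>_. borel))"
      using le B by (intro measurable_sets[OF measurable_component_singleton]) auto
    moreover have "X (real j / 2 ^ m) -` B \<inter> space M = dyadic_path (?K m') m' -` ?B' \<inter> space M"
      using le by (auto simp: dyadic_path_def space_PiM jj)
    moreover have "n \<le> m'" by (simp add: m'_def)
    ultimately have "X (real j / 2 ^ m) -` B \<inter> space M \<in> G" unfolding G_def by blast
    then show "X (real j / 2 ^ m) -` B \<inter> space M \<in> sigma_sets (space M) G" by (rule sigma_sets.Basic)
  qed
  then show ?thesis using I unfolding indep_sets2_eq by blast
qed

lemma expectation_increment: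
  assumes Z: "Z \<in> borel_measurable (filt (real k / 2 ^ n))" and bound: "\<And>\<omega>. \<omega> \<in> space M \<Longrightarrow> norm (Z \<omega>) \<le> C"
  shows "(\<integral>\<omega>. Z \<omega> * iexp (\<theta> * (X (real (Suc k) / 2 ^ n) \<omega> - X (real k / 2 ^ n) \<omega>)) \<partial>M) = (\<integral>\<omega>. Z \<omega> \<partial>M) * exp (\<psi> \<theta> / 2 ^ n)"
proof -
  let ?D = "\<lambda>\<omega>. X (real (Suc k) / 2 ^ n) \<omega> - X (real k / 2 ^ n) \<omega>"
  have Dm [measurable]: "?D \<in> borel_measurable M" by (intro borel_measurable_diff X_measurable) auto
  have Zm [measurable]: "Z \<in> borel_measurable M" by (rule measurable_filt_M[OF Z])
  let ?Y = "\<lambda>\<omega>. iexp (\<theta> * ?D \<omega>)"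
  have "indep_var borel Z borel ?Y"
    unfolding indep_var_eq
  proof (intro conjI)
    have "sigma_sets (space M) {Z -` A \<inter> space M | A. A \<in> sets borel} \<subseteq> sets (filt (real k / 2 ^ n))"
      using measurable_sets[OF Z] by (intro sets.sigma_sets_subset[of _ "filt (real k / 2 ^ n)", simplified]) auto
    moreover have "sigma_sets (space M) {?Y -` A \<inter> space M | A. A \<in> sets borel} \<subseteq> sigma_sets (space M) {?D -` C \<inter> space M | C. C \<in> sets borel}"
    proof (rule sigma_sets_mono, safe)
      fix A :: "complex set" assume "A \<in> sets borel"
      then have "(\<lambda>x. iexp (\<theta> * x)) -` A \<in> sets borel"
        using measurable_sets_borel[of "\<lambda>x. iexp (\<theta> * x)" borel A] by simp
      moreover have "?Y -` A \<inter> space M = ?D -` ((\<lambda>x. iexp (\<theta> * x)) -` A) \<inter> space M" by auto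
      ultimately show "?Y -` A \<inter> space M \<in> sigma_sets (space M) {?D -` C \<inter> space M | C. C \<in> sets borel}"
        by (intro sigma_sets.Basic) blast
    qed
    ultimately show "indep_set (sigma_sets (space M) {Z -` A \<inter> space M | A. A \<in> sets borel}) (sigma_sets (space M) {?Y -` A \<inter> space M | A. A \<in> sets borel})"
      using filt_indep[of k n] unfolding indep_sets2_eq by blast
  qed measurable
  moreover have "integrable M Z"
    using bound by (intro integrable_const_bound[where B=C] AE_I2) auto
  moreover have Ym: "?Y \<in> borel_measurable M" by measurable
  then have "integrable M ?Y"
    by (intro integrable_const_bound[where B=1] AE_I2) auto
  ultimately have "(\<integral>\<omega>. Z \<omega> * ?Y \<omega> \<partial>M) = (\<integral>\<omega>. Z \<omega> \<partial>M) * (\<integral>\<omega>. ?Y \<omega> \<partial>M)"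
    by (rule indep_var_lebesgue_integral)
  also have "(\<integral>\<omega>. ?Y \<omega> \<partial>M) = char (distr M borel ?D) \<theta>"
    unfolding char_def by (rule integral_distr[symmetric, OF Dm]) measurable
  also have "distr M borel ?D = distr M borel (X (1 / 2 ^ n))"
    by (subst X_increment_distr) (auto simp: divide_right_mono diff_divide_distrib[symmetric])
  also have "char (distr M borel (X (1 / 2 ^ n))) \<theta> = exp (\<psi> \<theta> / 2 ^ n)"
    by (subst char_X) auto
  finally show ?thesis .
qed

end

section \<open>Telescoping along grid stopping times\<close>

context levy_motion
begin

text \<open>Stopping times in units of 2^(-n), phrased through k < \<kappa>: at time k/2^n it is
  known whether the step from k to k + 1 is still made. This is the form in which they enter a sum
  over steps.\<close>

definition grid_time :: "nat \<Rightarrow> ('a \<Rightarrow> nat) \<Rightarrow> bool" where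
  "grid_time n \<kappa> \<longleftrightarrow> (\<forall>k. {\<omega>\<in>space M. k < \<kappa> \<omega>} \<in> sets (filt (real k / 2 ^ n)))"

lemma grid_timeD:
  assumes "grid_time n \<kappa>" "j \<le> k"
  shows "{\<omega>\<in>space M. j < \<kappa> \<omega>} \<in> sets (filt (real k / 2 ^ n))"
proof -
  have "real j / 2 ^ n \<le> real k / 2 ^ n" using assms(2) by (simp add: divide_right_mono)
  from filt_mono[OF this] show ?thesis using assms(1) by (auto simp: grid_time_def)
qed

lemma stopped_measurable:
  assumes "grid_time n \<kappa>"
  shows "(\<lambda>\<omega>. X (real (min (\<kappa> \<omega>) k) / 2 ^ n) \<omega>) \<in> borel_measurable (filt (real k / 2 ^ n))"
proof -
  have "X (real (min (\<kappa> \<omega>) k) / 2 ^ n) \<omega> = (\<Sum>j<k. if j < \<kappa> \<omega> then X (real (Suc j) / 2 ^ n) \<omega> - X (real j / 2 ^ n) \<omega> else 0)"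
    if "\<omega> \<in> space M" for \<omega>
  proof -
    have "(\<Sum>j<k. if j < \<kappa> \<omega> then X (real (Suc j) / 2 ^ n) \<omega> - X (real j / 2 ^ n) \<omega> else 0)
      = (\<Sum>j<min (\<kappa> \<omega>) k. X (real (Suc j) / 2 ^ n) \<omega> - X (real j / 2 ^ n) \<omega>)"
      by (rule sum.mono_neutral_cong_right) auto
    also have "\<dots> = X (real (min (\<kappa> \<omega>) k) / 2 ^ n) \<omega> - X (real 0 / 2 ^ n) \<omega>"
      by (rule sum_lessThan_telescope)
    finally show ?thesis using X_0[OF that] by simp
  qed
  moreover have "(\<lambda>\<omega>. \<Sum>j<k. if j < \<kappa> \<omega> then X (real (Suc j) / 2 ^ n) \<omega> - X (real j / 2 ^ n) \<omega> else 0) \<in> borel_measurable (filt (real k / 2 ^ n))"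
  proof (intro borel_measurable_sum measurable_If borel_measurable_diff X_measurable_filt)
    fix j assume "j \<in> {..<k}"
    then show "{\<omega> \<in> space (filt (real k / 2 ^ n)). j < \<kappa> \<omega>} \<in> sets (filt (real k / 2 ^ n))"
      using grid_timeD[OF assms, of j k] by simp
  qed (auto simp: divide_right_mono)
  ultimately show ?thesis by (subst measurable_cong) auto
qed

lemma grid_time_0: "grid_time n (\<lambda>_. 0)"
  by (simp add: grid_time_def)

text \<open>The exponential of the increment between the two times telescopes over the steps k with
  \<kappa> <= k < \<kappa>'. Each step is a past-measurable factor times exp(i \<theta> D) - 1 with
  D independent of the past, whose mean is exp(\<psi>/2^n) - 1 for every k.\<close>

lemma expectation_telescope:
  fixes \<theta> :: real
  assumes \<kappa>: "grid_time n \<kappa>" and \<kappa>': "grid_time n \<kappa>'"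
    and le: "\<And>\<omega>. \<omega> \<in> space M \<Longrightarrow> \<kappa> \<omega> \<le> \<kappa>' \<omega>" "\<And>\<omega>. \<omega> \<in> space M \<Longrightarrow> \<kappa>' \<omega> \<le> K"
  defines "Z \<equiv> \<lambda>k \<omega>. if \<kappa> \<omega> \<le> k \<and> k < \<kappa>' \<omega> then iexp (\<theta> * (X (real k / 2 ^ n) \<omega> - X (real (\<kappa> \<omega>) / 2 ^ n) \<omega>)) else 0"
  shows "(\<integral>\<omega>. iexp (\<theta> * (X (real (\<kappa>' \<omega>) / 2 ^ n) \<omega> - X (real (\<kappa> \<omega>) / 2 ^ n) \<omega>)) \<partial>M) - 1
     = (exp (\<psi> \<theta> / 2 ^ n) - 1) * (\<Sum>k<K. \<integral>\<omega>. Z k \<omega> \<partial>M)" (is ?eq)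
    and "\<And>k. Z k \<in> borel_measurable M"
proof -
  let ?D = "\<lambda>k \<omega>. X (real (Suc k) / 2 ^ n) \<omega> - X (real k / 2 ^ n) \<omega>"
  have Dm [measurable]: "?D k \<in> borel_measurable M" for k by (intro borel_measurable_diff X_measurable) auto
  have Zf: "Z k \<in> borel_measurable (filt (real k / 2 ^ n))" for k
  proof -
    let ?F = "filt (real k / 2 ^ n)"
    \<comment> \<open>Where \<kappa> <= k, the minimum equals \<kappa>; elsewhere the integrand is
      set to 0. The minimum is what makes the position measurable with respect to the past of
      k/2^n.\<close>
    have [measurable]: "(\<lambda>\<omega>. X (real (min (\<kappa> \<omega>) k) / 2 ^ n) \<omega>) \<in> borel_measurable ?F"
      by (rule stopped_measurable[OF \<kappa>])
    have [measurable]: "X (real k / 2 ^ n) \<in> borel_measurable ?F"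
      by (rule X_measurable_filt) simp
    have "{\<omega> \<in> space ?F. \<kappa> \<omega> \<le> k \<and> k < \<kappa>' \<omega>} = (space ?F - {\<omega> \<in> space M. k < \<kappa> \<omega>}) \<inter> {\<omega> \<in> space M. k < \<kappa>' \<omega>}"
      by auto
    also have "\<dots> \<in> sets ?F"
      by (intro sets.Int sets.compl_sets grid_timeD[OF \<kappa>] grid_timeD[OF \<kappa>'] order_refl)
    finally have S: "{\<omega> \<in> space ?F. \<kappa> \<omega> \<le> k \<and> k < \<kappa>' \<omega>} \<in> sets ?F" .
    have "(\<lambda>\<omega>. iexp (\<theta> * (X (real k / 2 ^ n) \<omega> - X (real (min (\<kappa> \<omega>) k) / 2 ^ n) \<omega>))) \<in> borel_measurable ?F"
      by measurable
    from measurable_If[OF this borel_measurable_const[of "0::complex"] S]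
    have "(\<lambda>\<omega>. if \<kappa> \<omega> \<le> k \<and> k < \<kappa>' \<omega> then iexp (\<theta> * (X (real k / 2 ^ n) \<omega> - X (real (min (\<kappa> \<omega>) k) / 2 ^ n) \<omega>)) else 0) \<in> borel_measurable ?F" .
    also have "(\<lambda>\<omega>. if \<kappa> \<omega> \<le> k \<and> k < \<kappa>' \<omega> then iexp (\<theta> * (X (real k / 2 ^ n) \<omega> - X (real (min (\<kappa> \<omega>) k) / 2 ^ n) \<omega>)) else 0) = Z k"
      by (auto simp: Z_def fun_eq_iff min_def)
    finally show ?thesis .
  qed
  then show Zm: "Z k \<in> borel_measurable M" for k by (rule measurable_filt_M)
  note Zm [measurable]
  have Zb: "norm (Z k \<omega>) \<le> 1" for k \<omega> by (simp add: Z_def)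
  have Zi: "integrable M (Z k)" for k
    using Zb by (intro integrable_const_bound[where B=1] AE_I2) auto
  have [measurable]: "(\<lambda>\<omega>. iexp (\<theta> * ?D k \<omega>)) \<in> borel_measurable M" for k by measurable
  have Ei: "integrable M (\<lambda>\<omega>. Z k \<omega> * iexp (\<theta> * ?D k \<omega>))" for k
  proof (rule integrable_const_bound[where B=1])
    show "(\<lambda>\<omega>. Z k \<omega> * iexp (\<theta> * ?D k \<omega>)) \<in> borel_measurable M" by measurable
  qed (use Zb in \<open>auto simp: norm_mult simp del: of_nat_Suc\<close>)
  have "iexp (\<theta> * (X (real (\<kappa>' \<omega>) / 2 ^ n) \<omega> - X (real (\<kappa> \<omega>) / 2 ^ n) \<omega>)) - 1
    = (\<Sum>k<K. Z k \<omega> * iexp (\<theta> * ?D k \<omega>) - Z k \<omega>)" if \<omega>: "\<omega> \<in> space M" for \<omega>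
  proof -
    let ?e = "\<lambda>k. iexp (\<theta> * (X (real k / 2 ^ n) \<omega> - X (real (\<kappa> \<omega>) / 2 ^ n) \<omega>))"
    have "(\<Sum>k<K. Z k \<omega> * iexp (\<theta> * ?D k \<omega>) - Z k \<omega>) = (\<Sum>k=\<kappa> \<omega>..<\<kappa>' \<omega>. ?e (Suc k) - ?e k)"
    proof (rule sum.mono_neutral_cong_right)
      fix k assume "k \<in> {\<kappa> \<omega>..<\<kappa>' \<omega>}"
      then show "Z k \<omega> * iexp (\<theta> * ?D k \<omega>) - Z k \<omega> = ?e (Suc k) - ?e k"
        by (simp add: Z_def exp_add[symmetric] algebra_simps del: of_nat_Suc)
    qed (use le(2)[OF \<omega>] in \<open>auto simp: Z_def\<close>)
    also have "\<dots> = ?e (\<kappa>' \<omega>) - ?e (\<kappa> \<omega>)"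
      by (rule sum_Suc_diff'[OF le(1)[OF \<omega>]])
    finally show ?thesis by simp
  qed
  note pointwise = this
  have "(\<integral>\<omega>. iexp (\<theta> * (X (real (\<kappa>' \<omega>) / 2 ^ n) \<omega> - X (real (\<kappa> \<omega>) / 2 ^ n) \<omega>)) \<partial>M)
    = (\<integral>\<omega>. 1 + (\<Sum>k<K. Z k \<omega> * iexp (\<theta> * ?D k \<omega>) - Z k \<omega>) \<partial>M)"
    using pointwise by (intro Bochner_Integration.integral_cong refl) (simp add: algebra_simps)
  also have "\<dots> = 1 + (\<Sum>k<K. (\<integral>\<omega>. Z k \<omega> * iexp (\<theta> * ?D k \<omega>) \<partial>M) - (\<integral>\<omega>. Z k \<omega> \<partial>M))"
    using Ei Zi by (subst Bochner_Integration.integral_add) (auto simp: prob_space simp del: of_nat_Suc)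
  also have "\<dots> = 1 + (\<Sum>k<K. (\<integral>\<omega>. Z k \<omega> \<partial>M) * exp (\<psi> \<theta> / 2 ^ n) - (\<integral>\<omega>. Z k \<omega> \<partial>M))"
    using expectation_increment[OF Zf Zb] by (simp del: of_nat_Suc)
  finally show ?eq
    by (simp add: sum_subtractf sum_distrib_right[symmetric] algebra_simps)
qed

section \<open>One-step errors, optional times and their grid approximation\<close>

lemma norm_exp_\<psi>: "norm (exp (\<psi> \<theta> / 2 ^ n) - 1) \<le> norm (\<psi> \<theta>) / 2 ^ n"
proof -
  have "Re (\<psi> \<theta> / 2 ^ n) \<le> 0" using Re_\<psi>[of \<theta>] by (simp add: Re_divide_of_real[of _ "2 ^ n", simplified] divide_nonpos_pos)
  then have "norm (exp (\<psi> \<theta> / 2 ^ n) - 1) \<le> norm (\<psi> \<theta> / 2 ^ n)" by (rule norm_exp_diff_1_halfplane)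
  then show ?thesis by (simp add: norm_divide norm_power)
qed

lemma norm_exp_\<psi>2: "norm (exp (\<psi> \<theta> / 2 ^ n) - 1 - \<psi> \<theta> / 2 ^ n) \<le> (norm (\<psi> \<theta>))\<^sup>2 / 4 ^ n"
proof -
  have "Re (\<psi> \<theta> / 2 ^ n) \<le> 0" using Re_\<psi>[of \<theta>] by (simp add: Re_divide_of_real[of _ "2 ^ n", simplified] divide_nonpos_pos)
  then have "norm (exp (\<psi> \<theta> / 2 ^ n) - 1 - \<psi> \<theta> / 2 ^ n) \<le> (norm (\<psi> \<theta> / 2 ^ n))\<^sup>2" by (rule norm_exp_diff_2_halfplane)
  then show ?thesis by (simp add: norm_divide norm_power power_divide power_mult[symmetric] mult.commute[of _ 2]) (simp add: power_mult)
qed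

text \<open>Optional times with a strict inequality, which is what entry times of open sets satisfy,
  tested at dyadic times only. The deterministic bound L keeps every sum over grid steps
  finite.\<close>

definition opt_time :: "nat \<Rightarrow> ('a \<Rightarrow> real) \<Rightarrow> bool" where
  "opt_time L T \<longleftrightarrow> (\<forall>\<omega>\<in>space M. 0 \<le> T \<omega> \<and> T \<omega> \<le> real L)
    \<and> (\<forall>n k. {\<omega>\<in>space M. T \<omega> < real k / 2 ^ n} \<in> sets (filt (real k / 2 ^ n)))"

text \<open>Index of the first grid point strictly after T, even when T is itself a grid point.
  Strictness has two purposes: k < \<open>grid_ceil\<close> is the complement of T < k/2^n, hence
  known at k/2^n, and the approximating times decrease to T from the right, where paths are
  continuous.\<close>

definition grid_ceil :: "nat \<Rightarrow> ('a \<Rightarrow> real) \<Rightarrow> 'a \<Rightarrow> nat" where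
  "grid_ceil n T \<omega> = nat \<lfloor>2 ^ n * T \<omega>\<rfloor> + 1"

lemma less_grid_ceil: "0 \<le> T \<omega> \<Longrightarrow> k < grid_ceil n T \<omega> \<longleftrightarrow> real k / 2 ^ n \<le> T \<omega>"
  unfolding grid_ceil_def by (simp add: less_Suc_eq_le le_nat_iff le_floor_iff pos_divide_le_eq mult.commute)

lemma grid_ceil_bounds:
  assumes "0 \<le> T \<omega>"
  shows "T \<omega> < real (grid_ceil n T \<omega>) / 2 ^ n" "real (grid_ceil n T \<omega>) / 2 ^ n \<le> T \<omega> + 1 / 2 ^ n"
proof -
  show "T \<omega> < real (grid_ceil n T \<omega>) / 2 ^ n"
    using less_grid_ceil[where T=T and \<omega>=\<omega>, OF assms, of "grid_ceil n T \<omega>" n] by simp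
  have "real (grid_ceil n T \<omega> - 1) / 2 ^ n \<le> T \<omega>"
    using less_grid_ceil[where T=T and \<omega>=\<omega>, OF assms, of "grid_ceil n T \<omega> - 1" n] by (simp add: grid_ceil_def)
  then show "real (grid_ceil n T \<omega>) / 2 ^ n \<le> T \<omega> + 1 / 2 ^ n"
    by (simp add: grid_ceil_def add_divide_distrib)
qed

lemma grid_ceil_le:
  assumes "0 \<le> T \<omega>" "T \<omega> \<le> real L"
  shows "grid_ceil n T \<omega> \<le> 2 ^ n * L + 1"
proof -
  have "real (grid_ceil n T \<omega>) \<le> (T \<omega> + 1 / 2 ^ n) * 2 ^ n"
    using grid_ceil_bounds(2)[of T \<omega> n] assms by (simp add: pos_divide_le_eq)
  also have "\<dots> \<le> (real L + 1 / 2 ^ n) * 2 ^ n"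
    using assms by (intro mult_right_mono) auto
  also have "\<dots> = real (2 ^ n * L + 1)" by (simp add: field_simps)
  finally show ?thesis by (simp only: of_nat_le_iff)
qed

lemma grid_ceil_lim:
  assumes "0 \<le> T \<omega>"
  shows "(\<lambda>n. real (grid_ceil n T \<omega>) / 2 ^ n) \<longlonglongrightarrow> T \<omega>"
proof (rule tendsto_sandwich[where f="\<lambda>_. T \<omega>" and h="\<lambda>n. T \<omega> + 1 / 2 ^ n"])
  have "(\<lambda>n. T \<omega> + (1 / 2) ^ n) \<longlonglongrightarrow> T \<omega> + 0"
    by (intro tendsto_intros LIMSEQ_power_zero) auto
  then show "(\<lambda>n. T \<omega> + 1 / 2 ^ n) \<longlonglongrightarrow> T \<omega>" by (simp add: power_divide)
  show "\<forall>\<^sub>F n in sequentially. T \<omega> \<le> real (grid_ceil n T \<omega>) / 2 ^ n"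
    by (intro always_eventually allI less_imp_le grid_ceil_bounds(1)[where T=T, OF assms])
  show "\<forall>\<^sub>F n in sequentially. real (grid_ceil n T \<omega>) / 2 ^ n \<le> T \<omega> + 1 / 2 ^ n"
    by (intro always_eventually allI grid_ceil_bounds(2)[where T=T, OF assms])
qed simp

lemma X_grid_ceil_lim:
  assumes "0 \<le> T \<omega>" "\<omega> \<in> space M"
  shows "(\<lambda>n. X (real (grid_ceil n T \<omega>) / 2 ^ n) \<omega>) \<longlonglongrightarrow> X (T \<omega>) \<omega>"
  by (rule X_right_lim[OF assms(2,1) grid_ceil_bounds(1)[where T=T, OF assms(1)] grid_ceil_lim[where T=T, OF assms(1)]])

lemma grid_time_ceil:
  assumes "opt_time L T"
  shows "grid_time n (grid_ceil n T)"
  unfolding grid_time_def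
proof
  fix k
  have "{\<omega>\<in>space M. k < grid_ceil n T \<omega>} = space (filt (real k / 2 ^ n)) - {\<omega>\<in>space M. T \<omega> < real k / 2 ^ n}"
    using assms by (auto simp: opt_time_def less_grid_ceil not_less)
  also have "\<dots> \<in> sets (filt (real k / 2 ^ n))"
    using assms by (intro sets.compl_sets) (auto simp: opt_time_def)
  finally show "{\<omega>\<in>space M. k < grid_ceil n T \<omega>} \<in> sets (filt (real k / 2 ^ n))" .
qed

lemma X_grid_measurable:
  assumes "opt_time L T"
  shows "(\<lambda>\<omega>. X (real (grid_ceil n T \<omega>) / 2 ^ n) \<omega>) \<in> borel_measurable M"
proof -
  have "(\<lambda>\<omega>. X (real (min (grid_ceil n T \<omega>) (2 ^ n * L + 1)) / 2 ^ n) \<omega>) \<in> borel_measurable M"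
    by (rule measurable_filt_M[OF stopped_measurable[OF grid_time_ceil[OF assms]]])
  moreover have "min (grid_ceil n T \<omega>) (2 ^ n * L + 1) = grid_ceil n T \<omega>" if "\<omega> \<in> space M" for \<omega>
    using grid_ceil_le[of T \<omega> L n] that assms by (auto simp: opt_time_def min_def)
  ultimately show ?thesis by (subst measurable_cong) (auto simp del: min.commute)
qed

lemma X_opt_measurable:
  assumes "opt_time L T"
  shows "(\<lambda>\<omega>. X (T \<omega>) \<omega>) \<in> borel_measurable M"
proof (rule borel_measurable_LIMSEQ_metric[OF X_grid_measurable[OF assms]])
  show "(\<lambda>n. X (real (grid_ceil n T \<omega>) / 2 ^ n) \<omega>) \<longlonglongrightarrow> X (T \<omega>) \<omega>" if "\<omega> \<in> space M" for \<omega>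
    using that assms by (intro X_grid_ceil_lim) (auto simp: opt_time_def)
qed

lemma opt_time_measurable:
  assumes "opt_time L T"
  shows "T \<in> borel_measurable M"
proof (rule borel_measurable_LIMSEQ_metric)
  fix n
  have "real (grid_ceil n T \<omega>) = (\<Sum>k<2 ^ n * L + 1. indicator {\<omega>\<in>space M. k < grid_ceil n T \<omega>} \<omega>)" if "\<omega> \<in> space M" for \<omega>
  proof -
    have "(\<Sum>k<2 ^ n * L + 1. indicator {\<omega>\<in>space M. k < grid_ceil n T \<omega>} \<omega>) = (\<Sum>k<grid_ceil n T \<omega>. 1::real)"
      using grid_ceil_le[of T \<omega> L n] that assms
      by (intro sum.mono_neutral_cong_right) (auto simp: opt_time_def indicator_def)
    then show ?thesis by simp
  qed
  moreover have "{\<omega>\<in>space M. k < grid_ceil n T \<omega>} \<in> sets M" for k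
    using grid_timeD[OF grid_time_ceil[OF assms], of k k] filt_subset by auto
  ultimately show "(\<lambda>\<omega>. real (grid_ceil n T \<omega>) / 2 ^ n) \<in> borel_measurable M"
    by (subst measurable_cong[where g="\<lambda>\<omega>. (\<Sum>k<2 ^ n * L + 1. indicator {\<omega>\<in>space M. k < grid_ceil n T \<omega>} \<omega>) / 2 ^ n"]) auto
  show "(\<lambda>n. real (grid_ceil n T \<omega>) / 2 ^ n) \<longlonglongrightarrow> T \<omega>" if "\<omega> \<in> space M" for \<omega>
    using that assms by (intro grid_ceil_lim) (auto simp: opt_time_def)
qed

text \<open>On the grid there are at most 2^n (T - S) + 1 steps, each contributing at most
  |\<psi>|/2^n. Right-continuity transfers the bound to S and T; it is the quantitative form of
  quasi-left-continuity.\<close>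

lemma opt_time_increment_char:
  assumes S: "opt_time L S" and T: "opt_time L T" and le: "\<And>\<omega>. \<omega> \<in> space M \<Longrightarrow> S \<omega> \<le> T \<omega>"
  shows "norm ((\<integral>\<omega>. iexp (\<theta> * (X (T \<omega>) \<omega> - X (S \<omega>) \<omega>)) \<partial>M) - 1) \<le> norm (\<psi> \<theta>) * (\<integral>\<omega>. T \<omega> - S \<omega> \<partial>M)"
proof -
  have S0: "0 \<le> S \<omega>" "S \<omega> \<le> L" and T0: "0 \<le> T \<omega>" "T \<omega> \<le> L" if "\<omega> \<in> space M" for \<omega>
    using S T that by (auto simp: opt_time_def)
  note [measurable] = X_grid_measurable[OF S] X_grid_measurable[OF T] X_opt_measurable[OF S] X_opt_measurable[OF T]
    opt_time_measurable[OF S] opt_time_measurable[OF T]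
  let ?k = "\<lambda>n. grid_ceil n S" and ?k' = "\<lambda>n. grid_ceil n T"
  have lek: "?k n \<omega> \<le> ?k' n \<omega>" if "\<omega> \<in> space M" for n \<omega>
  proof -
    have "2 ^ n * S \<omega> \<le> 2 ^ n * T \<omega>" using le[OF that] by simp
    then show ?thesis unfolding grid_ceil_def by (intro add_right_mono nat_mono floor_mono)
  qed
  have TSi: "integrable M (\<lambda>\<omega>. T \<omega> - S \<omega>)"
    by (intro integrable_const_bound[where B="real L"] AE_I2) (use S0 T0 le in force)+
  have step: "norm ((\<integral>\<omega>. iexp (\<theta> * (X (real (?k' n \<omega>) / 2 ^ n) \<omega> - X (real (?k n \<omega>) / 2 ^ n) \<omega>)) \<partial>M) - 1)
      \<le> norm (\<psi> \<theta>) * ((\<integral>\<omega>. T \<omega> - S \<omega> \<partial>M) + 1 / 2 ^ n)" for n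
  proof -
    define K where "K = 2 ^ n * L + 1"
    define Z where "Z = (\<lambda>k \<omega>. if ?k n \<omega> \<le> k \<and> k < ?k' n \<omega> then iexp (\<theta> * (X (real k / 2 ^ n) \<omega> - X (real (?k n \<omega>) / 2 ^ n) \<omega>)) else 0)"
    have K: "?k' n \<omega> \<le> K" if "\<omega> \<in> space M" for \<omega>
      unfolding K_def by (rule grid_ceil_le[where T=T, OF T0[OF that]])
    have tel: "(\<integral>\<omega>. iexp (\<theta> * (X (real (?k' n \<omega>) / 2 ^ n) \<omega> - X (real (?k n \<omega>) / 2 ^ n) \<omega>)) \<partial>M) - 1
        = (exp (\<psi> \<theta> / 2 ^ n) - 1) * (\<Sum>k<K. \<integral>\<omega>. Z k \<omega> \<partial>M)" "Z k \<in> borel_measurable M" for k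
      unfolding Z_def by (rule expectation_telescope[OF grid_time_ceil[OF S] grid_time_ceil[OF T] lek K]; assumption)+
    have Zi: "integrable M (\<lambda>\<omega>. norm (Z k \<omega>))" for k
      using tel(2)[of k] by (intro integrable_const_bound[where B=1] AE_I2) (auto simp: Z_def)
    have "norm (\<Sum>k<K. \<integral>\<omega>. Z k \<omega> \<partial>M) \<le> (\<Sum>k<K. \<integral>\<omega>. norm (Z k \<omega>) \<partial>M)"
      by (intro order_trans[OF norm_sum] sum_mono integral_norm_bound)
    also have "\<dots> = (\<integral>\<omega>. (\<Sum>k<K. norm (Z k \<omega>)) \<partial>M)"
      using Zi by simp
    also have "\<dots> \<le> (\<integral>\<omega>. 2 ^ n * (T \<omega> - S \<omega>) + 1 \<partial>M)"
    proof (rule integral_mono)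
      fix \<omega> assume \<omega>: "\<omega> \<in> space M"
      have "(\<Sum>k<K. norm (Z k \<omega>)) = (\<Sum>k=?k n \<omega>..<?k' n \<omega>. 1)"
        using K[OF \<omega>] by (intro sum.mono_neutral_cong_right) (auto simp: Z_def)
      also have "\<dots> = real (?k' n \<omega>) - real (?k n \<omega>)" using lek[OF \<omega>] by (simp add: of_nat_diff)
      also have "\<dots> \<le> (T \<omega> + 1 / 2 ^ n) * 2 ^ n - S \<omega> * 2 ^ n"
        using grid_ceil_bounds(2)[of T \<omega> n] grid_ceil_bounds(1)[of S \<omega> n] T0[OF \<omega>] S0[OF \<omega>]
        by (intro diff_mono) (simp_all add: pos_divide_le_eq pos_less_divide_eq)
      also have "\<dots> = 2 ^ n * (T \<omega> - S \<omega>) + 1" by (simp add: field_simps)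
      finally show "(\<Sum>k<K. norm (Z k \<omega>)) \<le> 2 ^ n * (T \<omega> - S \<omega>) + 1" .
    qed (use Zi TSi in auto)
    also have "\<dots> = 2 ^ n * (\<integral>\<omega>. T \<omega> - S \<omega> \<partial>M) + 1"
      using TSi by (simp add: prob_space)
    finally have "norm (exp (\<psi> \<theta> / 2 ^ n) - 1) * norm (\<Sum>k<K. \<integral>\<omega>. Z k \<omega> \<partial>M) \<le> (norm (\<psi> \<theta>) / 2 ^ n) * (2 ^ n * (\<integral>\<omega>. T \<omega> - S \<omega> \<partial>M) + 1)"
      by (intro mult_mono norm_exp_\<psi>) auto
    also have "(norm (\<psi> \<theta>) / 2 ^ n) * (2 ^ n * (\<integral>\<omega>. T \<omega> - S \<omega> \<partial>M) + 1) = norm (\<psi> \<theta>) * ((\<integral>\<omega>. T \<omega> - S \<omega> \<partial>M) + 1 / 2 ^ n)"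
      by (simp add: field_simps)
    finally show ?thesis unfolding tel(1) norm_mult .
  qed
  have "(\<lambda>n. norm ((\<integral>\<omega>. iexp (\<theta> * (X (real (?k' n \<omega>) / 2 ^ n) \<omega> - X (real (?k n \<omega>) / 2 ^ n) \<omega>)) \<partial>M) - 1))
    \<longlonglongrightarrow> norm ((\<integral>\<omega>. iexp (\<theta> * (X (T \<omega>) \<omega> - X (S \<omega>) \<omega>)) \<partial>M) - 1)"
  proof (intro tendsto_intros integral_dominated_convergence[where w="\<lambda>_. 1"])
    show "AE \<omega> in M. (\<lambda>n. iexp (\<theta> * (X (real (?k' n \<omega>) / 2 ^ n) \<omega> - X (real (?k n \<omega>) / 2 ^ n) \<omega>)))
       \<longlonglongrightarrow> iexp (\<theta> * (X (T \<omega>) \<omega> - X (S \<omega>) \<omega>))"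
      by (intro AE_I2 tendsto_intros X_grid_ceil_lim S0 T0)
  qed auto
  moreover have "(\<lambda>n. norm (\<psi> \<theta>) * ((\<integral>\<omega>. T \<omega> - S \<omega> \<partial>M) + (1 / 2) ^ n)) \<longlonglongrightarrow> norm (\<psi> \<theta>) * ((\<integral>\<omega>. T \<omega> - S \<omega> \<partial>M) + 0)"
    by (intro tendsto_intros LIMSEQ_power_zero) auto
  ultimately have "norm ((\<integral>\<omega>. iexp (\<theta> * (X (T \<omega>) \<omega> - X (S \<omega>) \<omega>)) \<partial>M) - 1) \<le> norm (\<psi> \<theta>) * ((\<integral>\<omega>. T \<omega> - S \<omega> \<partial>M) + 0)"
    by (rule LIMSEQ_le) (use step in \<open>auto simp: power_divide\<close>)
  then show ?thesis by simp
qed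

end

section \<open>Dynkin's formula\<close>

lemma fourier_integral_continuous:
  fixes F :: "real \<Rightarrow> complex"
  assumes F: "integrable lborel F" and u: "u \<longlonglongrightarrow> y"
  shows "(\<lambda>n. \<integral>\<theta>. F \<theta> * iexp (\<theta> * u n) \<partial>lborel) \<longlonglongrightarrow> (\<integral>\<theta>. F \<theta> * iexp (\<theta> * y) \<partial>lborel)"
proof (rule integral_dominated_convergence[where w="\<lambda>\<theta>. norm (F \<theta>)"])
  show "AE \<theta> in lborel. (\<lambda>n. F \<theta> * iexp (\<theta> * u n)) \<longlonglongrightarrow> F \<theta> * iexp (\<theta> * y)"
    by (intro AE_I2 tendsto_intros u)
qed (use F in \<open>auto simp: norm_mult\<close>)

lemma fourier_integral_bound:
  fixes F :: "real \<Rightarrow> complex"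
  shows "norm (\<integral>\<theta>. F \<theta> * iexp (\<theta> * y) \<partial>lborel) \<le> (\<integral>\<theta>. norm (F \<theta>) \<partial>lborel)"
  using integral_norm_bound[of lborel "\<lambda>\<theta>. F \<theta> * iexp (\<theta> * y)"] by (simp add: norm_mult)

lemma fourier_integrable:
  fixes F :: "real \<Rightarrow> complex"
  assumes F: "integrable lborel F"
  shows "integrable lborel (\<lambda>\<theta>. F \<theta> * iexp (\<theta> * y))"
proof (rule Bochner_Integration.integrable_bound[OF F])
  have [measurable]: "F \<in> borel_measurable borel" using F by auto
  show "(\<lambda>\<theta>. F \<theta> * iexp (\<theta> * y)) \<in> borel_measurable lborel" by measurable
qed (auto simp: norm_mult)

lemma fourier_measurable [measurable]:
  fixes F :: "real \<Rightarrow> complex"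
  assumes [measurable]: "F \<in> borel_measurable borel"
  shows "(\<lambda>y. \<integral>\<theta>. F \<theta> * iexp (\<theta> * y) \<partial>lborel) \<in> borel_measurable borel"
  by measurable

text \<open>Exchange of expectation and Fourier integral; it turns statements about characteristic
  functions into statements about functions with an integrable frequency density.\<close>

lemma (in prob_space) fourier_expectation:
  fixes F :: "real \<Rightarrow> complex"
  assumes F: "integrable lborel F" and Z [measurable]: "Z \<in> borel_measurable M" and Zb: "\<And>\<omega>. \<omega> \<in> space M \<Longrightarrow> norm (Z \<omega>) \<le> 1"
    and Y [measurable]: "Y \<in> borel_measurable M"
  shows "(\<integral>\<omega>. Z \<omega> * (\<integral>\<theta>. F \<theta> * iexp (\<theta> * Y \<omega>) \<partial>lborel) \<partial>M) = (\<integral>\<theta>. F \<theta> * (\<integral>\<omega>. Z \<omega> * iexp (\<theta> * Y \<omega>) \<partial>M) \<partial>lborel)"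
    and "integrable lborel (\<lambda>\<theta>. F \<theta> * (\<integral>\<omega>. Z \<omega> * iexp (\<theta> * Y \<omega>) \<partial>M))"
proof -
  interpret pair_sigma_finite lborel M ..
  have [measurable]: "F \<in> borel_measurable borel" using F by auto
  have I: "integrable (lborel \<Otimes>\<^sub>M M) (\<lambda>(\<theta>, \<omega>). F \<theta> * (Z \<omega> * iexp (\<theta> * Y \<omega>)))"
  proof (rule Fubini_integrable)
    show "(\<lambda>(\<theta>, \<omega>). F \<theta> * (Z \<omega> * iexp (\<theta> * Y \<omega>))) \<in> borel_measurable (lborel \<Otimes>\<^sub>M M)"
      by measurable
    have Zi: "integrable M (\<lambda>\<omega>. norm (Z \<omega>))" using Zb by (intro integrable_const_bound[where B=1] AE_I2) auto
    have "integrable lborel (\<lambda>\<theta>. norm (F \<theta>) * (\<integral>\<omega>. norm (Z \<omega>) \<partial>M))"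
      using F by auto
    then show "integrable lborel (\<lambda>\<theta>. \<integral>\<omega>. norm (case (\<theta>, \<omega>) of (\<theta>, \<omega>) \<Rightarrow> F \<theta> * (Z \<omega> * iexp (\<theta> * Y \<omega>))) \<partial>M)"
      by (simp add: norm_mult)
    show "AE \<theta> in lborel. integrable M (\<lambda>\<omega>. case (\<theta>, \<omega>) of (\<theta>, \<omega>) \<Rightarrow> F \<theta> * (Z \<omega> * iexp (\<theta> * Y \<omega>)))"
    proof (intro AE_I2)
      fix \<theta>
      have "integrable M (\<lambda>\<omega>. Z \<omega> * iexp (\<theta> * Y \<omega>))"
        by (rule Bochner_Integration.integrable_bound[OF Zi]) (auto simp: norm_mult)
      then show "integrable M (\<lambda>\<omega>. case (\<theta>, \<omega>) of (\<theta>, \<omega>) \<Rightarrow> F \<theta> * (Z \<omega> * iexp (\<theta> * Y \<omega>)))" by simp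
    qed
  qed
  have L: "Z \<omega> * (\<integral>\<theta>. F \<theta> * iexp (\<theta> * Y \<omega>) \<partial>lborel) = (\<integral>\<theta>. F \<theta> * (Z \<omega> * iexp (\<theta> * Y \<omega>)) \<partial>lborel)" for \<omega>
    unfolding integral_mult_right_zero[symmetric] by (simp only: mult.left_commute)
  have "(\<integral>\<omega>. (\<integral>\<theta>. F \<theta> * (Z \<omega> * iexp (\<theta> * Y \<omega>)) \<partial>lborel) \<partial>M) = (\<integral>\<theta>. (\<integral>\<omega>. F \<theta> * (Z \<omega> * iexp (\<theta> * Y \<omega>)) \<partial>M) \<partial>lborel)"
    by (rule Fubini_integral) (use I in simp)
  then show "(\<integral>\<omega>. Z \<omega> * (\<integral>\<theta>. F \<theta> * iexp (\<theta> * Y \<omega>) \<partial>lborel) \<partial>M) = (\<integral>\<theta>. F \<theta> * (\<integral>\<omega>. Z \<omega> * iexp (\<theta> * Y \<omega>) \<partial>M) \<partial>lborel)"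
    unfolding L by (simp only: integral_mult_right_zero)
  show "integrable lborel (\<lambda>\<theta>. F \<theta> * (\<integral>\<omega>. Z \<omega> * iexp (\<theta> * Y \<omega>) \<partial>M))"
    using integrable_fst[OF I] by simp
qed

context levy_motion
begin

lemma iexp_shift: "iexp (\<theta> * (x + y)) = iexp (\<theta> * x) * iexp (\<theta> * y)"
  by (simp add: exp_add[symmetric] algebra_simps)

text \<open>The telescoping identity for exponentials is integrated against F. The function D has
  multiplier exp(\<psi>/2^n) - 1, so it is the mean change of f over one grid step.\<close>

lemma dynkin_grid:
  fixes F :: "real \<Rightarrow> complex" and n :: nat and x :: real
  assumes T: "opt_time L T" and F: "integrable lborel F"
  defines "f \<equiv> \<lambda>y. \<integral>\<theta>. F \<theta> * iexp (\<theta> * y) \<partial>lborel"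
    and "D \<equiv> \<lambda>y. \<integral>\<theta>. F \<theta> * (exp (\<psi> \<theta> / 2 ^ n) - 1) * iexp (\<theta> * y) \<partial>lborel"
  shows "(\<integral>\<omega>. f (x + X (real (grid_ceil n T \<omega>) / 2 ^ n) \<omega>) \<partial>M) - f x
    = (\<Sum>k<2 ^ n * L + 1. \<integral>\<omega>. (if k < grid_ceil n T \<omega> then D (x + X (real k / 2 ^ n) \<omega>) else 0) \<partial>M)"
proof -
  define K where "K = 2 ^ n * L + 1"
  let ?\<kappa> = "grid_ceil n T"
  have T0: "0 \<le> T \<omega>" "T \<omega> \<le> real L" if "\<omega> \<in> space M" for \<omega> using T that by (auto simp: opt_time_def)
  have K: "?\<kappa> \<omega> \<le> K" if "\<omega> \<in> space M" for \<omega>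
    unfolding K_def by (rule grid_ceil_le[where T=T, OF T0[OF that]])
  note [measurable] = X_grid_measurable[OF T]
  have Xm [measurable]: "X (real k / 2 ^ n) \<in> borel_measurable M" for k by (rule X_measurable) simp
  have [measurable]: "F \<in> borel_measurable borel" using F by auto
  have Sm [measurable]: "{\<omega>\<in>space M. k < ?\<kappa> \<omega>} \<in> sets M" for k
    using grid_timeD[OF grid_time_ceil[OF T], of k k] filt_subset by auto
  define Z where "Z = (\<lambda>k \<omega>. indicator {\<omega>\<in>space M. k < ?\<kappa> \<omega>} \<omega> :: complex)"
  have Zm [measurable]: "Z k \<in> borel_measurable M" for k unfolding Z_def by measurable
  have Zb: "norm (Z k \<omega>) \<le> 1" for k \<omega> by (simp add: Z_def indicator_def)
  have tel: "(\<integral>\<omega>. iexp (\<theta> * X (real (?\<kappa> \<omega>) / 2 ^ n) \<omega>) \<partial>M) - 1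
     = (exp (\<psi> \<theta> / 2 ^ n) - 1) * (\<Sum>k<K. \<integral>\<omega>. Z k \<omega> * iexp (\<theta> * X (real k / 2 ^ n) \<omega>) \<partial>M)" for \<theta>
  proof -
    have "(\<integral>\<omega>. iexp (\<theta> * (X (real (?\<kappa> \<omega>) / 2 ^ n) \<omega> - X (real 0 / 2 ^ n) \<omega>)) \<partial>M) - 1
     = (exp (\<psi> \<theta> / 2 ^ n) - 1) * (\<Sum>k<K. \<integral>\<omega>. (if 0 \<le> k \<and> k < ?\<kappa> \<omega> then iexp (\<theta> * (X (real k / 2 ^ n) \<omega> - X (real 0 / 2 ^ n) \<omega>)) else 0) \<partial>M)"
      by (rule expectation_telescope(1)[OF grid_time_0 grid_time_ceil[OF T] _ K]) auto
    moreover have "(\<integral>\<omega>. iexp (\<theta> * (X (real (?\<kappa> \<omega>) / 2 ^ n) \<omega> - X (real 0 / 2 ^ n) \<omega>)) \<partial>M) = (\<integral>\<omega>. iexp (\<theta> * X (real (?\<kappa> \<omega>) / 2 ^ n) \<omega>) \<partial>M)"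
      by (intro Bochner_Integration.integral_cong refl) (simp add: X_0)
    moreover have "(\<integral>\<omega>. (if 0 \<le> k \<and> k < ?\<kappa> \<omega> then iexp (\<theta> * (X (real k / 2 ^ n) \<omega> - X (real 0 / 2 ^ n) \<omega>)) else 0) \<partial>M)
      = (\<integral>\<omega>. Z k \<omega> * iexp (\<theta> * X (real k / 2 ^ n) \<omega>) \<partial>M)" for k
      by (intro Bochner_Integration.integral_cong refl) (simp add: X_0 Z_def)
    ultimately show ?thesis by (simp only:)
  qed
  have Fx: "integrable lborel (\<lambda>\<theta>. F \<theta> * iexp (\<theta> * x))" by (rule fourier_integrable[OF F])
  have Fe: "integrable lborel (\<lambda>\<theta>. F \<theta> * (exp (\<psi> \<theta> / 2 ^ n) - 1))"
  proof (rule Bochner_Integration.integrable_bound[where f="\<lambda>\<theta>. F \<theta> * 2"])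
    show "AE \<theta> in lborel. norm (F \<theta> * (exp (\<psi> \<theta> / 2 ^ n) - 1)) \<le> norm (F \<theta> * 2)"
    proof (intro AE_I2)
      fix \<theta>
      have "norm (exp (\<psi> \<theta> / 2 ^ n) - 1) \<le> norm (exp (\<psi> \<theta> / 2 ^ n)) + norm (1::complex)" by (rule norm_triangle_ineq4)
      also have "\<dots> \<le> 2" using Re_\<psi>[of \<theta>] by (simp add: norm_exp Re_divide_of_real[of _ "2 ^ n", simplified] divide_nonpos_pos)
      finally show "norm (F \<theta> * (exp (\<psi> \<theta> / 2 ^ n) - 1)) \<le> norm (F \<theta> * 2)" by (simp add: norm_mult mult_left_mono)
    qed
  qed (use F in auto)
  have Fxe: "integrable lborel (\<lambda>\<theta>. (F \<theta> * (exp (\<psi> \<theta> / 2 ^ n) - 1)) * iexp (\<theta> * x))"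
    by (rule fourier_integrable[OF Fe])
  have "(\<integral>\<omega>. f (x + X (real (?\<kappa> \<omega>) / 2 ^ n) \<omega>) \<partial>M) = (\<integral>\<omega>. 1 * (\<integral>\<theta>. (F \<theta> * iexp (\<theta> * x)) * iexp (\<theta> * X (real (?\<kappa> \<omega>) / 2 ^ n) \<omega>) \<partial>lborel) \<partial>M)"
    unfolding f_def iexp_shift by (simp add: mult.assoc)
  also have "\<dots> = (\<integral>\<theta>. (F \<theta> * iexp (\<theta> * x)) * (\<integral>\<omega>. 1 * iexp (\<theta> * X (real (?\<kappa> \<omega>) / 2 ^ n) \<omega>) \<partial>M) \<partial>lborel)"
    by (rule fourier_expectation(1)[OF Fx]) auto
  finally have A: "(\<integral>\<omega>. f (x + X (real (?\<kappa> \<omega>) / 2 ^ n) \<omega>) \<partial>M) = (\<integral>\<theta>. (F \<theta> * iexp (\<theta> * x)) * (\<integral>\<omega>. iexp (\<theta> * X (real (?\<kappa> \<omega>) / 2 ^ n) \<omega>) \<partial>M) \<partial>lborel)"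
    by simp
  have Ai: "integrable lborel (\<lambda>\<theta>. (F \<theta> * iexp (\<theta> * x)) * (\<integral>\<omega>. iexp (\<theta> * X (real (?\<kappa> \<omega>) / 2 ^ n) \<omega>) \<partial>M))"
    using fourier_expectation(2)[OF Fx, of "\<lambda>_. 1" "\<lambda>\<omega>. X (real (?\<kappa> \<omega>) / 2 ^ n) \<omega>"] by simp
  have "(\<integral>\<omega>. f (x + X (real (?\<kappa> \<omega>) / 2 ^ n) \<omega>) \<partial>M) - f x
    = (\<integral>\<theta>. (F \<theta> * iexp (\<theta> * x)) * (\<integral>\<omega>. iexp (\<theta> * X (real (?\<kappa> \<omega>) / 2 ^ n) \<omega>) \<partial>M) - F \<theta> * iexp (\<theta> * x) \<partial>lborel)"
    unfolding A unfolding f_def by (rule Bochner_Integration.integral_diff[symmetric, OF Ai Fx])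
  also have "\<dots> = (\<integral>\<theta>. (F \<theta> * iexp (\<theta> * x)) * ((\<integral>\<omega>. iexp (\<theta> * X (real (?\<kappa> \<omega>) / 2 ^ n) \<omega>) \<partial>M) - 1) \<partial>lborel)"
    by (simp only: right_diff_distrib mult_1_right)
  also have "\<dots> = (\<integral>\<theta>. (\<Sum>k<K. ((F \<theta> * (exp (\<psi> \<theta> / 2 ^ n) - 1)) * iexp (\<theta> * x)) * (\<integral>\<omega>. Z k \<omega> * iexp (\<theta> * X (real k / 2 ^ n) \<omega>) \<partial>M)) \<partial>lborel)"
    unfolding tel sum_distrib_left by (intro Bochner_Integration.integral_cong refl sum.cong) (simp only: mult_ac)
  also have "\<dots> = (\<Sum>k<K. \<integral>\<theta>. ((F \<theta> * (exp (\<psi> \<theta> / 2 ^ n) - 1)) * iexp (\<theta> * x)) * (\<integral>\<omega>. Z k \<omega> * iexp (\<theta> * X (real k / 2 ^ n) \<omega>) \<partial>M) \<partial>lborel)"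
    by (intro Bochner_Integration.integral_sum fourier_expectation(2)[OF Fxe] Zm Xm Zb)
  also have "\<dots> = (\<Sum>k<K. \<integral>\<omega>. Z k \<omega> * (\<integral>\<theta>. ((F \<theta> * (exp (\<psi> \<theta> / 2 ^ n) - 1)) * iexp (\<theta> * x)) * iexp (\<theta> * X (real k / 2 ^ n) \<omega>) \<partial>lborel) \<partial>M)"
    by (intro sum.cong refl fourier_expectation(1)[OF Fxe, symmetric] Zm Xm Zb)
  also have "\<dots> = (\<Sum>k<K. \<integral>\<omega>. (if k < grid_ceil n T \<omega> then D (x + X (real k / 2 ^ n) \<omega>) else 0) \<partial>M)"
    unfolding D_def iexp_shift
    by (intro sum.cong Bochner_Integration.integral_cong refl) (simp add: Z_def mult.assoc)
  finally show ?thesis unfolding K_def .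
qed

text \<open>There are about 2^n L steps, and the mean change over one step is the generator divided
  by 2^n up to C/4^n. The generator is at most \<epsilon> as long as the path stays in D, so the
  total change tends to at most L \<epsilon>.\<close>

lemma dynkin_bound:
  fixes F :: "real \<Rightarrow> complex" and x :: real
  assumes T: "opt_time L T" and F: "integrable lborel F"
    and F1: "integrable lborel (\<lambda>\<theta>. F \<theta> * \<psi> \<theta>)" and F2: "integrable lborel (\<lambda>\<theta>. norm (F \<theta>) * (norm (\<psi> \<theta>))\<^sup>2)"
    and g: "\<And>y. y \<in> D \<Longrightarrow> norm (\<integral>\<theta>. F \<theta> * \<psi> \<theta> * iexp (\<theta> * y) \<partial>lborel) \<le> \<epsilon>"
    and D: "\<And>\<omega> s. \<omega> \<in> space M \<Longrightarrow> 0 \<le> s \<Longrightarrow> s < T \<omega> \<Longrightarrow> x + X s \<omega> \<in> D"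
    and \<epsilon>: "0 \<le> \<epsilon>"
  defines "f \<equiv> \<lambda>y. \<integral>\<theta>. F \<theta> * iexp (\<theta> * y) \<partial>lborel"
  shows "norm ((\<integral>\<omega>. f (x + X (T \<omega>) \<omega>) \<partial>M) - f x) \<le> real L * \<epsilon>"
proof -
  have T0: "0 \<le> T \<omega>" "T \<omega> \<le> real L" if "\<omega> \<in> space M" for \<omega> using T that by (auto simp: opt_time_def)
  note [measurable] = X_grid_measurable[OF T] X_opt_measurable[OF T]
  have [measurable]: "F \<in> borel_measurable borel" using F by auto
  have fm [measurable]: "f \<in> borel_measurable borel" unfolding f_def by measurable
  define C where "C = (\<integral>\<theta>. norm (F \<theta>) * (norm (\<psi> \<theta>))\<^sup>2 \<partial>lborel)"
  define G where "G = (\<integral>\<theta>. norm (F \<theta> * \<psi> \<theta>) \<partial>lborel)"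
  have C0: "0 \<le> C" "0 \<le> G" unfolding C_def G_def by (auto intro!: integral_nonneg_AE)
  define Dn where "Dn = (\<lambda>n y. \<integral>\<theta>. F \<theta> * (exp (\<psi> \<theta> / 2 ^ n) - 1) * iexp (\<theta> * y) \<partial>lborel)"
  define gg where "gg = (\<lambda>y. \<integral>\<theta>. F \<theta> * \<psi> \<theta> * iexp (\<theta> * y) \<partial>lborel)"
  have Dm [measurable]: "Dn n \<in> borel_measurable borel" for n
    unfolding Dn_def by measurable
  have gG: "norm (gg y) \<le> G" for y unfolding gg_def G_def by (rule fourier_integral_bound)
  \<comment> \<open>Second-order expansion of exp(\<psi>/2^n) - 1 under the Fourier integral;
    integrability of |F| |\<psi>|^2 makes the remainder uniform in y.\<close>
  have diff: "norm (Dn n y) \<le> norm (gg y) / 2 ^ n + C / 4 ^ n" for n y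
  proof -
    let ?r = "\<lambda>\<theta>. F \<theta> * (exp (\<psi> \<theta> / 2 ^ n) - 1 - \<psi> \<theta> / 2 ^ n)"
    have b: "norm (?r \<theta>) \<le> norm (F \<theta>) * (norm (\<psi> \<theta>))\<^sup>2 / 4 ^ n" for \<theta>
      using mult_left_mono[OF norm_exp_\<psi>2[of \<theta> n], of "norm (F \<theta>)"] by (simp add: norm_mult)
    have F2': "integrable lborel (\<lambda>\<theta>. norm (F \<theta>) * (norm (\<psi> \<theta>))\<^sup>2 / 4 ^ n)" using F2 by simp
    have ri: "integrable lborel ?r"
      by (rule Bochner_Integration.integrable_bound[OF F2']) (use b in \<open>auto intro!: AE_I2\<close>)
    have "Dn n y = (\<integral>\<theta>. ?r \<theta> * iexp (\<theta> * y) + (F \<theta> * \<psi> \<theta>) * iexp (\<theta> * y) / 2 ^ n \<partial>lborel)"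
      unfolding Dn_def by (intro Bochner_Integration.integral_cong refl) (simp add: algebra_simps)
    also have "\<dots> = (\<integral>\<theta>. ?r \<theta> * iexp (\<theta> * y) \<partial>lborel) + (\<integral>\<theta>. (F \<theta> * \<psi> \<theta>) * iexp (\<theta> * y) / 2 ^ n \<partial>lborel)"
      by (intro Bochner_Integration.integral_add fourier_integrable[OF ri] integrable_divide fourier_integrable[OF F1])
    finally have e: "Dn n y = (\<integral>\<theta>. ?r \<theta> * iexp (\<theta> * y) \<partial>lborel) + gg y / 2 ^ n"
      by (simp add: gg_def)
    have "norm (\<integral>\<theta>. ?r \<theta> * iexp (\<theta> * y) \<partial>lborel) \<le> (\<integral>\<theta>. norm (?r \<theta>) \<partial>lborel)" by (rule fourier_integral_bound)
    also have "\<dots> \<le> (\<integral>\<theta>. norm (F \<theta>) * (norm (\<psi> \<theta>))\<^sup>2 / 4 ^ n \<partial>lborel)"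
      by (rule integral_mono[OF integrable_norm[OF ri] F2' b])
    also have "\<dots> = C / 4 ^ n" by (simp add: C_def)
    finally show ?thesis unfolding e
      by (intro order_trans[OF norm_triangle_ineq]) (simp add: norm_divide norm_power)
  qed
  have step: "norm ((\<integral>\<omega>. f (x + X (real (grid_ceil n T \<omega>) / 2 ^ n) \<omega>) \<partial>M) - f x)
    \<le> real (2 ^ n * L + 1) * (\<epsilon> / 2 ^ n + C / 4 ^ n) + G / 2 ^ n" for n
  proof -
    define K where "K = 2 ^ n * L + 1"
    let ?Z = "\<lambda>k \<omega>. (if k < grid_ceil n T \<omega> then Dn n (x + X (real k / 2 ^ n) \<omega>) else 0)"
    have Xm [measurable]: "X (real k / 2 ^ n) \<in> borel_measurable M" for k by (rule X_measurable) simp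
    have Sm [measurable]: "{\<omega>\<in>space M. k < grid_ceil n T \<omega>} \<in> sets M" for k
      using grid_timeD[OF grid_time_ceil[OF T], of k k] filt_subset by auto
    have Zm: "?Z k \<in> borel_measurable M" for k
      by (intro measurable_If Sm) measurable
    have Zb: "norm (?Z k \<omega>) \<le> G + C" for k \<omega>
    proof -
      have "norm (Dn n y) \<le> G / 1 + C / 1" for y
        using C0 by (intro order_trans[OF diff] add_mono frac_le gG) auto
      then show ?thesis using C0 by auto
    qed
    have Zi: "integrable M (\<lambda>\<omega>. norm (?Z k \<omega>))" for k
      using Zm Zb by (intro integrable_const_bound[where B="G + C"] AE_I2) auto
    have "norm ((\<integral>\<omega>. f (x + X (real (grid_ceil n T \<omega>) / 2 ^ n) \<omega>) \<partial>M) - f x) = norm (\<Sum>k<K. \<integral>\<omega>. ?Z k \<omega> \<partial>M)"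
      unfolding f_def Dn_def K_def dynkin_grid[OF T F] ..
    also have "\<dots> \<le> (\<Sum>k<K. \<integral>\<omega>. norm (?Z k \<omega>) \<partial>M)"
      by (intro order_trans[OF norm_sum] sum_mono integral_norm_bound)
    also have "\<dots> = (\<integral>\<omega>. (\<Sum>k<K. norm (?Z k \<omega>)) \<partial>M)"
      using Zi by simp
    also have "\<dots> \<le> (\<integral>\<omega>. real K * (\<epsilon> / 2 ^ n + C / 4 ^ n) + G / 2 ^ n \<partial>M)"
    proof (rule integral_mono)
      fix \<omega> assume \<omega>: "\<omega> \<in> space M"
      \<comment> \<open>When T is itself a grid point, the step leaving T is still counted, although
        the path need not lie in D there. This single step is charged with the global bound G/2^n,
        negligible in the limit.\<close>
      have "norm (?Z k \<omega>) \<le> (\<epsilon> / 2 ^ n + C / 4 ^ n) + (if k = nat \<lfloor>2 ^ n * T \<omega>\<rfloor> then G / 2 ^ n else 0)" for k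
      proof (cases "k < grid_ceil n T \<omega>")
        case True
        then have le: "real k / 2 ^ n \<le> T \<omega>" using less_grid_ceil[where T=T, OF T0(1)[OF \<omega>]] by simp
        show ?thesis
        proof (cases "real k / 2 ^ n = T \<omega>")
          case eq: True
          then have "2 ^ n * T \<omega> = real k" by (simp add: field_simps)
          then have "nat \<lfloor>2 ^ n * T \<omega>\<rfloor> = k" by simp
          moreover have "norm (?Z k \<omega>) \<le> G / 2 ^ n + C / 4 ^ n"
            using True gG by (auto intro!: order_trans[OF diff] divide_right_mono)
          moreover have "0 \<le> \<epsilon> / 2 ^ n" using \<epsilon> by simp
          ultimately show ?thesis by simp
        next
          case False
          then have "x + X (real k / 2 ^ n) \<omega> \<in> D" using le by (intro D[OF \<omega>]) auto
          then have "norm (gg (x + X (real k / 2 ^ n) \<omega>)) \<le> \<epsilon>" unfolding gg_def by (rule g)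
          then have "norm (?Z k \<omega>) \<le> \<epsilon> / 2 ^ n + C / 4 ^ n"
            using True by (auto intro!: order_trans[OF diff] divide_right_mono)
          moreover have "0 \<le> (if k = nat \<lfloor>2 ^ n * T \<omega>\<rfloor> then G / 2 ^ n else 0)" using C0 by simp
          ultimately show ?thesis by linarith
        qed
      next
        case False
        then show ?thesis using C0 \<epsilon> by auto
      qed
      then have "(\<Sum>k<K. norm (?Z k \<omega>)) \<le> (\<Sum>k<K. (\<epsilon> / 2 ^ n + C / 4 ^ n) + (if k = nat \<lfloor>2 ^ n * T \<omega>\<rfloor> then G / 2 ^ n else 0))"
        by (intro sum_mono)
      also have "\<dots> = real K * (\<epsilon> / 2 ^ n + C / 4 ^ n) + (\<Sum>k<K. if k = nat \<lfloor>2 ^ n * T \<omega>\<rfloor> then G / 2 ^ n else 0)"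
        by (simp add: sum.distrib)
      also have "(\<Sum>k<K. if k = nat \<lfloor>2 ^ n * T \<omega>\<rfloor> then G / 2 ^ n else 0) \<le> G / 2 ^ n"
        using C0 by (simp add: sum.delta)
      finally show "(\<Sum>k<K. norm (?Z k \<omega>)) \<le> real K * (\<epsilon> / 2 ^ n + C / 4 ^ n) + G / 2 ^ n" by simp
    qed (use Zi in auto)
    also have "\<dots> = real K * (\<epsilon> / 2 ^ n + C / 4 ^ n) + G / 2 ^ n" by (simp add: prob_space)
    finally show ?thesis unfolding K_def .
  qed
  have "(\<lambda>n. norm ((\<integral>\<omega>. f (x + X (real (grid_ceil n T \<omega>) / 2 ^ n) \<omega>) \<partial>M) - f x)) \<longlonglongrightarrow> norm ((\<integral>\<omega>. f (x + X (T \<omega>) \<omega>) \<partial>M) - f x)"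
  proof (intro tendsto_intros integral_dominated_convergence[where w="\<lambda>_. \<integral>\<theta>. norm (F \<theta>) \<partial>lborel"])
    show "AE \<omega> in M. (\<lambda>n. f (x + X (real (grid_ceil n T \<omega>) / 2 ^ n) \<omega>)) \<longlonglongrightarrow> f (x + X (T \<omega>) \<omega>)"
      unfolding f_def by (intro AE_I2 fourier_integral_continuous[OF F] tendsto_intros X_grid_ceil_lim T0)
    show "AE \<omega> in M. norm (f (x + X (real (grid_ceil n T \<omega>) / 2 ^ n) \<omega>)) \<le> (\<integral>\<theta>. norm (F \<theta>) \<partial>lborel)" for n
      unfolding f_def by (intro AE_I2 fourier_integral_bound)
  qed auto
  moreover have "(\<lambda>n. real (2 ^ n * L + 1) * (\<epsilon> / 2 ^ n + C / 4 ^ n) + G / 2 ^ n) \<longlonglongrightarrow> real L * \<epsilon>"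
    by real_asymp
  ultimately show ?thesis
    by (rule LIMSEQ_le) (use step in auto)
qed

end

section \<open>Entry times and quasi-left-continuity\<close>

lemma dyadic_between:
  fixes s t :: real
  assumes "0 \<le> s" "s < t"
  obtains j m where "s < real j / 2 ^ m" "real j / 2 ^ m < t"
proof -
  have "(\<lambda>m. (1 / 2 :: real) ^ m) \<longlonglongrightarrow> 0" by (rule LIMSEQ_power_zero) simp
  then have "\<forall>\<^sub>F m in sequentially. (1 / 2 :: real) ^ m < t - s"
    using assms by (intro order_tendstoD) auto
  then obtain m where m: "(1 / 2 :: real) ^ m < t - s" by (auto simp: eventually_sequentially)
  define j where "j = nat \<lfloor>2 ^ m * s\<rfloor> + 1"
  have j: "real j = of_int \<lfloor>2 ^ m * s\<rfloor> + 1" using assms by (simp add: j_def)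
  have "2 ^ m * s < real j" "real j \<le> 2 ^ m * s + 1" unfolding j by linarith+
  then have "s < real j / 2 ^ m" "real j / 2 ^ m \<le> s + (1 / 2) ^ m"
    by (simp_all add: field_simps power_divide)
  then show ?thesis using m by (intro that[of j m]) auto
qed

text \<open>A countable union of inner and a countable intersection of outer approximations have the
  same probability h; the event differs from the former by a subset of a null set and so belongs to
  the completion.\<close>

lemma (in prob_space) completion_squeeze:
  assumes "E \<subseteq> space M"
    and lower: "\<And>\<epsilon>. 0 < \<epsilon> \<Longrightarrow> \<exists>A\<in>sets M. A \<subseteq> E \<and> h - \<epsilon> \<le> prob A"
    and upper: "\<And>\<epsilon>. 0 < \<epsilon> \<Longrightarrow> \<exists>B\<in>sets M. E \<subseteq> B \<and> prob B \<le> h + \<epsilon>"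
  shows "measure (completion M) E = h"
proof -
  have "\<forall>n. \<exists>A\<in>sets M. A \<subseteq> E \<and> h - 1 / real (Suc n) \<le> prob A" by (intro allI lower) simp
  then obtain A where A: "\<And>n. A n \<in> sets M" "\<And>n. A n \<subseteq> E" "\<And>n. h - 1 / real (Suc n) \<le> prob (A n)" by metis
  have "\<forall>n. \<exists>B\<in>sets M. E \<subseteq> B \<and> prob B \<le> h + 1 / real (Suc n)" by (intro allI upper) simp
  then obtain B where B: "\<And>n. B n \<in> sets M" "\<And>n. E \<subseteq> B n" "\<And>n. prob (B n) \<le> h + 1 / real (Suc n)" by metis
  define A' B' where "A' = (\<Union>n. A n)" and "B' = (\<Inter>n. B n)"
  have m [measurable]: "A' \<in> sets M" "B' \<in> sets M" unfolding A'_def B'_def using A B by auto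
  have sub: "A' \<subseteq> E" "E \<subseteq> B'" unfolding A'_def B'_def by (intro UN_least INT_greatest A(2) B(2))+
  have l0: "(\<lambda>n. 1 / real (Suc n)) \<longlonglongrightarrow> 0" using LIMSEQ_inverse_real_of_nat by (simp add: inverse_eq_divide)
  have "h - 0 \<le> prob A'"
  proof (rule LIMSEQ_le_const2[OF tendsto_diff[OF tendsto_const l0]])
    have "prob (A n) \<le> prob A'" for n using m A by (intro finite_measure_mono) (auto simp: A'_def)
    then show "\<exists>N. \<forall>n\<ge>N. h - 1 / real (Suc n) \<le> prob A'" using A(3) order_trans by blast
  qed
  moreover have "prob B' \<le> h + 0"
  proof (rule LIMSEQ_le_const[OF tendsto_add[OF tendsto_const l0]])
    have "prob B' \<le> prob (B n)" for n using m B by (intro finite_measure_mono) (auto simp: B'_def)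
    then show "\<exists>N. \<forall>n\<ge>N. prob B' \<le> h + 1 / real (Suc n)" using B(3) order_trans by blast
  qed
  moreover have "prob A' \<le> prob B'" using sub m by (intro finite_measure_mono) auto
  ultimately have P: "prob A' = h" "prob B' = h" by auto
  have "prob (B' - A') = 0" using P sub m by (subst finite_measure_Diff) auto
  then have nul: "B' - A' \<in> null_sets M" using m by (intro null_setsI) (auto simp: emeasure_eq_measure)
  have E: "E = A' \<union> (E - A')" "E - A' \<subseteq> B' - A'" using sub by auto
  have cE: "E \<in> sets (completion M)" by (rule sets_completionI[OF E nul m(1)])
  have "emeasure (completion M) A' \<le> emeasure (completion M) E" "emeasure (completion M) E \<le> emeasure (completion M) B'"
    by (rule emeasure_mono[OF sub(1) cE], rule emeasure_mono[OF sub(2) sets_completionI_sets[OF m(2)]])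
  then have "emeasure (completion M) E = ennreal h" using P m by (simp add: emeasure_eq_measure)
  moreover have "0 \<le> h" using P by (metis measure_nonneg)
  ultimately show ?thesis by (simp add: measure_def)
qed

context levy_motion
begin

definition entry_time :: "real set \<Rightarrow> nat \<Rightarrow> real \<Rightarrow> 'a \<Rightarrow> real" where
  "entry_time U L x \<omega> = Inf ({t. 0 \<le> t \<and> x + X t \<omega> \<in> U} \<union> {real L})"

lemma entry_time_bdd: "bdd_below ({t. 0 \<le> t \<and> x + X t \<omega> \<in> U} \<union> {real L})"
  by (rule bdd_belowI[of _ 0]) auto

lemma entry_time_nonneg: "0 \<le> entry_time U L x \<omega>"
  unfolding entry_time_def by (rule cInf_greatest) auto

lemma entry_time_le_L: "entry_time U L x \<omega> \<le> real L"
  unfolding entry_time_def by (rule cInf_lower[OF _ entry_time_bdd]) auto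

lemma entry_time_le: "0 \<le> t \<Longrightarrow> x + X t \<omega> \<in> U \<Longrightarrow> entry_time U L x \<omega> \<le> t"
  unfolding entry_time_def by (rule cInf_lower[OF _ entry_time_bdd]) auto

lemma before_entry_time: "0 \<le> s \<Longrightarrow> s < entry_time U L x \<omega> \<Longrightarrow> x + X s \<omega> \<notin> U"
  using entry_time_le[of s x \<omega> U L] by auto

lemma entry_time_less: "entry_time U L x \<omega> < t \<longleftrightarrow> (\<exists>s. 0 \<le> s \<and> s < t \<and> x + X s \<omega> \<in> U) \<or> real L < t"
  unfolding entry_time_def by (subst cInf_less_iff[OF _ entry_time_bdd]) auto

lemma entry_time_mono: "U \<subseteq> V \<Longrightarrow> entry_time V L x \<omega> \<le> entry_time U L x \<omega>"
  unfolding entry_time_def by (rule cInf_superset_mono[OF _ entry_time_bdd]) auto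

text \<open>Below the cap, the infimum is a limit of times spent in U, from the right or attained. A
  position outside the closed set \<open>closure U\<close> would by right-continuity persist for a
  short while and contradict this.\<close>

lemma at_entry_time:
  assumes \<omega>: "\<omega> \<in> space M" and less: "entry_time U L x \<omega> < real L"
  shows "x + X (entry_time U L x \<omega>) \<omega> \<in> closure U"
proof (rule ccontr)
  let ?T = "entry_time U L x \<omega>"
  assume out: "x + X ?T \<omega> \<notin> closure U"
  have "((\<lambda>s. x + X s \<omega>) \<longlongrightarrow> x + X ?T \<omega>) (at_right ?T)"
    using X_right_cont[OF \<omega> entry_time_nonneg[of U L x \<omega>]] unfolding continuous_within by (intro tendsto_intros)
  then have "\<forall>\<^sub>F s in at_right ?T. x + X s \<omega> \<in> - closure U"
    by (rule topological_tendstoD) (use out in auto)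
  then obtain b where b: "?T < b" "\<And>s. ?T < s \<Longrightarrow> s < b \<Longrightarrow> x + X s \<omega> \<notin> closure U"
    by (auto simp: eventually_at_right_field)
  have "entry_time U L x \<omega> < min b (real L)" using b less by simp
  then obtain s where s: "0 \<le> s" "s < min b (real L)" "x + X s \<omega> \<in> U"
    unfolding entry_time_less by auto
  have "?T \<le> s" by (rule entry_time_le[OF s(1,3)])
  then show False using s b(2)[of s] out closure_subset[of U] by (cases "s = ?T") auto
qed

text \<open>If the path is in the open set U at some s < t, then by right-continuity also at a
  dyadic time between s and t. Entry before t is thus a countable union of events at dyadic
  times.\<close>

lemma entry_time_opt_time:
  assumes U: "open U" shows "opt_time L (entry_time U L x)"
  unfolding opt_time_def
proof (intro conjI ballI allI)
  fix n k
  let ?t = "real k / 2 ^ n"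
  show "{\<omega> \<in> space M. entry_time U L x \<omega> < ?t} \<in> sets (filt ?t)"
  proof (cases "real L < ?t")
    case True
    then have "{\<omega> \<in> space M. entry_time U L x \<omega> < ?t} = space (filt ?t)" by (auto simp: entry_time_less)
    then show ?thesis by (simp only: sets.top)
  next
    case False
    have "{\<omega> \<in> space M. entry_time U L x \<omega> < ?t} = (\<Union>j. \<Union>m\<in>{m. real j / 2 ^ m < ?t}. X (real j / 2 ^ m) -` {v. x + v \<in> U} \<inter> space M)"
    proof (intro set_eqI iffI)
      fix \<omega> assume "\<omega> \<in> {\<omega> \<in> space M. entry_time U L x \<omega> < ?t}"
      then obtain s where \<omega>: "\<omega> \<in> space M" and s: "0 \<le> s" "s < ?t" "x + X s \<omega> \<in> U" using False by (auto simp: entry_time_less)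
      have "((\<lambda>u. x + X u \<omega>) \<longlongrightarrow> x + X s \<omega>) (at_right s)"
        using X_right_cont[OF \<omega> s(1)] unfolding continuous_within by (intro tendsto_intros)
      then have "\<forall>\<^sub>F u in at_right s. x + X u \<omega> \<in> U" by (rule topological_tendstoD[OF _ U s(3)])
      then obtain b where b: "s < b" "\<And>u. s < u \<Longrightarrow> u < b \<Longrightarrow> x + X u \<omega> \<in> U" by (auto simp: eventually_at_right_field)
      obtain j m where "s < real j / 2 ^ m" "real j / 2 ^ m < min b ?t"
        by (rule dyadic_between[OF s(1), of "min b ?t"]) (use b s in auto)
      then show "\<omega> \<in> (\<Union>j. \<Union>m\<in>{m. real j / 2 ^ m < ?t}. X (real j / 2 ^ m) -` {v. x + v \<in> U} \<inter> space M)"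
        using b(2) \<omega> by auto
    next
      fix \<omega> assume "\<omega> \<in> (\<Union>j. \<Union>m\<in>{m. real j / 2 ^ m < ?t}. X (real j / 2 ^ m) -` {v. x + v \<in> U} \<inter> space M)"
      then obtain j m where "real j / 2 ^ m < ?t" "x + X (real j / 2 ^ m) \<omega> \<in> U" "\<omega> \<in> space M" by auto
      then show "\<omega> \<in> {\<omega> \<in> space M. entry_time U L x \<omega> < ?t}"
        by (auto simp: entry_time_less intro!: exI[of _ "real j / 2 ^ m"])
    qed
    also have "\<dots> \<in> sets (filt ?t)"
    proof (rule sets.countable_UN''[OF countableI_type], rule sets.countable_UN''[OF countableI_type])
      fix j m :: nat assume "m \<in> {m. real j / 2 ^ m < ?t}"
      then have "X (real j / 2 ^ m) \<in> borel_measurable (filt ?t)" by (intro X_measurable_filt) auto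
      moreover have "{v. x + v \<in> U} \<in> sets borel"
        using measurable_sets_borel[of "\<lambda>v. x + v" borel U] U by (simp add: vimage_def)
      ultimately show "X (real j / 2 ^ m) -` {v. x + v \<in> U} \<inter> space M \<in> sets (filt ?t)"
        unfolding space_filt[of ?t, symmetric] by (rule measurable_sets)
    qed
    finally show ?thesis .
  qed
qed (auto simp: entry_time_nonneg entry_time_le_L)

text \<open>The supremum is below t exactly when all T j are below one common dyadic number less
  than t. The intermediate number is essential: T j < t for every j would only give a supremum of at
  most t.\<close>

lemma SUP_opt_time:
  assumes T: "\<And>j :: nat. opt_time L (T j)"
  shows "opt_time L (\<lambda>\<omega>. SUP j. T j \<omega>)"
  unfolding opt_time_def
proof (intro conjI ballI allI)
  have T0: "0 \<le> T j \<omega>" "T j \<omega> \<le> real L" if "\<omega> \<in> space M" for j \<omega> using T[of j] that by (auto simp: opt_time_def)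
  have bdd: "bdd_above (range (\<lambda>j. T j \<omega>))" if "\<omega> \<in> space M" for \<omega> using T0[OF that] by (intro bdd_aboveI[of _ "real L"]) auto
  show "0 \<le> (SUP j. T j \<omega>)" if "\<omega> \<in> space M" for \<omega>
    using T0(1)[OF that, of 0] by (rule cSUP_upper2[OF bdd[OF that], rotated]) simp
  show "(SUP j. T j \<omega>) \<le> real L" if "\<omega> \<in> space M" for \<omega>
    using T0[OF that] by (intro cSUP_least) auto
  fix n k
  let ?t = "real k / 2 ^ n"
  have "{\<omega> \<in> space M. (SUP j. T j \<omega>) < ?t} = (\<Union>i. \<Union>m\<in>{m. real i / 2 ^ m < ?t}. \<Inter>j. {\<omega> \<in> space M. T j \<omega> < real i / 2 ^ m})"
  proof (intro set_eqI iffI)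
    fix \<omega> assume "\<omega> \<in> {\<omega> \<in> space M. (SUP j. T j \<omega>) < ?t}"
    then have \<omega>: "\<omega> \<in> space M" and s: "(SUP j. T j \<omega>) < ?t" by auto
    have "0 \<le> (SUP j. T j \<omega>)"
      using T0(1)[OF \<omega>, of 0] by (rule cSUP_upper2[OF bdd[OF \<omega>], rotated]) simp
    then obtain i m where im: "(SUP j. T j \<omega>) < real i / 2 ^ m" "real i / 2 ^ m < ?t"
      using dyadic_between s by metis
    have "T j \<omega> < real i / 2 ^ m" for j
      using cSUP_upper[OF _ bdd[OF \<omega>], of j] im(1) by auto
    then show "\<omega> \<in> (\<Union>i. \<Union>m\<in>{m. real i / 2 ^ m < ?t}. \<Inter>j. {\<omega> \<in> space M. T j \<omega> < real i / 2 ^ m})"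
      using im(2) \<omega> by auto
  next
    fix \<omega> assume "\<omega> \<in> (\<Union>i. \<Union>m\<in>{m. real i / 2 ^ m < ?t}. \<Inter>j. {\<omega> \<in> space M. T j \<omega> < real i / 2 ^ m})"
    then obtain i m where im: "real i / 2 ^ m < ?t" "\<And>j. T j \<omega> < real i / 2 ^ m" "\<omega> \<in> space M" by auto
    have "(SUP j. T j \<omega>) \<le> real i / 2 ^ m" using im(2) by (intro cSUP_least) (auto intro: less_imp_le)
    then show "\<omega> \<in> {\<omega> \<in> space M. (SUP j. T j \<omega>) < ?t}" using im by auto
  qed
  also have "\<dots> \<in> sets (filt ?t)"
  proof (rule sets.countable_UN''[OF countableI_type], rule sets.countable_UN''[OF countableI_type], rule sets.countable_INT[OF image_subsetI])
    fix i m j :: nat assume m: "m \<in> {m. real i / 2 ^ m < ?t}"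
    have "{\<omega> \<in> space M. T j \<omega> < real i / 2 ^ m} \<in> sets (filt (real i / 2 ^ m))"
      using T[of j] by (auto simp: opt_time_def)
    then show "{\<omega> \<in> space M. T j \<omega> < real i / 2 ^ m} \<in> sets (filt ?t)"
      using filt_mono[of "real i / 2 ^ m" ?t] m by auto
  qed simp
  finally show "{\<omega> \<in> space M. (SUP j. T j \<omega>) < ?t} \<in> sets (filt ?t)" .
qed

text \<open>By uniqueness of characteristic functions the law of D is the point mass at 0.\<close>

lemma AE_eq_0_if_char_1:
  assumes D [measurable]: "D \<in> borel_measurable M" and c: "\<And>\<theta>::real. (\<integral>\<omega>. iexp (\<theta> * D \<omega>) \<partial>M) = 1"
  shows "AE \<omega> in M. D \<omega> = 0"
proof -
  have rd: "real_distribution (distr M borel D)" by (simp add: real_distribution_distr)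
  have r0: "real_distribution (return borel (0::real))"
    by (auto simp: real_distribution_def real_distribution_axioms_def prob_space_return)
  have "char (distr M borel D) = char (return borel 0)"
  proof
    fix \<theta>
    have "char (distr M borel D) \<theta> = (\<integral>\<omega>. iexp (\<theta> * D \<omega>) \<partial>M)" unfolding char_def by (rule integral_distr) measurable
    also have "\<dots> = char (return borel 0) \<theta>" unfolding c char_def by (subst integral_return) auto
    finally show "char (distr M borel D) \<theta> = char (return borel 0) \<theta>" .
  qed
  then have eq: "distr M borel D = return borel 0" by (rule Levy_uniqueness[OF rd r0])
  have "AE y in distr M borel D. y = 0" unfolding eq by (subst AE_return) auto
  then show ?thesis by (subst (asm) AE_distr_iff) auto
qed

text \<open>Quasi-left-continuity: the increment from T j to the limit time has characteristic function tending to 1,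
  while it converges along every path to the jump at the limit time.\<close>
lemma quasi_left_continuous:
  assumes T: "\<And>j :: nat. opt_time L (T j)" and inc: "\<And>\<omega> j. \<omega> \<in> space M \<Longrightarrow> T j \<omega> \<le> T (Suc j) \<omega>"
  shows "AE \<omega> in M. (\<lambda>j. X (T j \<omega>) \<omega>) \<longlonglongrightarrow> X (SUP j. T j \<omega>) \<omega>"
proof -
  define S where "S = (\<lambda>\<omega>. SUP j. T j \<omega>)"
  have S: "opt_time L S" unfolding S_def by (rule SUP_opt_time[OF T])
  have T0: "0 \<le> T j \<omega>" "T j \<omega> \<le> real L" if "\<omega> \<in> space M" for j \<omega> using T[of j] that by (auto simp: opt_time_def)
  have S0: "0 \<le> S \<omega>" "S \<omega> \<le> real L" if "\<omega> \<in> space M" for \<omega> using S that by (auto simp: opt_time_def)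
  have bdd: "bdd_above (range (\<lambda>j. T j \<omega>))" if "\<omega> \<in> space M" for \<omega> using T0[OF that] by (intro bdd_aboveI[of _ "real L"]) auto
  have le: "T j \<omega> \<le> S \<omega>" if "\<omega> \<in> space M" for j \<omega> unfolding S_def by (rule cSUP_upper[OF _ bdd[OF that]]) simp
  have mono: "incseq (\<lambda>j. T j \<omega>)" if "\<omega> \<in> space M" for \<omega> by (intro incseq_SucI inc that)
  have lim: "(\<lambda>j. T j \<omega>) \<longlonglongrightarrow> S \<omega>" if "\<omega> \<in> space M" for \<omega>
    unfolding S_def by (rule LIMSEQ_incseq_SUP[OF bdd[OF that] mono[OF that]])
  note [measurable] = X_opt_measurable[OF T] X_opt_measurable[OF S] opt_time_measurable[OF T] opt_time_measurable[OF S]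
  have conv: "convergent (\<lambda>j. X (T j \<omega>) \<omega>)" if \<omega>: "\<omega> \<in> space M" for \<omega>
  \<comment> \<open>Either the times reach their supremum and the sequence is eventually constant,
    or they stay strictly below and the left limit of the path exists.\<close>
  proof (cases "\<exists>j. T j \<omega> = S \<omega>")
    case True
    then obtain j where j: "T j \<omega> = S \<omega>" by auto
    have "T i \<omega> = S \<omega>" if "j \<le> i" for i
      using incseqD[OF mono[OF \<omega>] that] le[OF \<omega>, of i] j by simp
    then have "\<forall>\<^sub>F i in sequentially. X (T i \<omega>) \<omega> = X (S \<omega>) \<omega>"
      by (intro eventually_sequentiallyI[of j]) simp
    then show ?thesis by (intro convergentI[of _ "X (S \<omega>) \<omega>"] tendsto_eventually)
  next
    case False
    then have less: "T j \<omega> < S \<omega>" for j using le[OF \<omega>, of j] by (metis order_le_less)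
    then have "0 < S \<omega>" using T0(1)[OF \<omega>, of 0] le_less_trans by blast
    then obtain l where l: "((\<lambda>s. X s \<omega>) \<longlongrightarrow> l) (at_left (S \<omega>))" using X_left_lim[OF \<omega>] by blast
    have "filterlim (\<lambda>j. T j \<omega>) (at_left (S \<omega>)) sequentially"
      unfolding filterlim_at using lim[OF \<omega>] less by (auto intro!: always_eventually simp: less_imp_neq)
    then show ?thesis by (intro convergentI[of _ l] filterlim_compose[OF l])
  qed
  define Y where "Y = (\<lambda>\<omega>. lim (\<lambda>j. X (T j \<omega>) \<omega>))"
  have Ym [measurable]: "Y \<in> borel_measurable M" unfolding Y_def by measurable
  have Y: "(\<lambda>j. X (T j \<omega>) \<omega>) \<longlonglongrightarrow> Y \<omega>" if "\<omega> \<in> space M" for \<omega>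
    using conv[OF that] by (simp add: Y_def convergent_LIMSEQ_iff)
  have "(\<integral>\<omega>. iexp (\<theta> * (X (S \<omega>) \<omega> - Y \<omega>)) \<partial>M) = 1" for \<theta>
  proof -
    have "(\<lambda>j. \<integral>\<omega>. S \<omega> - T j \<omega> \<partial>M) \<longlonglongrightarrow> (\<integral>\<omega>. 0 \<partial>M)"
    proof (rule integral_dominated_convergence[where w="\<lambda>_. real L"])
      show "AE \<omega> in M. (\<lambda>j. S \<omega> - T j \<omega>) \<longlonglongrightarrow> 0"
      proof (intro AE_I2)
        fix \<omega> assume "\<omega> \<in> space M"
        then have "(\<lambda>j. S \<omega> - T j \<omega>) \<longlonglongrightarrow> S \<omega> - S \<omega>" by (intro tendsto_intros lim)
        then show "(\<lambda>j. S \<omega> - T j \<omega>) \<longlonglongrightarrow> 0" by simp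
      qed
      show "AE \<omega> in M. norm (S \<omega> - T j \<omega>) \<le> real L" for j
      proof (intro AE_I2)
        fix \<omega> assume "\<omega> \<in> space M"
        from S0[OF this] T0[OF this, of j] le[OF this, of j] show "norm (S \<omega> - T j \<omega>) \<le> real L" by simp
      qed
    qed auto
    then have z: "(\<lambda>j. norm (\<psi> \<theta>) * (\<integral>\<omega>. S \<omega> - T j \<omega> \<partial>M)) \<longlonglongrightarrow> norm (\<psi> \<theta>) * 0"
      by (intro tendsto_intros) simp
    have "(\<lambda>j. norm ((\<integral>\<omega>. iexp (\<theta> * (X (S \<omega>) \<omega> - X (T j \<omega>) \<omega>)) \<partial>M) - 1)) \<longlonglongrightarrow> norm ((\<integral>\<omega>. iexp (\<theta> * (X (S \<omega>) \<omega> - Y \<omega>)) \<partial>M) - 1)"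
    proof (intro tendsto_intros integral_dominated_convergence[where w="\<lambda>_. 1"])
      show "AE \<omega> in M. (\<lambda>j. iexp (\<theta> * (X (S \<omega>) \<omega> - X (T j \<omega>) \<omega>))) \<longlonglongrightarrow> iexp (\<theta> * (X (S \<omega>) \<omega> - Y \<omega>))"
        by (intro AE_I2 tendsto_intros Y)
    qed auto
    from LIMSEQ_le[OF this z] have "norm ((\<integral>\<omega>. iexp (\<theta> * (X (S \<omega>) \<omega> - Y \<omega>)) \<partial>M) - 1) \<le> norm (\<psi> \<theta>) * 0"
      using opt_time_increment_char[OF T S le] by auto
    then show ?thesis by simp
  qed
  from AE_eq_0_if_char_1[OF _ this] have "AE \<omega> in M. X (S \<omega>) \<omega> - Y \<omega> = 0" by simp
  then show ?thesis
  proof (rule AE_mp, intro AE_I2 impI)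
    fix \<omega> assume "\<omega> \<in> space M" "X (S \<omega>) \<omega> - Y \<omega> = 0"
    then show "(\<lambda>j. X (T j \<omega>) \<omega>) \<longlonglongrightarrow> X (SUP j. T j \<omega>) \<omega>" using Y[of \<omega>] by (simp add: S_def)
  qed
qed

end

section \<open>Harmonicity outside the target and decay in time\<close>

locale stable_motion = levy_motion M X "stable_exponent \<beta> \<gamma>" + stable_indices \<beta> \<gamma>
  for M :: "'a measure" and X :: "real \<Rightarrow> 'a \<Rightarrow> real" and \<beta> \<gamma> :: real
begin

definition target :: "real \<Rightarrow> real \<Rightarrow> real set" where
  "target \<delta> a = {-\<delta><..<\<delta>} \<union> {a<..}"

lemma target_open: "open (target \<delta> a)"
  by (simp add: target_def open_Un)

lemma closure_target: "y \<in> closure (target \<delta> a) \<Longrightarrow> \<bar>y\<bar> \<le> \<delta> \<or> a \<le> y"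
proof -
  have "closure (target \<delta> a) \<subseteq> {-\<delta>..\<delta>} \<union> {a..}"
    by (rule closure_minimal) (auto simp: target_def closed_Un)
  moreover assume "y \<in> closure (target \<delta> a)"
  ultimately have "y \<in> {-\<delta>..\<delta>} \<union> {a..}" by blast
  then show ?thesis by (auto simp: abs_le_iff)
qed

lemma smooth_const_nonneg: "0 \<le> smooth_const"
proof -
  have "0 \<le> Beta \<gamma> (1 - \<gamma>)" using weight_nonneg[of 1 0] weight_le[of 1 0] by linarith
  moreover have "0 < Gamma \<beta>" "0 < Gamma (1 - \<gamma>)" using \<beta> \<gamma> by (auto intro!: Gamma_real_pos)
  moreover have "0 \<le> (\<integral>x. std_normal_density x * \<bar>x\<bar> ^ 3 \<partial>lborel)" by (intro integral_nonneg_AE AE_I2) auto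
  ultimately show ?thesis unfolding smooth_const_def by (intro mult_nonneg_nonneg divide_nonneg_nonneg) auto
qed

lemma smoothed_H:
  assumes c: "0 \<le> c"
  defines "Hs \<equiv> \<lambda>n y. \<integral>v. H c (y - v / real (Suc n)) * std_normal_density v \<partial>lborel"
  shows "(\<lambda>n. Hs n y) \<longlonglongrightarrow> H c y" and "\<bar>Hs n y\<bar> \<le> H c 0" and "Hs n \<in> borel_measurable borel"
proof -
  note [measurable] = H_measurable[OF c]
  show "Hs n \<in> borel_measurable borel" unfolding Hs_def by measurable
  have wi: "integrable lborel (\<lambda>v. H c 0 * std_normal_density v)" by simp
  have b: "norm (H c z * std_normal_density v) \<le> H c 0 * std_normal_density v" for z v
    using H_le_H0[OF c, of z] H_nonneg[of c z] by (simp add: abs_mult mult_right_mono)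
  have "(\<lambda>n. Hs n y) \<longlonglongrightarrow> (\<integral>v. H c y * std_normal_density v \<partial>lborel)"
    unfolding Hs_def
  proof (rule integral_dominated_convergence[OF _ _ wi])
    show "AE v in lborel. (\<lambda>n. H c (y - v / real (Suc n)) * std_normal_density v) \<longlonglongrightarrow> H c y * std_normal_density v"
    proof (intro AE_I2 tendsto_mult tendsto_const H_lim[OF c])
      fix v :: real
      have "(\<lambda>n. y - v * inverse (real (Suc n))) \<longlonglongrightarrow> y - v * 0" by (intro tendsto_intros LIMSEQ_inverse_real_of_nat)
      then show "(\<lambda>n. y - v / real (Suc n)) \<longlonglongrightarrow> y" by (simp add: divide_inverse)
    qed
  qed (use b in auto)
  then show "(\<lambda>n. Hs n y) \<longlonglongrightarrow> H c y" by simp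
  have "\<bar>Hs n y\<bar> \<le> (\<integral>v. H c 0 * std_normal_density v \<partial>lborel)"
    unfolding Hs_def using b by (intro order_trans[OF integral_abs_bound] integral_mono' wi) (auto simp: abs_mult H_nonneg)
  then show "\<bar>Hs n y\<bar> \<le> H c 0" by simp
qed

text \<open>Outside the target |y| >= \<delta> and y <= a. A shift by less than \<delta> cannot
  cross 0, and one by less than c - a cannot pass the cut-off, so both points lie on the same
  constant piece of \<open>weight\<close>.\<close>

lemma weight_locally_constant:
  assumes "0 < \<delta>" "a < c" "y \<notin> target \<delta> a" "\<bar>u\<bar> < min \<delta> (c - a)"
  shows "weight c (y - u) = weight c y"
proof -
  have y: "y \<le> a" "\<bar>y\<bar> \<ge> \<delta>" using assms(3) by (auto simp: target_def abs_if not_less split: if_splits)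
  show ?thesis
  proof (cases "0 < y")
    case True
    then have "0 < y - u" "y - u \<le> c" "y \<le> c" using y assms by auto
    then show ?thesis using True by (simp add: weight_pos)
  next
    case False
    then have "y - u \<le> 0" using y assms by auto
    then show ?thesis using False by (simp add: weight_neg)
  qed
qed

text \<open>The Dynkin estimate for the smoothed H has error proportional to 1/((n+1) \<eta>^2),
  with \<eta> > 0 because a < c strictly. As n grows, the error vanishes and the smoothed functions
  converge boundedly to H.\<close>

lemma H_harmonic:
  assumes \<delta>: "0 < \<delta>" and a: "0 < a" "a < c" and T: "opt_time L T"
    and out: "\<And>\<omega> s. \<omega> \<in> space M \<Longrightarrow> 0 \<le> s \<Longrightarrow> s < T \<omega> \<Longrightarrow> x + X s \<omega> \<notin> target \<delta> a"
  shows "(\<integral>\<omega>. H c (x + X (T \<omega>) \<omega>) \<partial>M) = H c x"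
proof -
  have c: "0 \<le> c" using a by simp
  define \<eta> where "\<eta> = min \<delta> (c - a)"
  have \<eta>: "0 < \<eta>" using \<delta> a by (simp add: \<eta>_def)
  define Hs where "Hs = (\<lambda>n y. \<integral>v. H c (y - v / real (Suc n)) * std_normal_density v \<partial>lborel)"
  have Hs: "(\<lambda>n. Hs n y) \<longlonglongrightarrow> H c y" "\<bar>Hs n y\<bar> \<le> H c 0" "Hs n \<in> borel_measurable borel" for n y
    unfolding Hs_def by (rule smoothed_H[OF c])+
  note [measurable] = X_opt_measurable[OF T] Hs(3) H_measurable[OF c]
  have step: "\<bar>(\<integral>\<omega>. Hs n (x + X (T \<omega>) \<omega>) \<partial>M) - Hs n x\<bar> \<le> real L * (smooth_const / (real (Suc n) * \<eta>\<^sup>2))" for n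
  proof -
    have s: "0 < real (Suc n)" by simp
    have e: "(\<integral>\<theta>. smooth_freq c (real (Suc n)) \<theta> * iexp (\<theta> * y) \<partial>lborel) = complex_of_real (Hs n y)" for y
      unfolding Hs_def by (rule smooth_freq_integral[OF c s])
    have "norm ((\<integral>\<omega>. (\<integral>\<theta>. smooth_freq c (real (Suc n)) \<theta> * iexp (\<theta> * (x + X (T \<omega>) \<omega>)) \<partial>lborel) \<partial>M)
        - (\<integral>\<theta>. smooth_freq c (real (Suc n)) \<theta> * iexp (\<theta> * x) \<partial>lborel)) \<le> real L * (smooth_const / (real (Suc n) * \<eta>\<^sup>2))"
    proof (rule dynkin_bound[OF T smooth_freq_integrable[OF c s], where D="- target \<delta> a"])
      show "norm (\<integral>\<theta>. smooth_freq c (real (Suc n)) \<theta> * \<psi> \<theta> * iexp (\<theta> * y) \<partial>lborel) \<le> smooth_const / (real (Suc n) * \<eta>\<^sup>2)"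
        if "y \<in> - target \<delta> a" for y
        using that by (intro smooth_freq_generator[OF c s \<eta>] weight_locally_constant[OF \<delta> a(2)]) (auto simp: \<eta>_def)
    qed (use out smooth_const_nonneg in auto)
    then show ?thesis unfolding e integral_complex_of_real of_real_diff[symmetric] norm_of_real .
  qed
  have "(\<lambda>n. \<bar>(\<integral>\<omega>. Hs n (x + X (T \<omega>) \<omega>) \<partial>M) - Hs n x\<bar>) \<longlonglongrightarrow> \<bar>(\<integral>\<omega>. H c (x + X (T \<omega>) \<omega>) \<partial>M) - H c x\<bar>"
  proof (intro tendsto_intros Hs(1) integral_dominated_convergence[where w="\<lambda>_. H c 0"])
    show "AE \<omega> in M. (\<lambda>n. Hs n (x + X (T \<omega>) \<omega>)) \<longlonglongrightarrow> H c (x + X (T \<omega>) \<omega>)" by (intro AE_I2 Hs(1))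
    show "AE \<omega> in M. norm (Hs n (x + X (T \<omega>) \<omega>)) \<le> H c 0" for n using Hs(2) by (intro AE_I2) simp
  qed auto
  moreover have "(\<lambda>n. real L * (smooth_const / (real (Suc n) * \<eta>\<^sup>2))) \<longlonglongrightarrow> 0"
    using \<eta> by real_asymp
  ultimately have "\<bar>(\<integral>\<omega>. H c (x + X (T \<omega>) \<omega>) \<partial>M) - H c x\<bar> \<le> 0"
    by (rule LIMSEQ_le) (use step in blast)
  then show ?thesis by simp
qed

text \<open>Writing the Gaussian as a Fourier integral, its expectation becomes an average of the
  characteristic function exp(N \<psi>), which tends to 0 off the origin as Re \<psi> < 0. Hence the
  process leaves every bounded set in probability.\<close>

lemma gaussian_decay:
  assumes K: "0 < K"
  shows "(\<lambda>N. \<integral>\<omega>. exp (- ((x + X (real N) \<omega>) / K)\<^sup>2 / 2) \<partial>M) \<longlonglongrightarrow> 0"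
proof -
  let ?F = "\<lambda>\<tau>. complex_of_real (std_normal_density \<tau>)"
  have Fi: "integrable lborel ?F" using integrable_std_normal_moment[of 0] by (intro integrable_of_real) simp
  have Xm [measurable]: "X (real N) \<in> borel_measurable M" for N by (rule X_measurable) simp
  have "complex_of_real (\<integral>\<omega>. exp (- ((x + X (real N) \<omega>) / K)\<^sup>2 / 2) \<partial>M) = (\<integral>\<tau>. ?F \<tau> * (iexp (\<tau> / K * x) * exp (of_nat N * \<psi> (\<tau> / K))) \<partial>lborel)" for N
  proof -
    have "complex_of_real (\<integral>\<omega>. exp (- ((x + X (real N) \<omega>) / K)\<^sup>2 / 2) \<partial>M) = (\<integral>\<omega>. 1 * (\<integral>\<tau>. ?F \<tau> * iexp (\<tau> * ((x + X (real N) \<omega>) / K)) \<partial>lborel) \<partial>M)"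
      by (simp only: std_normal_fourier[symmetric] integral_complex_of_real mult_1_left)
    also have "\<dots> = (\<integral>\<tau>. ?F \<tau> * (\<integral>\<omega>. 1 * iexp (\<tau> * ((x + X (real N) \<omega>) / K)) \<partial>M) \<partial>lborel)"
      by (rule fourier_expectation(1)[OF Fi]) auto
    also have "\<dots> = (\<integral>\<tau>. ?F \<tau> * (iexp (\<tau> / K * x) * exp (of_nat N * \<psi> (\<tau> / K))) \<partial>lborel)"
    proof (intro Bochner_Integration.integral_cong refl arg_cong2[of _ _ _ _ "(*)"])
      fix \<tau>
      have "(\<integral>\<omega>. 1 * iexp (\<tau> * ((x + X (real N) \<omega>) / K)) \<partial>M) = (\<integral>\<omega>. iexp (\<tau> / K * x) * iexp (\<tau> / K * X (real N) \<omega>) \<partial>M)"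
        by (intro Bochner_Integration.integral_cong refl) (simp add: exp_add[symmetric] algebra_simps add_divide_distrib)
      also have "\<dots> = iexp (\<tau> / K * x) * (\<integral>\<omega>. iexp (\<tau> / K * X (real N) \<omega>) \<partial>M)" by (rule integral_mult_right_zero)
      also have "(\<integral>\<omega>. iexp (\<tau> / K * X (real N) \<omega>) \<partial>M) = char (distr M borel (X (real N))) (\<tau> / K)"
        unfolding char_def by (rule integral_distr[symmetric]) measurable
      also have "\<dots> = exp (of_nat N * \<psi> (\<tau> / K))" by (subst char_X) auto
      finally show "(\<integral>\<omega>. 1 * iexp (\<tau> * ((x + X (real N) \<omega>) / K)) \<partial>M) = iexp (\<tau> / K * x) * exp (of_nat N * \<psi> (\<tau> / K))" .
    qed
    finally show ?thesis .
  qed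
  moreover have "(\<lambda>N. \<integral>\<tau>. ?F \<tau> * (iexp (\<tau> / K * x) * exp (of_nat N * \<psi> (\<tau> / K))) \<partial>lborel) \<longlonglongrightarrow> (\<integral>\<tau>. 0 \<partial>(lborel :: real measure))"
  proof (rule integral_dominated_convergence[where w="std_normal_density"])
    have n: "norm (?F \<tau> * (iexp (\<tau> / K * x) * exp (of_nat N * \<psi> (\<tau> / K)))) = std_normal_density \<tau> * exp (Re (\<psi> (\<tau> / K))) ^ N" for N \<tau>
      by (simp add: norm_mult norm_exp exp_of_nat_mult[symmetric])
    have "AE \<tau> in lborel. \<tau> \<noteq> (0::real)" by (rule AE_lborel_singleton)
    then show "AE \<tau> in lborel. (\<lambda>N. ?F \<tau> * (iexp (\<tau> / K * x) * exp (of_nat N * \<psi> (\<tau> / K)))) \<longlonglongrightarrow> 0"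
    proof eventually_elim
      fix \<tau> :: real assume "\<tau> \<noteq> 0"
      then have "Re (\<psi> (\<tau> / K)) < 0" using K by (intro Re_stable_exponent \<beta> \<gamma>) auto
      then have "(\<lambda>N. std_normal_density \<tau> * exp (Re (\<psi> (\<tau> / K))) ^ N) \<longlonglongrightarrow> std_normal_density \<tau> * 0"
        by (intro tendsto_intros LIMSEQ_power_zero) auto
      then show "(\<lambda>N. ?F \<tau> * (iexp (\<tau> / K * x) * exp (of_nat N * \<psi> (\<tau> / K)))) \<longlonglongrightarrow> 0"
        by (subst tendsto_norm_zero_iff[symmetric], unfold n) simp
    qed
    show "AE \<tau> in lborel. norm (?F \<tau> * (iexp (\<tau> / K * x) * exp (of_nat N * \<psi> (\<tau> / K)))) \<le> std_normal_density \<tau>" for N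
    proof (intro AE_I2)
      fix \<tau>
      have "exp (Re (\<psi> (\<tau> / K))) ^ N \<le> 1" using Re_\<psi>[of "\<tau> / K"] by (intro power_le_one) auto
      then show "norm (?F \<tau> * (iexp (\<tau> / K * x) * exp (of_nat N * \<psi> (\<tau> / K)))) \<le> std_normal_density \<tau>"
        unfolding n by (intro mult_left_le) auto
    qed
  qed (use integrable_std_normal_moment[of 0] in auto)
  ultimately have "(\<lambda>N. complex_of_real (\<integral>\<omega>. exp (- ((x + X (real N) \<omega>) / K)\<^sup>2 / 2) \<partial>M)) \<longlonglongrightarrow> of_real 0" by simp
  then show ?thesis by (subst (asm) tendsto_of_real_iff)
qed

lemma H_decay:
  assumes c: "0 \<le> c"
  shows "(\<lambda>N. \<integral>\<omega>. H c (x + X (real N) \<omega>) \<partial>M) \<longlonglongrightarrow> 0"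
  unfolding LIMSEQ_def dist_real_def
proof (intro allI impI)
  fix \<epsilon> :: real assume \<epsilon>: "0 < \<epsilon>"
  note [measurable] = H_measurable[OF c]
  have Xm [measurable]: "X (real N) \<in> borel_measurable M" for N by (rule X_measurable) simp
  obtain K where K: "0 < K" "\<And>y. K < \<bar>y\<bar> \<Longrightarrow> H c y \<le> \<epsilon> / 2" using H_far[OF c, of "\<epsilon> / 2"] \<epsilon> by auto
  \<comment> \<open>On |y| <= K the Gaussian G is at least exp(-1/2), so C G dominates H there;
    beyond K, H is at most \<epsilon>/2.\<close>
  define C where "C = H c 0 * exp (1 / 2)"
  define G where "G = (\<lambda>y. exp (- (y / K)\<^sup>2 / 2))"
  have G1: "0 < G y" "G y \<le> 1" for y by (auto simp: G_def)
  have C0: "0 \<le> C" using H_nonneg[of c 0] by (simp add: C_def)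
  have b: "H c y \<le> \<epsilon> / 2 + C * G y" for y
  proof (cases "K < \<bar>y\<bar>")
    case True
    have "0 \<le> C * G y" using C0 G1(1)[of y] by simp
    then show ?thesis using K(2)[OF True] by linarith
  next
    case False
    then have "(y / K)\<^sup>2 \<le> 1" using K(1) by (simp add: power2_le_iff_abs_le abs_divide abs_square_le_1)
    then have "1 \<le> exp (1 / 2) * G y" unfolding G_def exp_add[symmetric] by simp
    then have "H c 0 * 1 \<le> H c 0 * (exp (1 / 2) * G y)" using H_nonneg[of c 0] by (intro mult_left_mono) auto
    then show ?thesis using H_le_H0[OF c, of y] \<epsilon> by (simp add: C_def mult.assoc)
  qed
  have "(\<lambda>N. C * (\<integral>\<omega>. G (x + X (real N) \<omega>) \<partial>M)) \<longlonglongrightarrow> C * 0"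
    unfolding G_def by (intro tendsto_intros gaussian_decay K)
  then have "\<forall>\<^sub>F N in sequentially. C * (\<integral>\<omega>. G (x + X (real N) \<omega>) \<partial>M) < \<epsilon> / 2" using \<epsilon> by (intro order_tendstoD) auto
  then obtain N0 where N0: "\<And>N. N0 \<le> N \<Longrightarrow> C * (\<integral>\<omega>. G (x + X (real N) \<omega>) \<partial>M) < \<epsilon> / 2" by (auto simp: eventually_sequentially)
  show "\<exists>no. \<forall>n\<ge>no. \<bar>(\<integral>\<omega>. H c (x + X (real n) \<omega>) \<partial>M) - 0\<bar> < \<epsilon>"
  proof (intro exI[of _ N0] allI impI)
    fix n assume n: "N0 \<le> n"
    have Gm [measurable]: "G \<in> borel_measurable borel" unfolding G_def by measurable
    have Gi: "integrable M (\<lambda>\<omega>. G (x + X (real n) \<omega>))"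
      by (rule integrable_const_bound[where B=1]) (use G1 in \<open>auto intro!: AE_I2 simp: abs_of_pos\<close>)
    have Hi: "integrable M (\<lambda>\<omega>. H c (x + X (real n) \<omega>))"
      by (rule integrable_const_bound[where B="H c 0"]) (use H_le_H0[OF c] H_nonneg in \<open>auto intro!: AE_I2\<close>)
    have "(\<integral>\<omega>. H c (x + X (real n) \<omega>) \<partial>M) \<le> (\<integral>\<omega>. \<epsilon> / 2 + C * G (x + X (real n) \<omega>) \<partial>M)"
      using b Hi Gi by (intro integral_mono) auto
    also have "\<dots> = \<epsilon> / 2 + C * (\<integral>\<omega>. G (x + X (real n) \<omega>) \<partial>M)" using Gi by (simp add: prob_space)
    also have "\<dots> < \<epsilon>" using N0[OF n] by simp
    finally have "(\<integral>\<omega>. H c (x + X (real n) \<omega>) \<partial>M) < \<epsilon>" .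
    moreover have "0 \<le> (\<integral>\<omega>. H c (x + X (real n) \<omega>) \<partial>M)" using H_nonneg by (intro integral_nonneg_AE AE_I2) auto
    ultimately show "\<bar>(\<integral>\<omega>. H c (x + X (real n) \<omega>) \<partial>M) - 0\<bar> < \<epsilon>" by simp
  qed
qed

end

section \<open>The hitting probability\<close>

context stable_motion
begin

abbreviation "hits_first x \<equiv> {\<omega>\<in>space M. first_hitting_point X x 0 \<omega> < first_passage_above X x 1 \<omega>}"

lemma H_at_0_pos: "0 < H 1 0"
  using H_1_0 \<alpha> H_nonneg[of 1 0] by (metis less_eq_real_def mult_zero_right zero_neq_one)

section \<open>Inner and outer approximation of the hitting event\<close>

lemma H_opt_integrable:
  assumes c: "0 \<le> c" and T: "opt_time L T"
  shows "integrable M (\<lambda>\<omega>. H c (x + X (T \<omega>) \<omega>))"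
proof (rule integrable_const_bound[where B="H c 0"])
  note [measurable] = X_opt_measurable[OF T] H_measurable[OF c]
  show "(\<lambda>\<omega>. H c (x + X (T \<omega>) \<omega>)) \<in> borel_measurable M" by measurable
qed (use H_le_H0[OF c] H_nonneg in \<open>auto intro!: AE_I2\<close>)

text \<open>The strict comparison of the two infima needs a margin: at time t the path is at 0 < 1,
  so by right-continuity it stays below 1 until some b > t, and the passage time is at least
  b.\<close>

lemma hits_firstI:
  assumes x: "x < 1" "x \<noteq> 0" and \<omega>: "\<omega> \<in> space M" and t: "0 \<le> t" "x + X t \<omega> = 0"
    and below: "\<And>s. 0 \<le> s \<Longrightarrow> s < t \<Longrightarrow> x + X s \<omega> \<le> 1"
  shows "\<omega> \<in> hits_first x"
proof -
  have t0: "0 < t" using t x X_0[OF \<omega>] by (cases "t = 0") auto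
  have "((\<lambda>s. x + X s \<omega>) \<longlongrightarrow> x + X t \<omega>) (at_right t)"
    using X_right_cont[OF \<omega> t(1)] unfolding continuous_within by (intro tendsto_intros)
  then have "\<forall>\<^sub>F s in at_right t. x + X s \<omega> < 1"
    by (rule order_tendstoD) (use t in simp)
  then obtain b where b: "t < b" "\<And>s. t < s \<Longrightarrow> s < b \<Longrightarrow> x + X s \<omega> < 1"
    by (auto simp: eventually_at_right_field)
  have "first_hitting_point X x 0 \<omega> \<le> ereal t"
    unfolding first_hitting_point_def using t0 t by (intro Inf_lower) auto
  also have "ereal t < ereal b" using b by simp
  also have "ereal b \<le> first_passage_above X x 1 \<omega>"
    unfolding first_passage_above_def
  proof (rule Inf_greatest)
    fix z assume "z \<in> ereal ` {t. 0 < t \<and> 1 < x + X t \<omega>}"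
    then obtain s where s: "z = ereal s" "0 < s" "1 < x + X s \<omega>" by auto
    have "\<not> s < b"
    proof
      assume "s < b"
      then show False using below[of s] b(2)[of s] s t by (cases s t rule: linorder_cases) auto
    qed
    then show "ereal b \<le> z" using s by simp
  qed
  finally show ?thesis using \<omega> by simp
qed

text \<open>With neighbourhoods of 0 shrinking, the entry times increase to S, and
  quasi-left-continuity shows that at S, if it is below the cap L, the process is at 0 or at least
  at a. Near and above 1, H is small, and at the cap its mean is small, so H(x) is carried by the
  event of being at 0.\<close>

lemma hits_first_lower:
  assumes x: "x < 1" "x \<noteq> 0" and \<epsilon>: "0 < \<epsilon>"
  shows "\<exists>A\<in>sets M. A \<subseteq> hits_first x \<and> H 1 x / H 1 0 - \<epsilon> \<le> prob A"
proof -
  \<comment> \<open>Two losses of size e occur, above a and at time L; after division by H(0) they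
    add up to \<epsilon>.\<close>
  define e where "e = \<epsilon> * H 1 0 / 2"
  have e: "0 < e" using \<epsilon> H_at_0_pos by (simp add: e_def)
  have c: "(0::real) \<le> 1" by simp
  have "isCont (H 1) 1" using H_continuous[OF c] by (simp add: continuous_on_eq_continuous_at)
  then have "\<forall>\<^sub>F y in at 1. H 1 y < e"
    using H_eq_0[of 1 1] e unfolding isCont_def by (intro order_tendstoD) auto
  then obtain d where d: "0 < d" "\<And>y. y \<noteq> 1 \<Longrightarrow> \<bar>y - 1\<bar> < d \<Longrightarrow> H 1 y < e"
    by (auto simp: eventually_at dist_real_def)
  \<comment> \<open>Within d of 1, so that H <= e on all of [a, oo), yet positive and strictly below
    the cut-off 1.\<close>
  define a where "a = max (1 / 2) (1 - d / 2)"
  have a: "0 < a" "a < 1" using d by (auto simp: a_def)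
  have Ha: "H 1 y \<le> e" if "a \<le> y" for y
  proof (cases "1 \<le> y")
    case True
    then show ?thesis using H_eq_0[of 1 y] e by simp
  next
    case False
    then have "\<bar>y - 1\<bar> < d" using that d by (auto simp: a_def)
    then show ?thesis using d(2)[of y] False by simp
  qed
  have "\<forall>\<^sub>F N in sequentially. (\<integral>\<omega>. H 1 (x + X (real N) \<omega>) \<partial>M) < e"
    using H_decay[OF c] e by (rule order_tendstoD)
  then obtain L where L: "(\<integral>\<omega>. H 1 (x + X (real L) \<omega>) \<partial>M) < e" by (auto simp: eventually_sequentially)
  define \<delta> where "\<delta> = (\<lambda>j. inverse (real (Suc j)))"
  have \<delta>: "0 < \<delta> j" for j by (simp add: \<delta>_def)
  have \<delta>dec: "\<delta> (Suc j) \<le> \<delta> j" for j unfolding \<delta>_def by (rule le_imp_inverse_le) auto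
  have \<delta>lim: "\<delta> \<longlonglongrightarrow> 0" unfolding \<delta>_def by (rule LIMSEQ_inverse_real_of_nat)
  define T where "T = (\<lambda>j. entry_time (target (\<delta> j) a) L x)"
  define S where "S = (\<lambda>\<omega>. SUP j. T j \<omega>)"
  have T: "opt_time L (T j)" for j unfolding T_def by (rule entry_time_opt_time[OF target_open])
  have S: "opt_time L S" unfolding S_def by (rule SUP_opt_time[OF T])
  have inc: "T j \<omega> \<le> T (Suc j) \<omega>" for j \<omega>
    unfolding T_def using \<delta>dec[of j] by (intro entry_time_mono) (auto simp: target_def)
  have TL: "T j \<omega> \<le> real L" for j \<omega> unfolding T_def by (rule entry_time_le_L)
  have bdd: "bdd_above (range (\<lambda>j. T j \<omega>))" for \<omega> using TL by (intro bdd_aboveI[of _ "real L"]) auto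
  have TS: "T j \<omega> \<le> S \<omega>" for j \<omega> unfolding S_def by (rule cSUP_upper[OF _ bdd]) simp
  have SL: "S \<omega> \<le> real L" for \<omega> unfolding S_def using TL by (intro cSUP_least) auto
  have S0: "0 \<le> S \<omega>" for \<omega> using TS[of 0 \<omega>] entry_time_nonneg[of _ L x \<omega>] unfolding T_def by (rule order_trans[rotated])
  note [measurable] = X_opt_measurable[OF T] X_opt_measurable[OF S] H_measurable[OF c]
  have XLm [measurable]: "X (real L) \<in> borel_measurable M" by (rule X_measurable) simp
  have qlc: "AE \<omega> in M. (\<lambda>j. X (T j \<omega>) \<omega>) \<longlonglongrightarrow> X (S \<omega>) \<omega>"
    unfolding S_def by (rule quasi_left_continuous[where T=T, OF T inc])
  have "(\<lambda>j. \<integral>\<omega>. H 1 (x + X (T j \<omega>) \<omega>) \<partial>M) \<longlonglongrightarrow> (\<integral>\<omega>. H 1 (x + X (S \<omega>) \<omega>) \<partial>M)"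
  proof (rule integral_dominated_convergence[where w="\<lambda>_. H 1 0"])
    show "AE \<omega> in M. (\<lambda>j. H 1 (x + X (T j \<omega>) \<omega>)) \<longlonglongrightarrow> H 1 (x + X (S \<omega>) \<omega>)"
      using qlc by eventually_elim (intro H_lim[OF c] tendsto_intros)
    show "AE \<omega> in M. norm (H 1 (x + X (T j \<omega>) \<omega>)) \<le> H 1 0" for j
      using H_le_H0[OF c] H_nonneg by (intro AE_I2) auto
  qed auto
  moreover have "(\<integral>\<omega>. H 1 (x + X (T j \<omega>) \<omega>) \<partial>M) = H 1 x" for j
    by (rule H_harmonic[OF \<delta> a T]) (auto simp: T_def dest: before_entry_time)
  ultimately have ES: "(\<integral>\<omega>. H 1 (x + X (S \<omega>) \<omega>) \<partial>M) = H 1 x"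
    using LIMSEQ_unique[OF tendsto_const] by fastforce
  define A where "A = {\<omega>\<in>space M. x + X (S \<omega>) \<omega> = 0}"
  have A [measurable]: "A \<in> sets M" unfolding A_def by measurable
  have bound: "AE \<omega> in M. H 1 (x + X (S \<omega>) \<omega>) \<le> H 1 0 * indicator A \<omega> + e + H 1 (x + X (real L) \<omega>)"
    using qlc AE_space
  proof eventually_elim
    fix \<omega> assume lim: "(\<lambda>j. X (T j \<omega>) \<omega>) \<longlonglongrightarrow> X (S \<omega>) \<omega>" and \<omega>: "\<omega> \<in> space M"
    have nn: "0 \<le> H 1 0 * indicator A \<omega>" "0 \<le> H 1 (x + X (real L) \<omega>)" using H_nonneg by auto
    show "H 1 (x + X (S \<omega>) \<omega>) \<le> H 1 0 * indicator A \<omega> + e + H 1 (x + X (real L) \<omega>)"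
    proof (cases "S \<omega> = real L")
      case True
      then show ?thesis using nn e by simp
    next
      case False
      then have "T j \<omega> < real L" for j using TS[of j \<omega>] SL[of \<omega>] by linarith
      then have cl: "\<bar>x + X (T j \<omega>) \<omega>\<bar> \<le> \<delta> j \<or> a \<le> x + X (T j \<omega>) \<omega>" for j
        using at_entry_time[OF \<omega>] closure_target unfolding T_def by blast
      let ?y = "x + X (S \<omega>) \<omega>"
      have ylim: "(\<lambda>j. x + X (T j \<omega>) \<omega>) \<longlonglongrightarrow> ?y" by (intro tendsto_intros lim)
      \<comment> \<open>Passage to the limit in \<open>cl\<close>: a position that is nonzero and
        below a would keep the approximating positions farther than \<delta> j from 0 and below
        a.\<close>
      have "?y = 0 \<or> a \<le> ?y"
      proof (rule ccontr)
        assume "\<not> (?y = 0 \<or> a \<le> ?y)"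
        then have y: "0 < \<bar>?y\<bar>" "?y < a" by auto
        have "(\<lambda>j. \<bar>x + X (T j \<omega>) \<omega>\<bar> - \<delta> j) \<longlonglongrightarrow> \<bar>?y\<bar> - 0" by (intro tendsto_intros ylim \<delta>lim)
        then have "\<forall>\<^sub>F j in sequentially. 0 < \<bar>x + X (T j \<omega>) \<omega>\<bar> - \<delta> j" using y by (intro order_tendstoD) auto
        moreover have "\<forall>\<^sub>F j in sequentially. x + X (T j \<omega>) \<omega> < a" using ylim y by (intro order_tendstoD) auto
        ultimately have "\<forall>\<^sub>F j in sequentially. False"
        proof eventually_elim
          fix j assume "0 < \<bar>x + X (T j \<omega>) \<omega>\<bar> - \<delta> j" "x + X (T j \<omega>) \<omega> < a"
          with cl[of j] show False by linarith
        qed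
        then show False by simp
      qed
      then show ?thesis
      proof
        assume "?y = 0"
        then show ?thesis using \<omega> nn e by (simp add: A_def)
      next
        assume "a \<le> ?y"
        then show ?thesis using Ha nn by fastforce
      qed
    qed
  qed
  have Li: "integrable M (\<lambda>\<omega>. H 1 (x + X (real L) \<omega>))"
    by (rule integrable_const_bound[where B="H 1 0"]) (use H_le_H0[OF c] H_nonneg in \<open>auto intro!: AE_I2\<close>)
  have Ii: "integrable M (\<lambda>\<omega>. H 1 0 * indicator A \<omega>)"
    by (intro integrable_mult_right integrable_const_bound[where B=1]) auto
  then have Ai: "integrable M (\<lambda>\<omega>. H 1 0 * indicator A \<omega> + e)" by simp
  have "H 1 x \<le> (\<integral>\<omega>. H 1 0 * indicator A \<omega> + e + H 1 (x + X (real L) \<omega>) \<partial>M)"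
    unfolding ES[symmetric] by (intro integral_mono_AE H_opt_integrable[OF c S] Bochner_Integration.integrable_add[OF Ai Li] bound)
  also have "\<dots> = (\<integral>\<omega>. H 1 0 * indicator A \<omega> + e \<partial>M) + (\<integral>\<omega>. H 1 (x + X (real L) \<omega>) \<partial>M)"
    by (rule Bochner_Integration.integral_add[OF Ai Li])
  also have "(\<integral>\<omega>. H 1 0 * indicator A \<omega> + e \<partial>M) = H 1 0 * prob A + e"
    by (subst Bochner_Integration.integral_add[OF Ii]) (auto simp: prob_space)
  finally have "H 1 x \<le> H 1 0 * prob A + 2 * e" using L by simp
  then have "H 1 x / H 1 0 - \<epsilon> \<le> prob A" using H_at_0_pos by (simp add: e_def field_simps)
  moreover have "A \<subseteq> hits_first x"
  proof
    fix \<omega> assume "\<omega> \<in> A"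
    then have \<omega>: "\<omega> \<in> space M" "x + X (S \<omega>) \<omega> = 0" by (auto simp: A_def)
    show "\<omega> \<in> hits_first x"
    proof (rule hits_firstI[OF x \<omega>(1) S0 \<omega>(2)])
      fix s assume s: "0 \<le> s" "s < S \<omega>"
      \<comment> \<open>Before S the path has not yet entered one of the targets, hence it is at
        most a < 1.\<close>
      then obtain j where "s < T j \<omega>" unfolding S_def by (subst (asm) less_cSUP_iff[OF _ bdd]) auto
      then have "x + X s \<omega> \<notin> target (\<delta> j) a" unfolding T_def by (rule before_entry_time[OF s(1)])
      then show "x + X s \<omega> \<le> 1" using a by (auto simp: target_def)
    qed
  qed
  ultimately show ?thesis using A by blast
qed

text \<open>The target is entered no later than the hitting time t of 0, for any cap L >= t. Up to t
  the path is at most 1 < a, so the entry can only be into the neighbourhood of 0.\<close>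

lemma hits_first_near_0:
  assumes x: "x < 1" and hit: "\<omega> \<in> hits_first x" and a: "1 < a" and \<delta>: "0 < \<delta>"
  shows "\<exists>N. \<forall>L\<ge>N. \<bar>x + X (entry_time (target \<delta> a) L x \<omega>) \<omega>\<bar> \<le> \<delta>"
proof -
  have \<omega>: "\<omega> \<in> space M" and less: "first_hitting_point X x 0 \<omega> < first_passage_above X x 1 \<omega>" using hit by auto
  obtain t where t: "0 < t" "x + X t \<omega> = 0" "ereal t < first_passage_above X x 1 \<omega>"
    using less unfolding first_hitting_point_def by (subst (asm) Inf_less_iff) auto
  have below: "x + X s \<omega> \<le> 1" if "0 \<le> s" "s \<le> t" for s
  proof (rule ccontr)
    assume s: "\<not> x + X s \<omega> \<le> 1"
    then have "0 < s" using that x X_0[OF \<omega>] by (cases "s = 0") auto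
    then have "first_passage_above X x 1 \<omega> \<le> ereal s"
      unfolding first_passage_above_def using s by (intro Inf_lower) auto
    then show False using t(3) that by (meson ereal_less_eq(3) le_less_trans not_less)
  qed
  show ?thesis
  proof (intro exI[of _ "nat \<lceil>t\<rceil>"] allI impI)
    fix L assume "nat \<lceil>t\<rceil> \<le> L"
    then have tL: "t \<le> real L" by linarith
    let ?T = "entry_time (target \<delta> a) L x \<omega>"
    have T: "?T \<le> t" using t \<delta> by (intro entry_time_le) (auto simp: target_def)
    show "\<bar>x + X ?T \<omega>\<bar> \<le> \<delta>"
    proof (cases "?T < real L")
      case True
      from closure_target[OF at_entry_time[OF \<omega> True]] show ?thesis
        using below[OF entry_time_nonneg T] a by auto
    next
      case False
      then have "?T = t" using T tL by linarith
      then show ?thesis using t \<delta> by simp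
    qed
  qed
qed

text \<open>Raising the cut-off to c > 1 makes H harmonic across level 1, so stopping may take place
  beyond 1 at a. On the hitting event the stopped value is close to H(0) for all large L, and
  Markov's inequality bounds the probability.\<close>

lemma hits_first_upper:
  assumes x: "x < 1" and \<epsilon>: "0 < \<epsilon>"
  shows "\<exists>B\<in>sets M. hits_first x \<subseteq> B \<and> prob B \<le> H 1 x / H 1 0 + \<epsilon>"
proof -
  have c1: "(0::real) \<le> 1" by simp
  have "((\<lambda>e. (H 1 x + e) / (H 1 0 - e)) \<longlongrightarrow> (H 1 x + 0) / (H 1 0 - 0)) (at_right 0)"
    using H_at_0_pos by (intro tendsto_intros) auto
  then have "\<forall>\<^sub>F e in at_right 0. (H 1 x + e) / (H 1 0 - e) < H 1 x / H 1 0 + \<epsilon>"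
    using \<epsilon> by (intro order_tendstoD) auto
  moreover have "\<forall>\<^sub>F e in at_right 0. 0 < e \<and> e < H 1 0"
    using H_at_0_pos by (auto simp: eventually_at_right_field)
  ultimately have "\<forall>\<^sub>F e in at_right 0. (H 1 x + e) / (H 1 0 - e) < H 1 x / H 1 0 + \<epsilon> \<and> 0 < e \<and> e < H 1 0"
    by eventually_elim simp
  then obtain e where e: "(H 1 x + e) / (H 1 0 - e) < H 1 x / H 1 0 + \<epsilon>" "0 < e" "e < H 1 0"
    using eventually_happens'[of "at_right (0::real)"] by (auto simp: trivial_limit_at_right_real)
  have "isCont (H 1) 0" using H_continuous[OF c1] by (simp add: continuous_on_eq_continuous_at)
  then have "\<forall>\<^sub>F y in at 0. H 1 0 - e < H 1 y"
    using e unfolding isCont_def by (intro order_tendstoD) auto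
  then obtain d where d: "0 < d" "\<And>y. y \<noteq> 0 \<Longrightarrow> \<bar>y\<bar> < d \<Longrightarrow> H 1 0 - e < H 1 y"
    by (auto simp: eventually_at dist_real_def)
  define \<delta> where "\<delta> = min (d / 2) (1 / 2)"
  have \<delta>: "0 < \<delta>" "\<delta> < 1" using d by (auto simp: \<delta>_def)
  have H\<delta>: "H 1 0 - e \<le> H 1 y" if "\<bar>y\<bar> \<le> \<delta>" for y
    using that d(1) d(2)[of y] e by (cases "y = 0") (auto simp: \<delta>_def)
  define k where "k = (1 - x) powr (\<beta> - 1)"
  have k: "0 < k" using x by (simp add: k_def)
  \<comment> \<open>Raising the cut-off by r increases H at x by at most r k = e, with k the
    derivative bound from \<open>H_level\<close>; a is then placed halfway between 1 and c.\<close>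
  define r where "r = e / k"
  have r: "0 < r" "r * k = e" using e k by (auto simp: r_def)
  define c where "c = 1 + r"
  define a where "a = 1 + r / 2"
  have ac: "1 < a" "a < c" "1 \<le> c" "0 \<le> c" "0 < a" using r by (auto simp: a_def c_def)
  have Hc: "H c x \<le> H 1 x + e" using H_level(2)[OF ac(3) x] r by (simp add: c_def k_def[symmetric])
  define T where "T = (\<lambda>L. entry_time (target \<delta> a) L x)"
  have T: "opt_time L (T L)" for L unfolding T_def by (rule entry_time_opt_time[OF target_open])
  define B where "B = (\<lambda>L. {\<omega>\<in>space M. \<bar>x + X (T L \<omega>) \<omega>\<bar> \<le> \<delta>})"
  have B [measurable]: "B L \<in> sets M" for L
  proof -
    note [measurable] = X_opt_measurable[OF T]
    show ?thesis unfolding B_def by measurable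
  qed
  have PB: "prob (B L) \<le> (H 1 x + e) / (H 1 0 - e)" for L
  proof -
    have "(\<integral>\<omega>. (H 1 0 - e) * indicator (B L) \<omega> \<partial>M) \<le> (\<integral>\<omega>. H c (x + X (T L \<omega>) \<omega>) \<partial>M)"
    proof (intro integral_mono H_opt_integrable[OF ac(4) T])
      show "integrable M (\<lambda>\<omega>. (H 1 0 - e) * indicator (B L) \<omega>)"
        by (intro integrable_mult_right integrable_const_bound[where B=1]) auto
      fix \<omega> assume "\<omega> \<in> space M"
      show "(H 1 0 - e) * indicator (B L) \<omega> \<le> H c (x + X (T L \<omega>) \<omega>)"
      proof (cases "\<omega> \<in> B L")
        case True
        then have y: "\<bar>x + X (T L \<omega>) \<omega>\<bar> \<le> \<delta>" by (simp add: B_def)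
        then have "x + X (T L \<omega>) \<omega> < 1" using \<delta> by linarith
        then show ?thesis using H\<delta>[OF y] H_level(1)[OF ac(3)] True by fastforce
      qed (simp add: H_nonneg)
    qed
    also have "\<dots> = H c x"
      by (rule H_harmonic[OF \<delta>(1) ac(5,2) T]) (auto simp: T_def dest: before_entry_time)
    finally have "(H 1 0 - e) * prob (B L) \<le> H 1 x + e" using Hc by simp
    then show ?thesis using e by (simp add: pos_le_divide_eq mult.commute)
  qed
  \<comment> \<open>The cap from which \<open>hits_first_near_0\<close> applies depends on the path,
    so the covering set consists of the paths that are near 0 for all L from some n on; its
    probability is a limit of values bounded uniformly in n.\<close>
  define C where "C = (\<lambda>n. \<Inter>L\<in>{n..}. B L)"
  have C [measurable]: "C n \<in> sets M" for n unfolding C_def by (intro sets.countable_INT) auto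
  have "incseq C" unfolding C_def by (intro incseq_SucI INF_superset_mono) auto
  then have "(\<lambda>n. prob (C n)) \<longlonglongrightarrow> prob (\<Union>n. C n)"
    by (intro finite_Lim_measure_incseq) auto
  moreover have "prob (C n) \<le> (H 1 x + e) / (H 1 0 - e)" for n
    by (rule order_trans[OF finite_measure_mono PB[of n]]) (auto simp: C_def)
  ultimately have "prob (\<Union>n. C n) \<le> (H 1 x + e) / (H 1 0 - e)"
    by (intro LIMSEQ_le_const2) auto
  moreover have "hits_first x \<subseteq> (\<Union>n. C n)"
  proof
    fix \<omega> assume hit: "\<omega> \<in> hits_first x"
    obtain N where "\<And>L. N \<le> L \<Longrightarrow> \<bar>x + X (T L \<omega>) \<omega>\<bar> \<le> \<delta>"
      using hits_first_near_0[OF x hit ac(1) \<delta>(1)] unfolding T_def by blast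
    then have "\<omega> \<in> C N" using hit by (auto simp: C_def B_def)
    then show "\<omega> \<in> (\<Union>n. C n)" by blast
  qed
  moreover have "(\<Union>n. C n) \<in> sets M" by measurable
  ultimately show ?thesis using e(1) by (intro bexI[of _ "\<Union>n. C n"]) auto
qed

lemma hits_first_probability:
  assumes "x < 1" "x \<noteq> 0"
  shows "measure (completion M) (hits_first x) = (\<beta> + \<gamma> - 1) * H 1 x"
proof -
  have "1 / H 1 0 = \<beta> + \<gamma> - 1" using H_1_0 H_at_0_pos by (simp add: field_simps)
  then have "H 1 x / H 1 0 = (\<beta> + \<gamma> - 1) * H 1 x" by (metis mult.commute times_divide_eq_right mult_1_right)
  then show ?thesis
    using completion_squeeze[of "hits_first x" "H 1 x / H 1 0"] hits_first_lower[OF assms] hits_first_upper[OF assms(1)] by auto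
qed

end

lemma stable_motion_of_strictly_stable:
  assumes X: "strictly_stable_process M X \<alpha> \<rho>" and ad: "admissible \<alpha> \<rho>" and \<alpha>: "1 < \<alpha>" "\<alpha> < 2"
  shows "stable_motion M X (\<alpha> * \<rho>) (\<alpha> * (1 - \<rho>))"
proof -
  note p = stable_parameters[OF ad \<alpha>]
  have l: "levy_process M X" using X by (simp add: strictly_stable_process_def)
  then interpret prob_space M by (simp add: levy_process_def)
  show ?thesis
  proof
    show "levy_process M X" by (rule l)
    show "char (distr M borel (X t)) \<theta> = exp (of_real t * stable_exponent (\<alpha> * \<rho>) (\<alpha> * (1 - \<rho>)) \<theta>)" if "0 \<le> t" for t \<theta>
      by (rule stable_char[OF X ad \<alpha> that])
    show "Re (stable_exponent (\<alpha> * \<rho>) (\<alpha> * (1 - \<rho>)) \<theta>) \<le> 0" for \<theta>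
      using Re_stable_exponent[OF p, of \<theta>] by (cases "\<theta> = 0") auto
    show "1 < \<alpha> * \<rho> + \<alpha> * (1 - \<rho>)" using \<alpha> by (simp add: algebra_simps)
  qed (use p in auto)
qed

theorem theorem1p5:
  fixes M :: "'a measure" and X :: "real \<Rightarrow> 'a \<Rightarrow> real" and \<alpha> \<rho> :: real
  assumes "strictly_stable_process M X \<alpha> \<rho>"
    and "admissible \<alpha> \<rho>"
    and "1 < \<alpha>" and "\<alpha> < 2"
  shows "(\<forall>x. 0 < x \<and> x < 1 \<longrightarrow>
           measure (completion M)
             {\<omega>\<in>space M. first_hitting_point X x 0 \<omega> < first_passage_above X x 1 \<omega>}
           = (\<alpha> - 1) * x powr (\<alpha> - 1) *
             (LINT t:{1..1/x}|lborel. (t - 1) powr (\<alpha> * \<rho> - 1) * t powr (\<alpha> * (1 - \<rho>) - 1)))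
       \<and> (\<forall>x. x < 0 \<longrightarrow>
           measure (completion M)
             {\<omega>\<in>space M. first_hitting_point X x 0 \<omega> < first_passage_above X x 1 \<omega>}
           = (\<alpha> - 1) * (-x) powr (\<alpha> - 1) *
             (LINT t:{1..1 - 1/x}|lborel. (t - 1) powr (\<alpha> * (1 - \<rho>) - 1) * t powr (\<alpha> * \<rho> - 1)))"
proof -
  interpret stable_motion M X "\<alpha> * \<rho>" "\<alpha> * (1 - \<rho>)"
    by (rule stable_motion_of_strictly_stable[OF assms])
  have s: "\<alpha> * \<rho> + \<alpha> * (1 - \<rho>) = \<alpha>" by (simp add: algebra_simps)
  show ?thesis
  proof (intro conjI allI impI)
    fix x :: real assume "0 < x \<and> x < 1"
    then have x: "0 < x" "x < 1" by auto
    then have "x \<noteq> 0" by simp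
    from hits_first_probability[OF x(2) this] show "measure (completion M)
             {\<omega>\<in>space M. first_hitting_point X x 0 \<omega> < first_passage_above X x 1 \<omega>}
           = (\<alpha> - 1) * x powr (\<alpha> - 1) *
             (LINT t:{1..1/x}|lborel. (t - 1) powr (\<alpha> * \<rho> - 1) * t powr (\<alpha> * (1 - \<rho>) - 1))"
      unfolding H_1_pos[OF x] s by (simp only: mult.assoc)
  next
    fix x :: real assume x: "x < 0"
    then have "x < 1" "x \<noteq> 0" by auto
    from hits_first_probability[OF this] show "measure (completion M)
             {\<omega>\<in>space M. first_hitting_point X x 0 \<omega> < first_passage_above X x 1 \<omega>}
           = (\<alpha> - 1) * (-x) powr (\<alpha> - 1) *
             (LINT t:{1..1 - 1/x}|lborel. (t - 1) powr (\<alpha> * (1 - \<rho>) - 1) * t powr (\<alpha> * \<rho> - 1))"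
      unfolding H_1_neg[OF x] s by (simp only: mult.assoc)
  qed
qed

end
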